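(* Let $1/3<\beta\le1/2$, $\gamma>1/\beta$, $\mathbf{X}\in\mathscr{C}^\beta(\mathbb{R}^d)$ an $(\omega,\beta)$-H\"older rough path, $\sigma\in\mathrm{Lip}^{\gamma-1}(\mathbb{R}^n,\mathcal{L}(\mathbb{R}^d,\mathbb{R}^n))$, $\xi\in\mathbb{R}^n$. Let $C:C([0,T],\mathbb{R}^n)\to C([0,T],\mathbb{R}^n)$ be a continuous mapping whose values are bounded variation paths and such that $(C(x)_s)_{0\le s\le t}$ is measurable with respect to $\sigma(\{x_s\}_{0\le s\le t})$ for all $0\le t\le T$. Suppose: (i) for any $x\in C([0,T],\mathbb{R}^n)$ there exists a unique $y\in C([0,T],\mathbb{R}^n)$ with $y=x+C(y)$; put $\tilde C(x)=y-x$; (ii) $\tilde C$ satisfies $(\mathrm{Lip})_{\rho'}$ for some $\rho'$ and $(\mathrm{BV})_{\rho''}$ for some $\rho''$. Consider the equations $$\text{(E1)}\quad Y_t=\xi+\int_0^t\sigma(Y_s)d\mathbf{X}_s+C(Y)_t,\qquad \text{(E2)}\quad Z_t=\xi+\int_0^t\sigma\big(Z_s+\tilde C(Z)_s\big)d\mathbf{X}_s,\quad Z'_t=\sigma(Z_t+\tilde C(Z)_t).$$ (1) There exists a controlled path $Z\in\mathscr{D}^{2\beta}_X(\mathbb{R}^n)$ satisfying (E2), and $Z$ satisfies $$\|Z\|_\beta+\|Z'\|_\beta+\|\tilde C(Z)\|_{1\text{-}var,\beta}+\|R^Z\|_{2\beta}\le K\left\{1+\big(1+\widetilde{|||\mathbf{X}|||}_\beta\big)^{\kappa_1}\omega(0,T)\right\}^{\kappa_2}\widetilde{|||\mathbf{X}|||}_\beta^{\kappa_3}$$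 with positive constants $K,\kappa_1,\kappa_2,\kappa_3$ depending only on $\sigma,\beta,\gamma,\rho''$. Moreover $Y_t=Z_t+\tilde C(Z)_t$ is a solution to (E1). (2) Let $Y$ be a solution to (E1) defined by $Z\in\mathscr{D}^{2\beta}_X(\mathbb{R}^n)$. Then $Z$ is a solution to (E2). Moreover, such a $Z$ is uniquely determined by $Y$. (3) The transformations $Z\mapsto Y$ of (1) and $Y\mapsto Z$ of (2) are inverse to each other, and uniqueness of the solution of (E1) is equivalent to uniqueness of the solution of (E2).
   Context: For a mapping $C:C([0,T],\mathbb{R}^n)\to C([0,T],\mathbb{R}^m)$ and $\rho>0$: $(\mathrm{Lip})_\rho$: $\|C(x)-C(y)\|_{\infty,[0,t]}\le\rho\|x-y\|_{\infty,[0,t]}$ for all $x,y$ and $0\le t\le T$. $(\mathrm{BV})_\rho$: $\|C(x)\|_{1\text{-}var,[s,t]}\le\rho\|x\|_{\infty\text{-}var,[s,t]}$ for all $x$ and $0\le s\le t\le T$. Here $x_{u,v}=x_v-x_u$, $\|x\|_{\infty,[s,t]}=\max_{s\le u\le t}|x_u|$, $\|x\|_{\infty\text{-}var,[s,t]}=\max_{s\le u\le v\le t}|x_{u,v}|$, $\|x\|_{1\text{-}var,[s,t]}$ the total variation. Solution of (E1): $Y$ is a solution if there is $Z\in\mathscr{D}^{2\beta}_X(\mathbb{R}^n)$ such that $Y_t=Z_t+C(Y)_t$, $Z'_t=\sigma(Y_t)$, and $Z_t=\xi+\int_0^t\sigma(Z_s+C(Y)_s)d\mathbf{X}_s$ for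 $0\le t\le T$ ("$Y$ is defined by $Z$"). Fix $T>0$. A control function is a continuous $\omega(s,t)\ge0$, $0\le s\le t\le T$, with $\omega(s,u)+\omega(u,t)\le\omega(s,t)$. $\|x\|_\theta=\inf\{C>0:|x_{u,v}|\le C\omega(u,v)^\theta,\ 0\le u\le v\le T\}$ (likewise for two-parameter functions); $\|x\|_{q\text{-}var,\theta}=\inf\{C>0:\|x\|_{q\text{-}var,[u,v]}\le C\omega(u,v)^\theta,\ 0\le u\le v\le T\}$. $\mathcal{C}^\theta$ is the space of continuous paths with $\|\cdot\|_\theta<\infty$. For $\gamma=m+\theta$ ($m\in\mathbb{N}\cup\{0\}$, $0<\theta\le1$), $\mathrm{Lip}^\gamma(E,F)$ is the set of bounded $f:E\to F$, $m$ times continuously differentiable with bounded derivatives up to order $m$ and $D^mf$ $\theta$-H\"older. $\mathscr{C}^\beta(\mathbb{R}^d)$ is the set of all $(\omega,\beta)$-H\"older rough paths $\mathbf{X}=(X,\mathbb{X})$ ($\omega$ ranging over control functions): Chen's relation, $|X_{s,t}|\le\|X\|_\beta\omega(s,t)^\beta$, $|\mathbb{X}_{s,t}|\le\|\mathbb{X}\|_{2\beta}\omega(s,t)^{2\beta}$. $|||\mathbf{X}|||_\beta=\|X\|_\beta+\sqrt{\|\mathbb{X}\|_{2\beta}}$, $\widetilde{|||\mathbf{X}|||}_\beta=\sum_{i=1}^3|||\mathbf{X}|||_\beta^i$. $\mathscr{D}^{2\beta}_X(\mathbb{R}^n)$: pairs $(Z,Z')\in\mathcal{C}^\beta([0,T],\mathbb{R}^n)\times\mathcal{C}^\beta([0,T],\mathcal{L}(\mathbb{R}^d,\mathbb{R}^n))$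 with $R^Z_{s,t}=Z_t-Z_s-Z'_sX_{s,t}$ satisfying $\|R^Z\|_{2\beta}<\infty$. For $(Z,Z')\in\mathscr{D}^{2\beta}_X$ and a continuous bounded variation path $\Psi$, $\int_s^t\sigma(Z_u+\Psi_u)d\mathbf{X}_u$ is the limit, as the mesh of partitions of $[s,t]$ tends to $0$, of $\sum_i\Xi_{t_{i-1},t_i}$, $\Xi_{s,t}=\sigma(Y_s)X_{s,t}+(D\sigma)(Y_s)Z'_s\mathbb{X}_{s,t}+(D\sigma)(Y_s)\int_s^t\Psi_{s,r}\otimes dX_r$ with $Y=Z+\Psi$ (Young integral in the last term). *)

theory Defs
  imports "HOL-Analysis.Analysis"
begin

section \<open>Paths on a compact interval\<close>

text \<open>
  The space \<open>C([0,T])\<close> with the supremum distance. Its elements are functions on the real line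
  that are \<open>undefined\<close> outside \<open>{0..T}\<close>, so that equality of paths is equality of functions.
\<close>

abbreviation path_metric :: "real \<Rightarrow> (real \<Rightarrow> 'a::real_normed_vector) metric" where
  "path_metric T \<equiv> cfunspace (top_of_set {0..T}) euclidean_metric"

abbreviation cpath :: "real \<Rightarrow> (real \<Rightarrow> 'a::real_normed_vector) set" where
  "cpath T \<equiv> mspace (path_metric T)"

lemma cpath_iff:
  fixes x :: "real \<Rightarrow> 'a::real_normed_vector"
  shows "x \<in> cpath T \<longleftrightarrow> x \<in> extensional {0..T} \<and> continuous_on {0..T} x"
proof -
  have "Metric_space.mbounded UNIV dist (x ` {0..T})" if "continuous_on {0..T} x"
    using compact_imp_bounded[OF compact_continuous_image[OF that compact_Icc]]
    by (simp add: mbounded_iff_bounded)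
  then show ?thesis by auto
qed

definition sup_norm :: "(real \<Rightarrow> 'a::real_normed_vector) \<Rightarrow> real \<Rightarrow> real \<Rightarrow> real" where
  "sup_norm x s t = (SUP u\<in>{s..t}. norm (x u))"

definition sup_variation :: "(real \<Rightarrow> 'a::real_normed_vector) \<Rightarrow> real \<Rightarrow> real \<Rightarrow> real" where
  "sup_variation x s t = (SUP (u, v)\<in>{(u, v). s \<le> u \<and> u \<le> v \<and> v \<le> t}. norm (x v - x u))"

text \<open>
  A partition \<open>s = t\<^sub>0 < \<dots> < t\<^sub>N = t\<close> is the list of its points (\<open>[s]\<close> when \<open>s = t\<close>);
  \<open>mesh_to_0 s t\<close> is the filter of partitions of \<open>[s,t]\<close> whose mesh tends to \<open>0\<close>.
\<close>

definition partitions :: "real \<Rightarrow> real \<Rightarrow> real list set" where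
  "partitions s t = {p. p \<noteq> [] \<and> hd p = s \<and> last p = t \<and> sorted_wrt (<) p}"

definition mesh_less :: "real \<Rightarrow> real list \<Rightarrow> bool" where
  "mesh_less \<delta> p \<longleftrightarrow> (\<forall>i. Suc i < length p \<longrightarrow> p ! Suc i - p ! i < \<delta>)"

definition mesh_to_0 :: "real \<Rightarrow> real \<Rightarrow> real list filter" where
  "mesh_to_0 s t = (INF \<delta>\<in>{0<..}. principal {p \<in> partitions s t. mesh_less \<delta> p})"

lemma eventually_mesh_to_0:
  "eventually P (mesh_to_0 s t) \<longleftrightarrow> (\<exists>\<delta>>0. \<forall>p\<in>partitions s t. mesh_less \<delta> p \<longrightarrow> P p)"
proof -
  have "eventually P (mesh_to_0 s t) \<longleftrightarrow>
      (\<exists>\<delta>\<in>{0<..}. eventually P (principal {p \<in> partitions s t. mesh_less \<delta> p}))"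
    unfolding mesh_to_0_def
  proof (rule eventually_INF_base)
    show "\<exists>c\<in>{0<..}. principal {p \<in> partitions s t. mesh_less c p}
        \<le> inf (principal {p \<in> partitions s t. mesh_less a p})
              (principal {p \<in> partitions s t. mesh_less b p})"
      if "a \<in> {0<..}" "b \<in> {0<..}" for a b :: real
      using that by (intro bexI[of _ "min a b"]) (auto simp: mesh_less_def)
  qed auto
  then show ?thesis by (auto simp: eventually_principal)
qed

definition partition_sum :: "(real \<Rightarrow> real \<Rightarrow> 'a::comm_monoid_add) \<Rightarrow> real list \<Rightarrow> 'a" where
  "partition_sum \<Xi> p = (\<Sum>i<length p - 1. \<Xi> (p ! i) (p ! Suc i))"

text \<open>The total variation; it is \<open>\<infinity>\<close> for paths of unbounded variation.\<close>

definition total_variation :: "(real \<Rightarrow> 'a::real_normed_vector) \<Rightarrow> real \<Rightarrow> real \<Rightarrow> ennreal" where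
  "total_variation x s t =
    (SUP p\<in>partitions s t. partition_sum (\<lambda>u v. ennreal (norm (x v - x u))) p)"

section \<open>Conditions on path-dependent terms\<close>

definition Lip_cond ::
  "real \<Rightarrow> real \<Rightarrow> ((real \<Rightarrow> 'a::euclidean_space) \<Rightarrow> (real \<Rightarrow> 'b::euclidean_space)) \<Rightarrow> bool" where
  "Lip_cond T \<rho> C \<longleftrightarrow> (\<forall>x\<in>cpath T. \<forall>y\<in>cpath T. \<forall>t\<in>{0..T}.
     sup_norm (\<lambda>u. C x u - C y u) 0 t \<le> \<rho> * sup_norm (\<lambda>u. x u - y u) 0 t)"

definition BV_cond ::
  "real \<Rightarrow> real \<Rightarrow> ((real \<Rightarrow> 'a::euclidean_space) \<Rightarrow> (real \<Rightarrow> 'b::euclidean_space)) \<Rightarrow> bool" where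
  "BV_cond T \<rho> C \<longleftrightarrow> (\<forall>x\<in>cpath T. \<forall>s t. 0 \<le> s \<longrightarrow> s \<le> t \<longrightarrow> t \<le> T \<longrightarrow>
     total_variation (C x) s t \<le> ennreal (\<rho> * sup_variation x s t))"

text \<open>The sigma-algebra on \<open>C([0,T])\<close> generated by the evaluations \<open>x \<mapsto> x s\<close>, \<open>0 \<le> s \<le> t\<close>.\<close>

definition path_sigma :: "real \<Rightarrow> real \<Rightarrow> (real \<Rightarrow> 'a::euclidean_space) measure" where
  "path_sigma T t =
    vimage_algebra (cpath T) (\<lambda>x. restrict x {0..t}) (\<Pi>\<^sub>M s\<in>{0..t}. borel)"

definition adapted ::
  "real \<Rightarrow> ((real \<Rightarrow> 'a::euclidean_space) \<Rightarrow> (real \<Rightarrow> 'b::euclidean_space)) \<Rightarrow> bool" where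
  "adapted T C \<longleftrightarrow> (\<forall>t\<in>{0..T}.
     (\<lambda>x. restrict (C x) {0..t}) \<in> measurable (path_sigma T t) (\<Pi>\<^sub>M s\<in>{0..t}. borel))"

text \<open>\<open>implicit_solution T C x y\<close> is \<open>y = x + C(y)\<close>, and \<open>tilde T C x = y - x\<close> for the unique such \<open>y\<close>.\<close>

definition implicit_solution ::
  "real \<Rightarrow> ((real \<Rightarrow> 'a::euclidean_space) \<Rightarrow> (real \<Rightarrow> 'a)) \<Rightarrow> (real \<Rightarrow> 'a) \<Rightarrow> (real \<Rightarrow> 'a) \<Rightarrow> bool" where
  "implicit_solution T C x y \<longleftrightarrow> y \<in> cpath T \<and> (\<forall>t\<in>{0..T}. y t = x t + C y t)"

definition tilde ::
  "real \<Rightarrow> ((real \<Rightarrow> 'a::euclidean_space) \<Rightarrow> (real \<Rightarrow> 'a)) \<Rightarrow> (real \<Rightarrow> 'a) \<Rightarrow> (real \<Rightarrow> 'a)" where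
  "tilde T C x = (\<lambda>t\<in>{0..T}. (THE y. implicit_solution T C x y) t - x t)"

section \<open>Control functions, Hoelder norms and Lipschitz classes\<close>

definition control :: "real \<Rightarrow> (real \<Rightarrow> real \<Rightarrow> real) \<Rightarrow> bool" where
  "control T \<omega> \<longleftrightarrow>
     continuous_on {(s, t). 0 \<le> s \<and> s \<le> t \<and> t \<le> T} (\<lambda>(s, t). \<omega> s t) \<and>
     (\<forall>s t. 0 \<le> s \<longrightarrow> s \<le> t \<longrightarrow> t \<le> T \<longrightarrow> 0 \<le> \<omega> s t) \<and>
     (\<forall>s u t. 0 \<le> s \<longrightarrow> s \<le> u \<longrightarrow> u \<le> t \<longrightarrow> t \<le> T \<longrightarrow> \<omega> s u + \<omega> u t \<le> \<omega> s t)"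

text \<open>
  Norms relative to a control are extended nonnegative reals, with value \<open>\<infinity>\<close> (the infimum of the
  empty set) when no constant is admissible. \<open>holder_norm2\<close> is for two-parameter functions.
\<close>

definition holder_norm2 ::
  "real \<Rightarrow> (real \<Rightarrow> real \<Rightarrow> real) \<Rightarrow> real \<Rightarrow> (real \<Rightarrow> real \<Rightarrow> 'a::real_normed_vector) \<Rightarrow> ennreal" where
  "holder_norm2 T \<omega> \<theta> f =
     (INF c\<in>{c::real. c > 0 \<and> (\<forall>u v. 0 \<le> u \<longrightarrow> u \<le> v \<longrightarrow> v \<le> T \<longrightarrow>
        norm (f u v) \<le> c * \<omega> u v powr \<theta>)}. ennreal c)"

definition holder_norm ::
  "real \<Rightarrow> (real \<Rightarrow> real \<Rightarrow> real) \<Rightarrow> real \<Rightarrow> (real \<Rightarrow> 'a::real_normed_vector) \<Rightarrow> ennreal" where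
  "holder_norm T \<omega> \<theta> x = holder_norm2 T \<omega> \<theta> (\<lambda>u v. x v - x u)"

definition variation_holder_norm ::
  "real \<Rightarrow> (real \<Rightarrow> real \<Rightarrow> real) \<Rightarrow> real \<Rightarrow> (real \<Rightarrow> 'a::real_normed_vector) \<Rightarrow> ennreal" where
  "variation_holder_norm T \<omega> \<theta> x =
     (INF c\<in>{c::real. c > 0 \<and> (\<forall>u v. 0 \<le> u \<longrightarrow> u \<le> v \<longrightarrow> v \<le> T \<longrightarrow>
        total_variation x u v \<le> ennreal (c * \<omega> u v powr \<theta>))}. ennreal c)"

text \<open>
  \<open>nderiv f [h\<^sub>1, \<dots>, h\<^sub>k] x\<close> is the \<open>k\<close>-th Frechet derivative \<open>D\<^sup>k f(x)\<close> evaluated at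
  \<open>h\<^sub>1, \<dots>, h\<^sub>k\<close>. On a finite-dimensional domain, differentiability and continuity of \<open>D\<^sup>k f\<close> in
  the operator norm of multilinear maps amount to the same for every fixed choice of the \<open>h\<^sub>i\<close>.
  Bounds of the form \<open>M * prod_list (map norm hs)\<close> are bounds on that operator norm.
\<close>

primrec nderiv ::
  "('a::real_normed_vector \<Rightarrow> 'b::real_normed_vector) \<Rightarrow> 'a list \<Rightarrow> 'a \<Rightarrow> 'b" where
  "nderiv f [] = f"
| "nderiv f (h # hs) = (\<lambda>x. frechet_derivative (nderiv f hs) (at x) h)"

definition C_k_on_UNIV :: "nat \<Rightarrow> ('a::euclidean_space \<Rightarrow> 'b::real_normed_vector) \<Rightarrow> bool" where
  "C_k_on_UNIV m f \<longleftrightarrow>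
     (\<forall>hs. length hs < m \<longrightarrow> (\<forall>x. nderiv f hs differentiable (at x))) \<and>
     (\<forall>hs. length hs \<le> m \<longrightarrow> continuous_on UNIV (nderiv f hs))"

definition Lip_class :: "real \<Rightarrow> ('a::euclidean_space \<Rightarrow> 'b::real_normed_vector) set" where
  "Lip_class \<gamma> = {f. \<exists>m::nat. \<exists>\<theta>::real. \<gamma> = real m + \<theta> \<and> 0 < \<theta> \<and> \<theta> \<le> 1 \<and>
     C_k_on_UNIV m f \<and>
     (\<exists>M. \<forall>hs x. length hs \<le> m \<longrightarrow>
        norm (nderiv f hs x) \<le> M * prod_list (map norm hs)) \<and>
     (\<exists>H. \<forall>hs x y. length hs = m \<longrightarrow>
        norm (nderiv f hs x - nderiv f hs y) \<le> H * norm (x - y) powr \<theta> * prod_list (map norm hs))}"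

section \<open>Rough paths and controlled paths\<close>

text \<open>The tensor product of \<open>\<real>\<^sup>n\<close> and \<open>\<real>\<^sup>d\<close> is the space of \<open>n \<times> d\<close> matrices.\<close>

definition tensor :: "real^'n \<Rightarrow> real^'d \<Rightarrow> real^'d^'n" where
  "tensor a b = (\<chi> i j. a $ i * b $ j)"

text \<open>
  For linear \<open>B\<close> from \<open>\<real>\<^sup>n\<close> to \<open>L(\<real>\<^sup>d, F)\<close>, \<open>tensor_apply B\<close> is the linear map on the tensor
  product that sends \<open>tensor a b\<close> to \<open>B a b\<close>.
\<close>

definition tensor_apply ::
  "(real^'n \<Rightarrow> ((real^'d) \<Rightarrow>\<^sub>L 'f::real_normed_vector)) \<Rightarrow> real^'d^'n \<Rightarrow> 'f" where
  "tensor_apply B M = (\<Sum>i\<in>UNIV. \<Sum>j\<in>UNIV. M $ i $ j *\<^sub>R blinfun_apply (B (axis i 1)) (axis j 1))"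

definition rough_path ::
  "real \<Rightarrow> (real \<Rightarrow> real \<Rightarrow> real) \<Rightarrow> real \<Rightarrow> (real \<Rightarrow> real^'d) \<Rightarrow> (real \<Rightarrow> real \<Rightarrow> real^'d^'d) \<Rightarrow> bool" where
  "rough_path T \<omega> \<beta> X XX \<longleftrightarrow>
     (\<forall>s u t. 0 \<le> s \<longrightarrow> s \<le> u \<longrightarrow> u \<le> t \<longrightarrow> t \<le> T \<longrightarrow>
        XX s t = XX s u + XX u t + tensor (X u - X s) (X t - X u)) \<and>
     holder_norm T \<omega> \<beta> X < \<infinity> \<and> holder_norm2 T \<omega> (2 * \<beta>) XX < \<infinity>"

definition rough_norm ::
  "real \<Rightarrow> (real \<Rightarrow> real \<Rightarrow> real) \<Rightarrow> real \<Rightarrow> (real \<Rightarrow> real^'d) \<Rightarrow> (real \<Rightarrow> real \<Rightarrow> real^'d^'d) \<Rightarrow> real" where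
  "rough_norm T \<omega> \<beta> X XX =
     enn2real (holder_norm T \<omega> \<beta> X) + sqrt (enn2real (holder_norm2 T \<omega> (2 * \<beta>) XX))"

definition rough_norm_tilde ::
  "real \<Rightarrow> (real \<Rightarrow> real \<Rightarrow> real) \<Rightarrow> real \<Rightarrow> (real \<Rightarrow> real^'d) \<Rightarrow> (real \<Rightarrow> real \<Rightarrow> real^'d^'d) \<Rightarrow> real" where
  "rough_norm_tilde T \<omega> \<beta> X XX = (\<Sum>i=1..3. rough_norm T \<omega> \<beta> X XX ^ i)"

definition remainder ::
  "(real \<Rightarrow> real^'d) \<Rightarrow> (real \<Rightarrow> real^'n) \<Rightarrow> (real \<Rightarrow> ((real^'d) \<Rightarrow>\<^sub>L (real^'n))) \<Rightarrow> real \<Rightarrow> real \<Rightarrow> real^'n" where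
  "remainder X Z Z' s t = Z t - Z s - blinfun_apply (Z' s) (X t - X s)"

definition controlled_paths ::
  "real \<Rightarrow> (real \<Rightarrow> real \<Rightarrow> real) \<Rightarrow> real \<Rightarrow> (real \<Rightarrow> real^'d) \<Rightarrow>
     ((real \<Rightarrow> real^'n) \<times> (real \<Rightarrow> ((real^'d) \<Rightarrow>\<^sub>L (real^'n)))) set" where
  "controlled_paths T \<omega> \<beta> X = {(Z, Z'). Z \<in> cpath T \<and> holder_norm T \<omega> \<beta> Z < \<infinity> \<and>
     Z' \<in> cpath T \<and> holder_norm T \<omega> \<beta> Z' < \<infinity> \<and>
     holder_norm2 T \<omega> (2 * \<beta>) (remainder X Z Z') < \<infinity>}"

section \<open>Integration\<close>

text \<open>The Young integral of \<open>\<Psi>\<^sub>r - \<Psi>\<^sub>s\<close> (tensor) \<open>dX\<^sub>r\<close> over \<open>[s,t]\<close>.\<close>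

definition young_integral ::
  "(real \<Rightarrow> real^'n) \<Rightarrow> (real \<Rightarrow> real^'d) \<Rightarrow> real \<Rightarrow> real \<Rightarrow> real^'d^'n" where
  "young_integral \<Psi> X s t =
     Lim (mesh_to_0 s t) (partition_sum (\<lambda>u v. tensor (\<Psi> u - \<Psi> s) (X v - X u)))"

definition rough_germ ::
  "(real^'n \<Rightarrow> ((real^'d) \<Rightarrow>\<^sub>L (real^'n))) \<Rightarrow> (real \<Rightarrow> real^'d) \<Rightarrow> (real \<Rightarrow> real \<Rightarrow> real^'d^'d) \<Rightarrow>
     (real \<Rightarrow> real^'n) \<Rightarrow> (real \<Rightarrow> ((real^'d) \<Rightarrow>\<^sub>L (real^'n))) \<Rightarrow> (real \<Rightarrow> real^'n) \<Rightarrow>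
     real \<Rightarrow> real \<Rightarrow> real^'n" where
  "rough_germ \<sigma> X XX Z Z' \<Psi> s t =
     (let D\<sigma> = frechet_derivative \<sigma> (at (Z s + \<Psi> s)) in
        blinfun_apply (\<sigma> (Z s + \<Psi> s)) (X t - X s)
      + tensor_apply (\<lambda>v. D\<sigma> (blinfun_apply (Z' s) v)) (XX s t)
      + tensor_apply D\<sigma> (young_integral \<Psi> X s t))"

text \<open>The integral of \<open>\<sigma>(Z\<^sub>u + \<Psi>\<^sub>u)\<close> against the rough path over \<open>[s,t]\<close> exists and equals \<open>I\<close>.\<close>

definition has_rough_integral ::
  "(real^'n \<Rightarrow> ((real^'d) \<Rightarrow>\<^sub>L (real^'n))) \<Rightarrow> (real \<Rightarrow> real^'d) \<Rightarrow> (real \<Rightarrow> real \<Rightarrow> real^'d^'d) \<Rightarrow>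
     (real \<Rightarrow> real^'n) \<Rightarrow> (real \<Rightarrow> ((real^'d) \<Rightarrow>\<^sub>L (real^'n))) \<Rightarrow> (real \<Rightarrow> real^'n) \<Rightarrow>
     real \<Rightarrow> real \<Rightarrow> real^'n \<Rightarrow> bool" where
  "has_rough_integral \<sigma> X XX Z Z' \<Psi> s t I \<longleftrightarrow>
     (partition_sum (rough_germ \<sigma> X XX Z Z' \<Psi>) \<longlongrightarrow> I) (mesh_to_0 s t)"

section \<open>The two equations\<close>

definition E1_defined_by ::
  "real \<Rightarrow> (real \<Rightarrow> real \<Rightarrow> real) \<Rightarrow> real \<Rightarrow> (real \<Rightarrow> real^'d) \<Rightarrow> (real \<Rightarrow> real \<Rightarrow> real^'d^'d) \<Rightarrow>
     (real^'n \<Rightarrow> ((real^'d) \<Rightarrow>\<^sub>L (real^'n))) \<Rightarrow> real^'n \<Rightarrow>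
     ((real \<Rightarrow> real^'n) \<Rightarrow> (real \<Rightarrow> real^'n)) \<Rightarrow>
     (real \<Rightarrow> real^'n) \<Rightarrow> (real \<Rightarrow> real^'n) \<times> (real \<Rightarrow> ((real^'d) \<Rightarrow>\<^sub>L (real^'n))) \<Rightarrow> bool" where
  "E1_defined_by T \<omega> \<beta> X XX \<sigma> \<xi> C Y = (\<lambda>(Z, Z').
     Y \<in> cpath T \<and> (Z, Z') \<in> controlled_paths T \<omega> \<beta> X \<and>
     (\<forall>t\<in>{0..T}. Y t = Z t + C Y t \<and> Z' t = \<sigma> (Y t) \<and>
        has_rough_integral \<sigma> X XX Z Z' (C Y) 0 t (Z t - \<xi>)))"

definition E1_solutions ::
  "real \<Rightarrow> (real \<Rightarrow> real \<Rightarrow> real) \<Rightarrow> real \<Rightarrow> (real \<Rightarrow> real^'d) \<Rightarrow> (real \<Rightarrow> real \<Rightarrow> real^'d^'d) \<Rightarrow>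
     (real^'n \<Rightarrow> ((real^'d) \<Rightarrow>\<^sub>L (real^'n))) \<Rightarrow> real^'n \<Rightarrow>
     ((real \<Rightarrow> real^'n) \<Rightarrow> (real \<Rightarrow> real^'n)) \<Rightarrow> (real \<Rightarrow> real^'n) set" where
  "E1_solutions T \<omega> \<beta> X XX \<sigma> \<xi> C = {Y. \<exists>P. E1_defined_by T \<omega> \<beta> X XX \<sigma> \<xi> C Y P}"

definition E2_solutions ::
  "real \<Rightarrow> (real \<Rightarrow> real \<Rightarrow> real) \<Rightarrow> real \<Rightarrow> (real \<Rightarrow> real^'d) \<Rightarrow> (real \<Rightarrow> real \<Rightarrow> real^'d^'d) \<Rightarrow>
     (real^'n \<Rightarrow> ((real^'d) \<Rightarrow>\<^sub>L (real^'n))) \<Rightarrow> real^'n \<Rightarrow>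
     ((real \<Rightarrow> real^'n) \<Rightarrow> (real \<Rightarrow> real^'n)) \<Rightarrow>
     ((real \<Rightarrow> real^'n) \<times> (real \<Rightarrow> ((real^'d) \<Rightarrow>\<^sub>L (real^'n)))) set" where
  "E2_solutions T \<omega> \<beta> X XX \<sigma> \<xi> C = {(Z, Z').
     (Z, Z') \<in> controlled_paths T \<omega> \<beta> X \<and>
     (\<forall>t\<in>{0..T}. Z' t = \<sigma> (Z t + tilde T C Z t) \<and>
        has_rough_integral \<sigma> X XX Z Z' (tilde T C Z) 0 t (Z t - \<xi>))}"

definition Z_to_Y ::
  "real \<Rightarrow> ((real \<Rightarrow> real^'n) \<Rightarrow> (real \<Rightarrow> real^'n)) \<Rightarrow>
     (real \<Rightarrow> real^'n) \<times> (real \<Rightarrow> ((real^'d) \<Rightarrow>\<^sub>L (real^'n))) \<Rightarrow> (real \<Rightarrow> real^'n)" where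
  "Z_to_Y T C = (\<lambda>(Z, Z'). \<lambda>t\<in>{0..T}. Z t + tilde T C Z t)"

text \<open>The controlled path that defines the solution \<open>Y\<close> of the first equation.\<close>

definition Y_to_Z ::
  "real \<Rightarrow> (real \<Rightarrow> real \<Rightarrow> real) \<Rightarrow> real \<Rightarrow> (real \<Rightarrow> real^'d) \<Rightarrow> (real \<Rightarrow> real \<Rightarrow> real^'d^'d) \<Rightarrow>
     (real^'n \<Rightarrow> ((real^'d) \<Rightarrow>\<^sub>L (real^'n))) \<Rightarrow> real^'n \<Rightarrow>
     ((real \<Rightarrow> real^'n) \<Rightarrow> (real \<Rightarrow> real^'n)) \<Rightarrow>
     (real \<Rightarrow> real^'n) \<Rightarrow> (real \<Rightarrow> real^'n) \<times> (real \<Rightarrow> ((real^'d) \<Rightarrow>\<^sub>L (real^'n)))" where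
  "Y_to_Z T \<omega> \<beta> X XX \<sigma> \<xi> C Y = (THE P. E1_defined_by T \<omega> \<beta> X XX \<sigma> \<xi> C Y P)"

end

theory Submission
  imports Defs "HOL-Complex_Analysis.Great_Picard"
begin

text \<open>
  The correspondence between the two equations is pure algebra: if \<open>Y\<close> is defined by \<open>Z\<close>, then \<open>Y\<close>
  is the unique solution of \<open>y = Z + C(y)\<close>, so the transformed drift of \<open>Z\<close> is \<open>C(Y)\<close>.

  Existence is proved with an Euler scheme in the manner of Davie instead of a fixed point theorem.
  After rescaling the control by \<open>r\<^sup>1\<^sup>/\<^sup>\<beta>\<close>, where \<open>r\<close> is the norm of the rough path, one has
  \<open>|X\<^sub>s\<^sub>t| \<le> w(s,t)\<^sup>\<beta>\<close> and likewise with \<open>2\<beta>\<close> for the second level. Let \<open>E\<close> be the germ without its Young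
  term and \<open>V\<close> the variation of the drift. Bisecting with respect to \<open>w\<close> shows, by induction on the
  number of steps, that on intervals of small control the scheme deviates from \<open>E\<close> by at most
  \<open>D w\<^sup>p + D' V w\<^sup>\<beta>\<close> with \<open>p = (2 + \<theta>)\<beta> > 1\<close>. The bound on \<open>V\<close> by the oscillation of the path closes the
  estimate, and dyadic chopping makes it global at the cost of a factor linear in \<open>w(0,T)\<close>.

  By Arzela-Ascoli the schemes have a limit point. \<open>V\<close> need not converge, but the deviations
  sum along any partition to at most \<open>D max w\<^sup>p\<^sup>-\<^sup>1 w(0,T) + D' max w\<^sup>\<beta> V(0,T)\<close> uniformly in the scheme, which
  identifies the limit as a rough integral without a sewing lemma.
\<close>

section \<open>Control functions and norms\<close>

text \<open>The drift is Lipschitz only in the supremum norm: nothing bounds the variation of a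
  difference of two drifts by the distance of the paths. A contraction argument in a variation norm
  therefore has nothing to work with, and no step below compares variations along different paths.
  What is used instead is superadditivity of V. When w is halved, two terms w^p contribute the
  factor 2 * 2^(-p) < 1, whereas two terms V w^\<beta> contribute only 2^(-\<beta>), because the two
  values of V add up to at most V of the whole interval. Both parts of the deviation thus contract,
  although w^\<beta> alone has too small an exponent to be summed. For the same reason the Young
  terms, of size V w^\<beta>, disappear from the limit of the sums, so the scheme may leave them
  out.

  The supremum Lipschitz constant enters only qualitatively, through causality of the scheme and the
  passage to the limit. It stays out of the estimates, whose constants are fixed before the driver
  is.\<close>

lemma control_nonneg: "control T \<omega> \<Longrightarrow> 0 \<le> s \<Longrightarrow> s \<le> t \<Longrightarrow> t \<le> T \<Longrightarrow> 0 \<le> \<omega> s t"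
  by (simp add: control_def)

lemma control_superadd:
  "control T \<omega> \<Longrightarrow> 0 \<le> s \<Longrightarrow> s \<le> u \<Longrightarrow> u \<le> t \<Longrightarrow> t \<le> T \<Longrightarrow> \<omega> s u + \<omega> u t \<le> \<omega> s t"
  by (simp add: control_def)

lemma control_diag: "control T \<omega> \<Longrightarrow> 0 \<le> s \<Longrightarrow> s \<le> T \<Longrightarrow> \<omega> s s = 0"
  using control_superadd[of T \<omega> s s s] control_nonneg[of T \<omega> s s] by simp

lemma control_mono:
  assumes "control T \<omega>" "0 \<le> s'" "s' \<le> s" "s \<le> t" "t \<le> t'" "t' \<le> T"
  shows "\<omega> s t \<le> \<omega> s' t'"
proof -
  have "\<omega> s' s + \<omega> s t' \<le> \<omega> s' t'" "\<omega> s t + \<omega> t t' \<le> \<omega> s t'"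
    using assms by (auto intro!: control_superadd)
  moreover have "0 \<le> \<omega> s' s" "0 \<le> \<omega> t t'"
    using assms by (auto intro!: control_nonneg[OF assms(1)])
  ultimately show ?thesis by linarith
qed

lemma control_scale:
  assumes "control T \<omega>" "0 \<le> c"
  shows "control T (\<lambda>s t. c * \<omega> s t)"
proof -
  have "continuous_on {(s, t). 0 \<le> s \<and> s \<le> t \<and> t \<le> T} (\<lambda>z. c * (\<lambda>(s, t). \<omega> s t) z)"
    using assms by (intro continuous_intros) (simp add: control_def)
  then show ?thesis
    using assms unfolding control_def
    by (auto simp: case_prod_beta' distrib_left[symmetric] intro!: mult_left_mono)
qed

text \<open>With the exponent 1 / \<beta> the factor r leaves the first level linearly and the
  second quadratically, in line with the homogeneous norm of a rough path, so one rescaled control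
  serves both levels. The case r = 0 is covered because 0 powr a is 0.\<close>

lemma powr_scaled_control:
  assumes "0 < \<beta>" "0 \<le> r" "0 \<le> (a::real)"
  shows "(r powr (1 / \<beta>) * a) powr \<beta> = r * a powr \<beta>" "(r powr (1 / \<beta>) * a) powr (2 * \<beta>) = r\<^sup>2 * a powr (2 * \<beta>)"
proof -
  have "(r powr (1 / \<beta>)) powr \<beta> = r" using assms by (simp add: powr_powr)
  then show 1: "(r powr (1 / \<beta>) * a) powr \<beta> = r * a powr \<beta>"
    using assms by (simp add: powr_mult)
  have sq: "b powr (2 * \<beta>) = b powr \<beta> * b powr \<beta>" for b :: real by (simp add: powr_add[symmetric])
  show "(r powr (1 / \<beta>) * a) powr (2 * \<beta>) = r\<^sup>2 * a powr (2 * \<beta>)"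
    unfolding sq 1 by (simp add: power2_eq_square mult_ac)
qed

lemma compact_triangle: "compact {(s::real, t). 0 \<le> s \<and> s \<le> t \<and> t \<le> T}"
proof -
  have "{(s::real, t). 0 \<le> s \<and> s \<le> t \<and> t \<le> T}
      = ({0..T} \<times> {0..T}) \<inter> {z. fst z \<le> snd z}" by auto
  moreover have "closed {z::real\<times>real. fst z \<le> snd z}"
    by (intro closed_Collect_le continuous_intros)
  ultimately show ?thesis
    by (metis compact_Int_closed compact_Times compact_Icc)
qed

text \<open>Superadditivity forces \<omega> to vanish on the diagonal. Uniform continuity on the
  compact triangle, used at (s, s), gives a width that works for all s at once.\<close>

lemma control_small:
  assumes c: "control T \<omega>" and e: "0 < e"
  obtains d where "0 < d"
    "\<And>s t. 0 \<le> s \<Longrightarrow> s \<le> t \<Longrightarrow> t \<le> T \<Longrightarrow> t - s < d \<Longrightarrow> \<omega> s t < e"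
proof -
  let ?\<Delta> = "{(s, t). 0 \<le> s \<and> s \<le> t \<and> t \<le> T}"
  have "uniformly_continuous_on ?\<Delta> (\<lambda>(s, t). \<omega> s t)"
    using c compact_triangle by (intro compact_uniformly_continuous) (auto simp: control_def)
  then obtain d where d: "0 < d" "\<And>x y. x \<in> ?\<Delta> \<Longrightarrow> y \<in> ?\<Delta> \<Longrightarrow> dist y x < d \<Longrightarrow>
      dist ((\<lambda>(s, t). \<omega> s t) y) ((\<lambda>(s, t). \<omega> s t) x) < e"
    unfolding uniformly_continuous_on_def using e by blast
  have "\<omega> s t < e" if "0 \<le> s" "s \<le> t" "t \<le> T" "t - s < d" for s t
    using d(2)[of "(s, s)" "(s, t)"] that control_diag[OF c, of s]
    by (auto simp: dist_Pair_Pair dist_real_def)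
  then show thesis using d(1) that by blast
qed

lemma control_tendsto:
  assumes c: "control T \<omega>" and st: "0 \<le> s" "s \<le> t" "t \<le> T"
    and a: "a \<longlonglongrightarrow> s" "b \<longlonglongrightarrow> t" "\<And>n. 0 \<le> a n" "\<And>n. a n \<le> b n" "\<And>n. b n \<le> T"
  shows "(\<lambda>n. \<omega> (a n) (b n)) \<longlonglongrightarrow> \<omega> s t"
proof -
  have "((\<lambda>(s, t). \<omega> s t) \<longlongrightarrow> (\<lambda>(s, t). \<omega> s t) (s, t))
      (at (s, t) within {(s, t). 0 \<le> s \<and> s \<le> t \<and> t \<le> T})"
    using c st unfolding control_def continuous_on_def by blast
  then have "continuous (at (s, t) within {(s, t). 0 \<le> s \<and> s \<le> t \<and> t \<le> T}) (\<lambda>(s, t). \<omega> s t)"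
    by (simp add: continuous_within)
  then have "(\<lambda>n. (\<lambda>(s, t). \<omega> s t) (a n, b n)) \<longlonglongrightarrow> (\<lambda>(s, t). \<omega> s t) (s, t)"
    by (rule continuous_within_tendsto_compose') (use a in \<open>auto intro!: tendsto_Pair\<close>)
  then show ?thesis by simp
qed

text \<open>Serves both controls and variations of drifts. Points may coincide, as happens when a
  partition is rounded to a grid. The ordering of the end points is carried along because the
  induction step needs it.\<close>

lemma superadditive_sum_le:
  fixes W :: "real \<Rightarrow> real \<Rightarrow> real"
  assumes sup: "\<And>s u t. lo \<le> s \<Longrightarrow> s \<le> u \<Longrightarrow> u \<le> t \<Longrightarrow> t \<le> hi \<Longrightarrow> W s u + W u t \<le> W s t"
    and pos: "\<And>s t. lo \<le> s \<Longrightarrow> s \<le> t \<Longrightarrow> t \<le> hi \<Longrightarrow> 0 \<le> W s t"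
    and x: "\<And>i. i < m \<Longrightarrow> x i \<le> x (Suc i)" "lo \<le> x 0" "x m \<le> hi"
  shows "(\<Sum>i<m. W (x i) (x (Suc i))) \<le> W (x 0) (x m) \<and> x 0 \<le> x m"
  using x
proof (induction m)
  case 0
  then show ?case using pos[of "x 0" "x 0"] by simp
next
  case (Suc m)
  have "x m \<le> x (Suc m)" using Suc.prems by simp
  then have "(\<Sum>i<m. W (x i) (x (Suc i))) \<le> W (x 0) (x m) \<and> x 0 \<le> x m"
    using Suc.prems by (intro Suc.IH) (auto intro: order_trans)
  moreover have "W (x 0) (x m) + W (x m) (x (Suc m)) \<le> W (x 0) (x (Suc m))"
    using calculation Suc.prems \<open>x m \<le> x (Suc m)\<close> by (intro sup) auto
  ultimately show ?case using \<open>x m \<le> x (Suc m)\<close> by simp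
qed

text \<open>The infimum runs over positive constants, but c = 0 must be allowed, for instance when
  the rough path has norm 0. Hence c + e is taken as the admissible constant and e is sent to
  0.\<close>

lemma holder_norm2_le:
  assumes "0 \<le> c" "\<And>u v. 0 \<le> u \<Longrightarrow> u \<le> v \<Longrightarrow> v \<le> T \<Longrightarrow> norm (f u v) \<le> c * \<omega> u v powr \<theta>"
  shows "holder_norm2 T \<omega> \<theta> f \<le> ennreal c"
proof (rule ennreal_le_epsilon)
  fix e :: real assume "0 < e"
  have "norm (f u v) \<le> (c + e) * \<omega> u v powr \<theta>" if "0 \<le> u" "u \<le> v" "v \<le> T" for u v
    using assms(2)[OF that] \<open>0 < e\<close> by (simp add: distrib_right add_increasing2)
  then have "holder_norm2 T \<omega> \<theta> f \<le> ennreal (c + e)"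
    unfolding holder_norm2_def using assms(1) \<open>0 < e\<close> by (intro INF_lower) auto
  then show "holder_norm2 T \<omega> \<theta> f \<le> ennreal c + ennreal e"
    using assms(1) \<open>0 < e\<close> by simp
qed

lemma variation_holder_norm_le:
  assumes "0 \<le> c"
    "\<And>u v. 0 \<le> u \<Longrightarrow> u \<le> v \<Longrightarrow> v \<le> T \<Longrightarrow> total_variation x u v \<le> ennreal (c * \<omega> u v powr \<theta>)"
  shows "variation_holder_norm T \<omega> \<theta> x \<le> ennreal c"
proof (rule ennreal_le_epsilon)
  fix e :: real assume "0 < e"
  have "total_variation x u v \<le> ennreal ((c + e) * \<omega> u v powr \<theta>)" if "0 \<le> u" "u \<le> v" "v \<le> T" for u v
    using \<open>0 < e\<close> by (intro order.trans[OF assms(2)[OF that]] ennreal_leI) (simp add: distrib_right)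
  then have "variation_holder_norm T \<omega> \<theta> x \<le> ennreal (c + e)"
    unfolding variation_holder_norm_def using assms(1) \<open>0 < e\<close> by (intro INF_lower) auto
  then show "variation_holder_norm T \<omega> \<theta> x \<le> ennreal c + ennreal e"
    using assms(1) \<open>0 < e\<close> by simp
qed

text \<open>A finite infimum is attained: admissible constants may be enlarged, so the infimum plus
  e is admissible, and the inequality survives the limit e to 0.\<close>

lemma holder_norm2_bound:
  assumes fin: "holder_norm2 T \<omega> \<theta> f < \<infinity>" and uv: "0 \<le> u" "u \<le> v" "v \<le> T"
  shows "norm (f u v) \<le> enn2real (holder_norm2 T \<omega> \<theta> f) * \<omega> u v powr \<theta>"
proof -
  let ?h = "enn2real (holder_norm2 T \<omega> \<theta> f)"
  have "norm (f u v) \<le> (?h + e) * \<omega> u v powr \<theta>" if e: "0 < e" for e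
  proof -
    have "holder_norm2 T \<omega> \<theta> f < ennreal (?h + e)"
      using fin e by (subst ennreal_enn2real[of "holder_norm2 T \<omega> \<theta> f", symmetric])
        (auto simp: less_top intro!: ennreal_lessI)
    then obtain c where c: "c > 0" "\<forall>u v. 0 \<le> u \<longrightarrow> u \<le> v \<longrightarrow> v \<le> T \<longrightarrow>
        norm (f u v) \<le> c * \<omega> u v powr \<theta>" "ennreal c < ennreal (?h + e)"
      unfolding holder_norm2_def INF_less_iff by auto
    then have "c \<le> ?h + e" by (metis ennreal_less_iff less_imp_le)
    then have "c * \<omega> u v powr \<theta> \<le> (?h + e) * \<omega> u v powr \<theta>" by (intro mult_right_mono) auto
    with c(2) uv show ?thesis by (meson order_trans)
  qed
  then have "\<forall>\<^sub>F e in at_right 0. norm (f u v) \<le> (?h + e) * \<omega> u v powr \<theta>"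
    by (simp add: eventually_at_right_less eventually_mono[OF eventually_at_right_less])
  moreover have "((\<lambda>e. (?h + e) * \<omega> u v powr \<theta>) \<longlongrightarrow> (?h + 0) * \<omega> u v powr \<theta>) (at_right 0)"
    by (intro tendsto_intros)
  ultimately show ?thesis
    by (intro tendsto_lowerbound[of "\<lambda>e. (?h + e) * \<omega> u v powr \<theta>" _ "at_right 0"]) auto
qed

section \<open>Partitions and total variation\<close>

lemma partitions_props:
  assumes "p \<in> partitions s t"
  shows "0 < length p" "p ! 0 = s" "p ! (length p - 1) = t"
    and "\<And>i. Suc i < length p \<Longrightarrow> p ! i < p ! Suc i"
    and "\<And>i. i < length p \<Longrightarrow> s \<le> p ! i \<and> p ! i \<le> t"
proof -
  show *: "0 < length p" "p ! 0 = s" "p ! (length p - 1) = t"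
    using assms by (auto simp: partitions_def hd_conv_nth last_conv_nth)
  have srt: "sorted_wrt (<) p" using assms by (simp add: partitions_def)
  show "p ! i < p ! Suc i" if "Suc i < length p" for i
    using srt that by (auto simp: sorted_wrt_iff_nth_less)
  have "p ! i \<le> p ! j" if "i \<le> j" "j < length p" for i j
    using srt that by (cases "i = j") (auto simp: sorted_wrt_iff_nth_less less_imp_le)
  from this[of 0] this[of _ "length p - 1"] show "s \<le> p ! i \<and> p ! i \<le> t" if "i < length p" for i
    using that * by auto
qed

lemma partition_cell:
  assumes "p \<in> partitions s t" "i < length p - 1"
  shows "s \<le> p ! i" "p ! i \<le> p ! Suc i" "p ! Suc i \<le> t" "mesh_less d p \<Longrightarrow> p ! Suc i - p ! i < d"
proof -
  have "Suc i < length p" using assms(2) by linarith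
  then show "s \<le> p ! i" "p ! i \<le> p ! Suc i" "p ! Suc i \<le> t" "mesh_less d p \<Longrightarrow> p ! Suc i - p ! i < d"
    using partitions_props(4,5)[OF assms(1)] by (auto simp: mesh_less_def less_imp_le)
qed

lemma partition_sum_Cons:
  fixes \<Xi> :: "real \<Rightarrow> real \<Rightarrow> 'a::comm_monoid_add"
  shows "partition_sum \<Xi> (x # y # p) = \<Xi> x y + partition_sum \<Xi> (y # p)"
  by (simp add: partition_sum_def sum.lessThan_Suc_shift del: sum.lessThan_Suc)

lemma partition_sum_singleton: "partition_sum \<Xi> [x] = 0"
  by (simp add: partition_sum_def)

lemma partition_sum_append:
  fixes \<Xi> :: "real \<Rightarrow> real \<Rightarrow> 'a::comm_monoid_add"
  assumes "p \<noteq> []"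
  shows "partition_sum \<Xi> (p @ q) = partition_sum \<Xi> p + partition_sum \<Xi> (last p # q)"
  using assms
proof (induction p rule: list_nonempty_induct)
  case (single x)
  then show ?case by (simp add: partition_sum_singleton)
next
  case (cons x p)
  then obtain y r where p: "p = y # r" by (cases p) auto
  from cons.IH show ?case unfolding p by (simp add: partition_sum_Cons add.assoc)
qed

text \<open>\<open>tl q\<close> removes the common point u, which strict sortedness would not allow
  twice.\<close>

lemma partitions_append:
  assumes p: "p \<in> partitions s u" and q: "q \<in> partitions u t"
  shows "p @ tl q \<in> partitions s t"
proof -
  obtain r where r: "q = u # r" using q by (cases q) (auto simp: partitions_def)
  have "x \<le> u" if "x \<in> set p" for x
    using that partitions_props(5)[OF p] by (auto simp: in_set_conv_nth)
  then show ?thesis using p q r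
    by (force simp: partitions_def sorted_wrt_append)
qed

lemma partition_sum_concat:
  fixes \<Xi> :: "real \<Rightarrow> real \<Rightarrow> 'a::comm_monoid_add"
  assumes p: "p \<in> partitions s u" and q: "q \<in> partitions u t"
  shows "partition_sum \<Xi> (p @ tl q) = partition_sum \<Xi> p + partition_sum \<Xi> q"
proof -
  have "last p # tl q = q" "p \<noteq> []" using p q by (cases q; auto simp: partitions_def)+
  then show ?thesis by (metis partition_sum_append)
qed

lemma ex_partition: "s \<le> t \<Longrightarrow> (if s = t then [s] else [s, t]) \<in> partitions s t"
  by (simp add: partitions_def)

lemma partition_sum_superadditive:
  fixes W :: "real \<Rightarrow> real \<Rightarrow> real"
  assumes sup: "\<And>s u t. lo \<le> s \<Longrightarrow> s \<le> u \<Longrightarrow> u \<le> t \<Longrightarrow> t \<le> hi \<Longrightarrow> W s u + W u t \<le> W s t"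
    and pos: "\<And>s t. lo \<le> s \<Longrightarrow> s \<le> t \<Longrightarrow> t \<le> hi \<Longrightarrow> 0 \<le> W s t"
    and p: "p \<in> partitions s t" "lo \<le> s" "t \<le> hi"
  shows "partition_sum W p \<le> W s t"
proof -
  have "(\<Sum>i<length p - 1. W (p ! i) (p ! Suc i)) \<le> W (p ! 0) (p ! (length p - 1)) \<and> p ! 0 \<le> p ! (length p - 1)"
  proof (rule superadditive_sum_le[OF sup pos])
    show "p ! i \<le> p ! Suc i" if "i < length p - 1" for i
    proof -
      from that have "Suc i < length p" by linarith
      then show ?thesis by (simp add: partitions_props(4)[OF p(1)] less_imp_le)
    qed
  qed (use partitions_props(2,3)[OF p(1)] p in auto)
  then show ?thesis
    using partitions_props(2,3)[OF p(1)] by (simp add: partition_sum_def)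
qed

lemma partition_sum_increment:
  fixes f :: "real \<Rightarrow> 'a::real_normed_vector"
  assumes "p \<in> partitions s t"
  shows "partition_sum (\<lambda>u v. f v - f u) p = f t - f s"
  using partitions_props(2,3)[OF assms] sum_lessThan_telescope[of "\<lambda>i. f (p ! i)" "length p - 1"]
  by (simp add: partition_sum_def)

lemma total_variation_superadd:
  assumes "s \<le> u" "u \<le> t"
  shows "total_variation x s u + total_variation x u t \<le> total_variation x s t"
proof -
  let ?S = "partition_sum (\<lambda>u v. ennreal (norm (x v - x u)))"
  have ne: "partitions s u \<noteq> {}" "partitions u t \<noteq> {}"
    using ex_partition[OF assms(1)] ex_partition[OF assms(2)] by blast+
  have "total_variation x s u + total_variation x u t
      = (SUP p\<in>partitions s u. ?S p + total_variation x u t)"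
    unfolding total_variation_def[of x s u] using ne(1) by (rule ennreal_SUP_add_left[symmetric])
  also have "\<dots> \<le> total_variation x s t"
  proof (rule SUP_least)
    fix p assume p: "p \<in> partitions s u"
    have "?S p + total_variation x u t = (SUP q\<in>partitions u t. ?S p + ?S q)"
      unfolding total_variation_def[of x u t]
      using ne(2) by (rule ennreal_SUP_add_right)
    also have "\<dots> \<le> total_variation x s t"
    proof (rule SUP_least)
      fix q assume q: "q \<in> partitions u t"
      show "?S p + ?S q \<le> total_variation x s t"
        unfolding partition_sum_concat[OF p q, symmetric] total_variation_def
        by (intro SUP_upper partitions_append[OF p q])
    qed
    finally show "?S p + total_variation x u t \<le> total_variation x s t" .
  qed
  finally show ?thesis .
qed

lemma norm_le_total_variation:
  assumes "s \<le> t"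
  shows "ennreal (norm (x t - x s)) \<le> total_variation x s t"
proof -
  have "ennreal (norm (x t - x s)) =
      partition_sum (\<lambda>u v. ennreal (norm (x v - x u))) (if s = t then [s] else [s, t])"
    by (simp add: partition_sum_def)
  also have "\<dots> \<le> total_variation x s t"
    unfolding total_variation_def by (rule SUP_upper[OF ex_partition[OF assms]])
  finally show ?thesis .
qed

lemma sup_variation_le:
  assumes "s \<le> t" "\<And>u v. s \<le> u \<Longrightarrow> u \<le> v \<Longrightarrow> v \<le> t \<Longrightarrow> norm (x v - x u) \<le> B"
  shows "sup_variation x s t \<le> B"
proof -
  have "(s, s) \<in> {(u, v). s \<le> u \<and> u \<le> v \<and> v \<le> t}" using assms(1) by simp
  then show ?thesis
    unfolding sup_variation_def by (intro cSUP_least) (use assms(2) in auto)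
qed

text \<open>Equidistant partitions have arbitrarily small mesh. Nontriviality of the filter makes
  limits along it unique, so that the \<open>Lim\<close> in \<open>young_integral\<close> can be
  identified, and lets bounds pass to limits.\<close>

lemma mesh_to_0_ne_bot:
  assumes "s \<le> t"
  shows "mesh_to_0 s t \<noteq> bot"
proof -
  have "\<exists>p\<in>partitions s t. mesh_less \<delta> p" if d: "0 < \<delta>" for \<delta>
  proof (cases "s = t")
    case True
    then show ?thesis by (auto simp: partitions_def mesh_less_def intro!: bexI[of _ "[s]"])
  next
    case False
    with assms have st: "s < t" by simp
    obtain n :: nat where n: "(t - s) / \<delta> < real n" using reals_Archimedean2 by blast
    moreover have "0 < (t - s) / \<delta>" using st d by simp
    ultimately have n0: "0 < n" by (metis less_trans of_nat_0_less_iff)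
    let ?f = "\<lambda>i. s + real i * ((t - s) / real n)"
    let ?p = "map ?f [0..<Suc n]"
    have "?p \<in> partitions s t"
      using n0 st by (auto simp: partitions_def hd_map last_map sorted_wrt_map
          sorted_wrt_iff_nth_less divide_strict_right_mono mult_strict_right_mono simp del: upt_Suc)
    moreover have "mesh_less \<delta> ?p"
      unfolding mesh_less_def
    proof (intro allI impI)
      fix i assume i: "Suc i < length ?p"
      then have "?p ! i = ?f i" "?p ! Suc i = ?f (Suc i)"
        by (metis Suc_lessD add.left_neutral diff_zero length_map length_upt nth_map_upt)+
      then have "?p ! Suc i - ?p ! i = (t - s) / real n"
        by (simp only: of_nat_Suc) (simp add: distrib_right add_divide_distrib del: upt_Suc)
      also have "\<dots> < \<delta>" using n n0 d by (simp add: field_simps)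
      finally show "?p ! Suc i - ?p ! i < \<delta>" .
    qed
    ultimately show ?thesis by blast
  qed
  then show ?thesis unfolding trivial_limit_def eventually_mesh_to_0 by blast
qed

section \<open>Lipschitz vector fields and second-order germs\<close>

text \<open>Since \<gamma> > 1/\<beta> \<ge> 2, the integer m in \<gamma> - 1 = m + \<eta> is at
  least 1. For m = 1 take \<theta> = \<eta>; then 2 + \<theta> = \<gamma> and (2 + \<theta>) \<beta>
  > 1. For m \<ge> 2 the bounded second derivative makes D\<sigma> Lipschitz, so \<theta> = 1, and 3
  \<beta> > 1 is the hypothesis on \<beta>.\<close>

lemma Lip_class_bounds:
  fixes \<sigma> :: "'a::euclidean_space \<Rightarrow> 'b::real_normed_vector"
  assumes \<beta>: "1/3 < \<beta>" "\<beta> \<le> 1/2" and \<gamma>: "\<gamma> > 1/\<beta>" and \<sigma>: "\<sigma> \<in> Lip_class (\<gamma> - 1)"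
  obtains M H \<theta> where "1 \<le> M" "0 \<le> H" "0 < \<theta>" "\<theta> \<le> 1" "1 < (2 + \<theta>) * \<beta>"
    "\<And>x. \<sigma> differentiable (at x)" "\<And>x. norm (\<sigma> x) \<le> M"
    "\<And>x h. norm (frechet_derivative \<sigma> (at x) h) \<le> M * norm h"
    "\<And>x y h. norm (frechet_derivative \<sigma> (at x) h - frechet_derivative \<sigma> (at y) h)
        \<le> H * norm (x - y) powr \<theta> * norm h"
proof -
  obtain m \<eta> M0 H0 where m: "\<gamma> - 1 = real m + \<eta>" "0 < \<eta>" "\<eta> \<le> 1" "C_k_on_UNIV m \<sigma>"
    and M0: "\<And>hs x. length hs \<le> m \<Longrightarrow> norm (nderiv \<sigma> hs x) \<le> M0 * prod_list (map norm hs)"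
    and H0: "\<And>hs x y. length hs = m \<Longrightarrow>
        norm (nderiv \<sigma> hs x - nderiv \<sigma> hs y) \<le> H0 * norm (x - y) powr \<eta> * prod_list (map norm hs)"
    using \<sigma> unfolding Lip_class_def mem_Collect_eq by blast
  have b2: "2 \<le> 1 / \<beta>" using \<beta> by (simp add: field_simps)
  have m1: "1 \<le> m"
  proof (rule ccontr)
    assume "\<not> 1 \<le> m"
    then have "\<gamma> - 1 \<le> 1" using m(1,3) by simp
    with \<gamma> b2 show False by linarith
  qed
  define M where "M = max 1 M0"
  have diff: "nderiv \<sigma> hs differentiable (at x)" if "length hs < m" for hs x
    using m(4) that by (simp add: C_k_on_UNIV_def)
  have d0: "\<sigma> differentiable (at x)" for x
    using diff[of "[]" x] m1 by simp
  have s0: "norm (\<sigma> x) \<le> M" for x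
    using M0[of "[]" x] by (simp add: M_def)
  have s1: "norm (frechet_derivative \<sigma> (at x) h) \<le> M * norm h" for x h
    using M0[of "[h]" x] m1 mult_right_mono[of M0 M "norm h"] by (simp add: M_def)
  show thesis
  proof (cases "m = 1")
    case True
    have "1 < (2 + \<eta>) * \<beta>"
      using \<gamma> m(1) True \<beta> by (simp add: field_simps)
    moreover have "norm (frechet_derivative \<sigma> (at x) h - frechet_derivative \<sigma> (at y) h)
        \<le> max 0 H0 * norm (x - y) powr \<eta> * norm h" for x y h
    proof -
      have "norm (frechet_derivative \<sigma> (at x) h - frechet_derivative \<sigma> (at y) h)
        \<le> H0 * norm (x - y) powr \<eta> * norm h"
        using H0[of "[h]" x y] True by simp
      also have "\<dots> \<le> max 0 H0 * norm (x - y) powr \<eta> * norm h"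
        by (intro mult_right_mono) auto
      finally show ?thesis .
    qed
    ultimately show thesis
      using that[of M "max 0 H0" \<eta>] m d0 s0 s1 by (auto simp: M_def)
  next
    case False
    with m1 have m2: "2 \<le> m" by simp
    have "norm (frechet_derivative \<sigma> (at x) h - frechet_derivative \<sigma> (at y) h)
        \<le> M * norm (x - y) powr 1 * norm h" for x y h
    proof -
      let ?g = "nderiv \<sigma> [h]"
      have "norm (?g x - ?g y) \<le> (M * norm h) * norm (x - y)"
      proof (rule differentiable_bound[of UNIV ?g "\<lambda>z. frechet_derivative ?g (at z)"])
        show "(?g has_derivative frechet_derivative ?g (at z)) (at z within UNIV)" for z
          using diff[of "[h]" z] m2 frechet_derivative_works[of ?g] by simp
        show "onorm (frechet_derivative ?g (at z)) \<le> M * norm h" for z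
        proof (rule onorm_le)
          fix k
          have "norm (frechet_derivative ?g (at z) k) \<le> M0 * (norm k * norm h)"
            using M0[of "[k, h]" z] m2 by simp
          also have "\<dots> \<le> M * (norm k * norm h)" by (intro mult_right_mono) (auto simp: M_def)
          finally show "norm (frechet_derivative ?g (at z) k) \<le> M * norm h * norm k"
            by (simp add: mult_ac)
        qed
      qed auto
      then show ?thesis by (simp add: mult_ac)
    qed
    moreover have "1 < (2 + 1) * \<beta>" using \<beta> by simp
    moreover have "0 \<le> M" "1 \<le> M" by (auto simp: M_def)
    ultimately show thesis
      using that[of M M 1] d0 s0 s1 by (metis zero_less_one order_refl)
  qed
qed

text \<open>A crude bound through the matrix entries; the dimension factors in \<open>c2\<close> and
  \<open>cH\<close> originate here.\<close>

lemma norm_tensor_apply_le: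
  fixes K :: "real^'d^'n"
  assumes "\<And>i j. norm (blinfun_apply (B (axis i 1)) (axis j 1)) \<le> c"
  shows "norm (tensor_apply B K) \<le> real CARD('n) * real CARD('d) * c * norm K"
proof -
  have "norm (tensor_apply B K) \<le> (\<Sum>i\<in>(UNIV::'n set). \<Sum>j\<in>(UNIV::'d set). norm K * c)"
    unfolding tensor_apply_def
  proof (rule sum_norm_le, rule sum_norm_le)
    fix i :: 'n and j :: 'd
    have "norm (K $ i $ j) \<le> norm K"
      using Finite_Cartesian_Product.norm_nth_le[of "K $ i" j] Finite_Cartesian_Product.norm_nth_le[of K i]
      by linarith
    then show "norm (K $ i $ j *\<^sub>R blinfun_apply (B (axis i 1)) (axis j 1)) \<le> norm K * c"
      using assms[of i j] by (simp add: mult_mono)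
  qed
  then show ?thesis by (simp add: mult_ac)
qed

lemma tensor_apply_add: "tensor_apply B (K + L) = tensor_apply B K + tensor_apply B L"
  by (simp add: tensor_apply_def scaleR_add_left sum.distrib)

lemma tensor_apply_zero [simp]: "tensor_apply B 0 = 0"
  by (simp add: tensor_apply_def)

lemma tensor_apply_diff_fun:
  "tensor_apply (\<lambda>v. B v - C v) K = tensor_apply B K - tensor_apply C K"
  by (simp add: tensor_apply_def blinfun.diff_left scaleR_diff_right sum_subtractf)

lemma tensor_apply_tensor:
  fixes a :: "real^'n" and b :: "real^'d"
  assumes "linear B"
  shows "tensor_apply B (tensor a b) = blinfun_apply (B a) b"
proof -
  interpret B: linear B by fact
  have a: "a = (\<Sum>i\<in>UNIV. a $ i *\<^sub>R axis i 1)" and b: "b = (\<Sum>i\<in>UNIV. b $ i *\<^sub>R axis i 1)"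
    using basis_expansion[of a] basis_expansion[of b] by (simp_all add: scalar_mult_eq_scaleR)
  have "blinfun_apply (B a) b = blinfun_apply (B (\<Sum>i\<in>UNIV. a $ i *\<^sub>R axis i 1)) (\<Sum>i\<in>UNIV. b $ i *\<^sub>R axis i 1)"
    by (rule arg_cong2[OF a b])
  also have "\<dots> = (\<Sum>i\<in>UNIV. \<Sum>j\<in>UNIV. a $ i *\<^sub>R (b $ j *\<^sub>R blinfun_apply (B (axis i 1)) (axis j 1)))"
    by (simp only: B.sum B.scale blinfun.sum_left blinfun.sum_right blinfun.scaleR_left
        blinfun.scaleR_right scaleR_sum_right, subst sum.swap)
      (intro sum.cong refl scaleR_left_commute)
  finally show ?thesis by (simp only: tensor_apply_def tensor_def vec_lambda_beta scaleR_scaleR)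
qed

lemma continuous_on_tensor_apply:
  "continuous_on S f \<Longrightarrow> continuous_on S (\<lambda>x. tensor_apply B (f x))"
  unfolding tensor_apply_def by (intro continuous_intros)

lemma bounded_bilinear_tensor: "bounded_bilinear tensor"
  unfolding bilinear_conv_bounded_bilinear[symmetric] bilinear_def
  by (auto intro!: linearI simp: tensor_def vec_eq_iff algebra_simps)

interpretation tensor: bounded_bilinear tensor
  by (rule bounded_bilinear_tensor)

locale lip_vector_field =
  fixes \<sigma> :: "real^'n \<Rightarrow> ((real^'d) \<Rightarrow>\<^sub>L (real^'n))" and M H \<theta> :: real
  assumes M1: "1 \<le> M" and H0: "0 \<le> H" and \<theta>: "0 < \<theta>" "\<theta> \<le> 1"
    and diff: "\<sigma> differentiable (at x)"
    and bounded: "norm (\<sigma> x) \<le> M"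
    and deriv_bounded: "norm (frechet_derivative \<sigma> (at x) h) \<le> M * norm h"
    and deriv_holder: "norm (frechet_derivative \<sigma> (at x) h - frechet_derivative \<sigma> (at y) h)
        \<le> H * norm (x - y) powr \<theta> * norm h"
begin

abbreviation D :: "real^'n \<Rightarrow> real^'n \<Rightarrow> ((real^'d) \<Rightarrow>\<^sub>L (real^'n))"
  where "D x \<equiv> frechet_derivative \<sigma> (at x)"

text \<open>The coefficient D\<sigma>(x)\<sigma>(x) of the second level. Along a path with Z' =
  \<sigma>(Y) it turns the middle term of \<open>rough_germ\<close> into \<open>A\<close> at
  Y.\<close>

definition A :: "real^'n \<Rightarrow> real^'d^'d \<Rightarrow> real^'n"
  where "A x = tensor_apply (\<lambda>v. D x (blinfun_apply (\<sigma> x) v))"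

definition germ :: "(real \<Rightarrow> real^'d) \<Rightarrow> (real \<Rightarrow> real \<Rightarrow> real^'d^'d) \<Rightarrow> real^'n \<Rightarrow> real \<Rightarrow> real \<Rightarrow> real^'n"
  where "germ X XX x s t = blinfun_apply (\<sigma> x) (X t - X s) + A x (XX s t)"

definition c2 :: real where "c2 = real CARD('d) * real CARD('d) * (M * M)"

definition cH :: real where "cH = real CARD('d) * real CARD('d) * (H * M + 2 * (M * M))"

lemma c2_ge: "M * M \<le> c2" and c2_ge1: "1 \<le> c2" and cH_ge: "0 \<le> cH"
proof -
  have d: "1 * 1 \<le> real CARD('d) * real CARD('d)" by (intro mult_mono) auto
  have m: "1 * 1 \<le> M * M" using M1 by (intro mult_mono) auto
  then show "M * M \<le> c2"
    using mult_right_mono[OF d, of "M * M"] by (simp add: c2_def)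
  with m show "1 \<le> c2" by simp
  show "0 \<le> cH" using M1 H0 by (simp add: cH_def)
qed

lemma has_deriv: "(\<sigma> has_derivative D x) (at x within S)"
  using diff frechet_derivative_works has_derivative_at_withinI by blast

lemma D_linear: "linear (D x)"
  using has_deriv has_derivative_linear by blast

lemma lip: "norm (\<sigma> x - \<sigma> y) \<le> M * norm (x - y)"
  by (rule differentiable_bound[of UNIV \<sigma> D])
    (auto intro!: has_deriv onorm_le deriv_bounded)

text \<open>Interpolation: up to distance 1 the Lipschitz bound is the stronger one, beyond it the
  bound 2 * M on the values suffices. This gives \<open>A\<close> the same Hoelder exponent as the
  derivative.\<close>

lemma holder: "norm (\<sigma> x - \<sigma> y) \<le> 2 * M * norm (x - y) powr \<theta>"
proof (cases "norm (x - y) \<le> 1")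
  case True
  have "norm (x - y) powr 1 \<le> norm (x - y) powr \<theta>"
    using True \<theta> by (intro powr_mono') auto
  then have "M * norm (x - y) \<le> M * norm (x - y) powr \<theta>"
    using M1 by (intro mult_left_mono) auto
  moreover have "0 \<le> M * norm (x - y) powr \<theta>" using M1 by simp
  ultimately show ?thesis using lip[of x y] by linarith
next
  case False
  then have "1 powr \<theta> \<le> norm (x - y) powr \<theta>" using \<theta> by (intro powr_mono2) auto
  then have "2 * M * 1 \<le> 2 * M * norm (x - y) powr \<theta>" using M1 by (intro mult_left_mono) auto
  moreover have "norm (\<sigma> x - \<sigma> y) \<le> M + M"
    using norm_triangle_ineq4[of "\<sigma> x" "\<sigma> y"] bounded[of x] bounded[of y] by linarith
  ultimately show ?thesis by simp
qed

text \<open>Along the segment the derivative varies by at most H * norm (y - x) powr \<theta>, so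
  linearization gains the power 1 + \<theta>.\<close>

lemma taylor: "norm (\<sigma> y - \<sigma> x - D x (y - x)) \<le> H * norm (y - x) powr (1 + \<theta>)"
proof -
  let ?S = "closed_segment x y"
  have "norm (\<sigma> y - \<sigma> x - D x (y - x)) \<le> norm (y - x) * (H * norm (y - x) powr \<theta>)"
  proof (rule differentiable_bound_linearization[where S = ?S])
    show "x + t *\<^sub>R (y - x) \<in> ?S" if "t \<in> {0..1}" for t
      using that by (auto simp: closed_segment_def algebra_simps intro!: exI[of _ t])
    show "(\<sigma> has_derivative D z) (at z within ?S)" for z by (rule has_deriv)
    show "onorm (D z - D x) \<le> H * norm (y - x) powr \<theta>" if "z \<in> ?S" for z
    proof (rule onorm_le)
      fix h :: "real^'n"
      have "norm (z - x) \<le> norm (y - x)"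
        using that by (metis dist_in_closed_segment dist_norm norm_minus_commute)
      then have "norm (z - x) powr \<theta> \<le> norm (y - x) powr \<theta>"
        using \<theta> by (intro powr_mono2) auto
      then have "H * norm (z - x) powr \<theta> * norm h \<le> H * norm (y - x) powr \<theta> * norm h"
        using H0 by (intro mult_right_mono mult_left_mono) auto
      then show "norm ((D z - D x) h) \<le> H * norm (y - x) powr \<theta> * norm h"
        using deriv_holder[of z h x] by simp
    qed
  qed auto
  also have "norm (y - x) * (H * norm (y - x) powr \<theta>) = H * norm (y - x) powr (1 + \<theta>)"
    by (simp add: powr_add)
  finally show ?thesis .
qed

lemma norm_D_apply: "norm (blinfun_apply (D x h) v) \<le> M * norm h * norm v"
  by (rule order.trans[OF norm_blinfun mult_right_mono[OF deriv_bounded]]) simp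

lemma norm_apply: "norm (blinfun_apply (\<sigma> x) v) \<le> M * norm v"
  by (rule order.trans[OF norm_blinfun mult_right_mono[OF bounded]]) simp

lemma A_bound: "norm (A x K) \<le> c2 * norm K"
proof -
  have "norm (blinfun_apply (D x (blinfun_apply (\<sigma> x) u)) v) \<le> M * M"
    if "norm u = 1" "norm v = 1" for u v
  proof -
    have "M * norm (blinfun_apply (\<sigma> x) u) \<le> M * M"
      using mult_left_mono[OF norm_apply[of x u], of M] M1 that(1) by simp
    then show ?thesis
      using norm_D_apply[of x "blinfun_apply (\<sigma> x) u" v] that(2) by simp
  qed
  then have "norm (blinfun_apply (D x (blinfun_apply (\<sigma> x) (axis i 1))) (axis j 1)) \<le> M * M"
    for i j :: 'd
    by simp
  then show ?thesis unfolding A_def c2_def by (rule norm_tensor_apply_le)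
qed

lemma A_add: "A x (K + L) = A x K + A x L"
  by (simp add: A_def tensor_apply_add)

lemma A_zero [simp]: "A x 0 = 0"
  by (simp add: A_def)

lemma continuous_on_A:
  "continuous_on S f \<Longrightarrow> continuous_on S (\<lambda>x. A y (f x))"
  unfolding A_def by (rule continuous_on_tensor_apply)

lemma A_tensor: "A x (tensor a b) = blinfun_apply (D x (blinfun_apply (\<sigma> x) a)) b"
  unfolding A_def
  by (intro tensor_apply_tensor linear_compose[OF _ D_linear, unfolded o_def]
      bounded_linear.linear blinfun.bounded_linear_right)

text \<open>Split as for a product: varying the derivative gives H * M, varying \<sigma> inside a
  fixed derivative gives M * (2 * M).\<close>

lemma A_holder: "norm (A x K - A y K) \<le> cH * norm (x - y) powr \<theta> * norm K"
proof -
  let ?r = "norm (x - y) powr \<theta>"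
  have "norm (blinfun_apply (D x (blinfun_apply (\<sigma> x) u) - D y (blinfun_apply (\<sigma> y) u)) v)
      \<le> (H * M + 2 * (M * M)) * ?r" if "norm u = 1" "norm v = 1" for u v :: "real^'d"
  proof -
    have eq: "D x (blinfun_apply (\<sigma> x) u) - D y (blinfun_apply (\<sigma> y) u)
      = (D x (blinfun_apply (\<sigma> x) u) - D y (blinfun_apply (\<sigma> x) u)) + D y (blinfun_apply (\<sigma> x - \<sigma> y) u)"
      by (simp add: blinfun.diff_left linear_diff[OF D_linear])
    have "norm (D x (blinfun_apply (\<sigma> x) u) - D y (blinfun_apply (\<sigma> x) u)) \<le> H * ?r * M"
      using deriv_holder[of x "blinfun_apply (\<sigma> x) u" y]
        mult_left_mono[OF norm_apply[of x u], of "H * ?r"] H0 that by simp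
    moreover have "norm (D y (blinfun_apply (\<sigma> x - \<sigma> y) u)) \<le> M * (2 * M * ?r)"
    proof -
      have "norm (blinfun_apply (\<sigma> x - \<sigma> y) u) \<le> 2 * M * ?r"
        using norm_blinfun[of "\<sigma> x - \<sigma> y" u] holder[of x y] that by simp
      then show ?thesis
        using deriv_bounded[of y "blinfun_apply (\<sigma> x - \<sigma> y) u"] M1
        by (meson mult_left_mono order_trans zero_le_one)
    qed
    ultimately have "norm (D x (blinfun_apply (\<sigma> x) u) - D y (blinfun_apply (\<sigma> y) u)) \<le> (H * M + 2 * (M * M)) * ?r"
      unfolding eq using norm_triangle_ineq[of "D x (blinfun_apply (\<sigma> x) u) - D y (blinfun_apply (\<sigma> x) u)"
          "D y (blinfun_apply (\<sigma> x - \<sigma> y) u)"]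
      by (simp add: algebra_simps)
    then show ?thesis
      using norm_blinfun[of "D x (blinfun_apply (\<sigma> x) u) - D y (blinfun_apply (\<sigma> y) u)" v] that by simp
  qed
  then have "norm (blinfun_apply (D x (blinfun_apply (\<sigma> x) (axis i 1)) - D y (blinfun_apply (\<sigma> y) (axis i 1))) (axis j 1))
      \<le> (H * M + 2 * (M * M)) * ?r" for i j :: 'd
    by simp
  then have "norm (tensor_apply (\<lambda>v. D x (blinfun_apply (\<sigma> x) v) - D y (blinfun_apply (\<sigma> y) v)) K)
      \<le> real CARD('d) * real CARD('d) * ((H * M + 2 * (M * M)) * ?r) * norm K"
    by (rule norm_tensor_apply_le)
  then show ?thesis
    unfolding A_def tensor_apply_diff_fun cH_def by (simp only: mult.assoc)
qed

lemma A_tendsto: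
  assumes x: "x \<longlonglongrightarrow> y" and K: "K \<longlonglongrightarrow> L"
  shows "(\<lambda>m::nat. A (x m) (K m)) \<longlonglongrightarrow> A y L"
proof -
  have "(\<lambda>m. A (x m) (K m) - A y (K m)) \<longlonglongrightarrow> 0"
  proof (rule Lim_null_comparison)
    show "\<forall>\<^sub>F m in sequentially. norm (A (x m) (K m) - A y (K m)) \<le> cH * norm (x m - y) powr \<theta> * norm (K m)"
      by (intro always_eventually allI A_holder)
    have "(\<lambda>m. norm (x m - y)) \<longlonglongrightarrow> 0" using x by (intro tendsto_norm_zero) (simp add: LIM_zero)
    then have "(\<lambda>m. norm (x m - y) powr \<theta>) \<longlonglongrightarrow> 0"
      using \<theta> by (intro tendsto_zero_powrI[of _ _ _ \<theta>]) auto
    then have "(\<lambda>m. cH * norm (x m - y) powr \<theta> * norm (K m)) \<longlonglongrightarrow> cH * 0 * norm L"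
      by (intro tendsto_intros K)
    then show "(\<lambda>m. cH * norm (x m - y) powr \<theta> * norm (K m)) \<longlonglongrightarrow> 0" by simp
  qed
  moreover have "(\<lambda>m. A y (K m)) \<longlonglongrightarrow> A y L"
    using continuous_on_A[OF continuous_on_id, of UNIV y] K
    by (intro continuous_on_tendsto_compose[of UNIV "A y"]) auto
  ultimately show ?thesis using tendsto_add by fastforce
qed

lemma continuous_on_\<sigma>: "continuous_on S \<sigma>"
  using diff by (intro differentiable_imp_continuous_on) (auto simp: differentiable_on_def intro: differentiable_at_withinI)

text \<open>The algebraic core of the second-order scheme. Pushed through \<open>A x\<close>, the
  tensor term of Chen's relation becomes \<open>D x\<close> of the first-order part of y - x, which
  is just what the expansion of \<sigma> y around x produces. There remain the Taylor remainder,
  \<open>D x\<close> of the first-order error of y, and the change of \<open>A\<close>.\<close>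

lemma germ_defect:
  assumes chen: "XX s t = XX s u + XX u t + tensor (X u - X s) (X t - X u)"
  shows "norm (germ X XX x s u + germ X XX y u t - germ X XX x s t)
    \<le> (H * norm (y - x) powr (1 + \<theta>) + M * norm (y - x - blinfun_apply (\<sigma> x) (X u - X s))) * norm (X t - X u)
      + cH * norm (y - x) powr \<theta> * norm (XX u t)"
proof -
  let ?e = "y - x - blinfun_apply (\<sigma> x) (X u - X s)" and ?r = "\<sigma> y - \<sigma> x - D x (y - x)"
  have st: "X t - X s = (X u - X s) + (X t - X u)" by simp
  have eq: "germ X XX x s u + germ X XX y u t - germ X XX x s t
      = blinfun_apply ?r (X t - X u) + blinfun_apply (D x ?e) (X t - X u) + (A y (XX u t) - A x (XX u t))"
    unfolding germ_def chen A_add A_tensor st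
    by (simp only: blinfun.diff_left blinfun.add_right linear_diff[OF D_linear]) simp
  have "norm (blinfun_apply ?r (X t - X u)) \<le> H * norm (y - x) powr (1 + \<theta>) * norm (X t - X u)"
    by (rule order.trans[OF norm_blinfun mult_right_mono[OF taylor]]) simp
  moreover have "norm (blinfun_apply (D x ?e) (X t - X u)) \<le> M * norm ?e * norm (X t - X u)"
    by (rule norm_D_apply)
  moreover have "norm (A y (XX u t) - A x (XX u t)) \<le> cH * norm (y - x) powr \<theta> * norm (XX u t)"
    by (rule A_holder)
  ultimately show ?thesis
    unfolding eq distrib_right by (intro norm_triangle_le add_mono)
qed

text \<open>Chen's relation moves the end time while the starting point stays frozen; this yields
  the regularity of an Euler path inside one of its steps.\<close>

lemma germ_in_step:
  assumes chen: "XX s t = XX s u + XX u t + tensor (X u - X s) (X t - X u)"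
  shows "norm (germ X XX x s t - germ X XX x s u)
    \<le> M * norm (X t - X u) + c2 * norm (XX u t) + c2 * (norm (X u - X s) * norm (X t - X u))"
proof -
  have eq: "germ X XX x s t - germ X XX x s u = blinfun_apply (\<sigma> x) (X t - X u) + A x (XX u t)
      + blinfun_apply (D x (blinfun_apply (\<sigma> x) (X u - X s))) (X t - X u)"
    unfolding germ_def chen A_add A_tensor by (simp add: blinfun.diff_right)
  have "norm (blinfun_apply (D x (blinfun_apply (\<sigma> x) (X u - X s))) (X t - X u))
      \<le> M * norm (blinfun_apply (\<sigma> x) (X u - X s)) * norm (X t - X u)"
    by (rule norm_D_apply)
  also have "\<dots> \<le> M * (M * norm (X u - X s)) * norm (X t - X u)"
    using M1 by (intro mult_right_mono mult_left_mono norm_apply) auto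
  also have "\<dots> = (M * M) * (norm (X u - X s) * norm (X t - X u))"
    by (simp only: mult.assoc)
  also have "\<dots> \<le> c2 * (norm (X u - X s) * norm (X t - X u))"
    by (intro mult_right_mono c2_ge) simp
  finally show ?thesis
    unfolding eq by (intro norm_triangle_le add_mono norm_apply A_bound)
qed

end

section \<open>Young integrals of paths of bounded variation\<close>

text \<open>Abel summation: the increments move from g to f, so the sums are bounded by the
  variation of f and the size of the increments of g up to the end point, without any regularity of
  g.\<close>

lemma tensor_summation_by_parts:
  fixes f :: "nat \<Rightarrow> real^'n" and g :: "nat \<Rightarrow> real^'d"
  shows "(\<Sum>i<m. tensor (f i - f 0) (g (Suc i) - g i)) = (\<Sum>i<m. tensor (f (Suc i) - f i) (g m - g (Suc i)))"
proof (induction m)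
  case (Suc m)
  have "(\<Sum>i<Suc m. tensor (f (Suc i) - f i) (g (Suc m) - g (Suc i)))
      = (\<Sum>i<m. tensor (f (Suc i) - f i) (g m - g (Suc i)) + tensor (f (Suc i) - f i) (g (Suc m) - g m))"
    by (simp add: tensor.add_right[symmetric] tensor.zero_right)
  also have "\<dots> = (\<Sum>i<m. tensor (f i - f 0) (g (Suc i) - g i)) + tensor (\<Sum>i<m. f (Suc i) - f i) (g (Suc m) - g m)"
    by (simp add: sum.distrib Suc.IH tensor.sum_left)
  also have "\<dots> = (\<Sum>i<Suc m. tensor (f i - f 0) (g (Suc i) - g i))"
    by (simp add: sum_lessThan_telescope tensor.zero_right)
  finally show ?case by simp
qed simp

lemma norm_tensor: "norm (tensor a b) = norm a * norm b"
proof -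
  have "tensor a b $ i = a $ i *\<^sub>R b" for i by (simp add: tensor_def vec_eq_iff)
  then show ?thesis by (simp add: norm_vec_def[of "tensor a b"] norm_vec_def[of a] L2_set_left_distrib)
qed

text \<open>V is any superadditive majorant of the increments rather than the total variation
  itself, which keeps extended reals out of the estimates.\<close>

locale bv_path =
  fixes \<Psi> :: "real \<Rightarrow> real^'n" and V :: "real \<Rightarrow> real \<Rightarrow> real" and s t :: real
  assumes st: "s \<le> t" and cont: "continuous_on {s..t} \<Psi>"
    and V_bound: "\<And>u v. s \<le> u \<Longrightarrow> u \<le> v \<Longrightarrow> v \<le> t \<Longrightarrow> norm (\<Psi> v - \<Psi> u) \<le> V u v"
    and V_superadd: "\<And>u r v. s \<le> u \<Longrightarrow> u \<le> r \<Longrightarrow> r \<le> v \<Longrightarrow> v \<le> t \<Longrightarrow> V u r + V r v \<le> V u v"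
begin

lemma V_nonneg: "s \<le> u \<Longrightarrow> u \<le> v \<Longrightarrow> v \<le> t \<Longrightarrow> 0 \<le> V u v"
  using V_bound norm_ge_zero order_trans by blast

abbreviation young_sum :: "(real \<Rightarrow> real^'d) \<Rightarrow> real list \<Rightarrow> real^'d^'n"
  where "young_sum X \<equiv> partition_sum (\<lambda>u v. tensor (\<Psi> u - \<Psi> s) (X v - X u))"

lemma young_sum_bound:
  fixes X :: "real \<Rightarrow> real^'d"
  assumes p: "p \<in> partitions s t" and B: "\<And>u. s \<le> u \<Longrightarrow> u \<le> t \<Longrightarrow> norm (X t - X u) \<le> B"
  shows "norm (young_sum X p) \<le> V s t * B"
proof -
  let ?m = "length p - 1"
  note pp = partitions_props[OF p]
  have B0: "0 \<le> B" using B[of s] st norm_ge_zero order_trans by blast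
  have cell: "s \<le> p ! i" "p ! i \<le> p ! Suc i" "p ! Suc i \<le> t" if "i < ?m" for i
    using partition_cell[OF p that] by auto
  have "young_sum X p = (\<Sum>i<?m. tensor (\<Psi> (p ! Suc i) - \<Psi> (p ! i)) (X t - X (p ! Suc i)))"
    using tensor_summation_by_parts[of "\<lambda>i. \<Psi> (p ! i)" "\<lambda>i. X (p ! i)" ?m] pp(2,3)
    by (simp add: partition_sum_def)
  also have "norm \<dots> \<le> (\<Sum>i<?m. V (p ! i) (p ! Suc i) * B)"
  proof (rule sum_norm_le)
    fix i assume i: "i \<in> {..<?m}"
    have "norm (\<Psi> (p ! Suc i) - \<Psi> (p ! i)) * norm (X t - X (p ! Suc i)) \<le> V (p ! i) (p ! Suc i) * B"
      using cell[of i] i by (intro mult_mono V_bound B V_nonneg) auto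
    then show "norm (tensor (\<Psi> (p ! Suc i) - \<Psi> (p ! i)) (X t - X (p ! Suc i)))
        \<le> V (p ! i) (p ! Suc i) * B"
      by (simp add: norm_tensor)
  qed
  also have "\<dots> = partition_sum V p * B"
    by (simp add: partition_sum_def sum_distrib_right)
  also have "\<dots> \<le> V s t * B"
    using B0
    by (intro mult_right_mono partition_sum_superadditive[OF V_superadd V_nonneg p]) auto
  finally show ?thesis by (simp add: mult_ac)
qed

text \<open>For a smooth integrator these are Riemann sums of the integral of \<open>\<Psi>\<close> against its derivative.\<close>

lemma young_sum_smooth:
  fixes g g' :: "real \<Rightarrow> real^'d"
  assumes g': "\<And>r. (g has_vector_derivative g' r) (at r)" "continuous_on UNIV g'"
  shows "(young_sum g \<longlongrightarrow> integral {s..t} (\<lambda>r. tensor (\<Psi> r - \<Psi> s) (g' r))) (mesh_to_0 s t)"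
proof -
  let ?f = "\<lambda>r. tensor (\<Psi> r - \<Psi> s) (g' r)"
  have fint: "?f integrable_on {u..v}" if "s \<le> u" "v \<le> t" for u v
    using that by (intro integrable_continuous_interval tensor.continuous_on continuous_intros
        continuous_on_subset[OF cont] continuous_on_subset[OF g'(2)]) auto
  obtain G where G: "0 < G" "\<And>r. r \<in> {s..t} \<Longrightarrow> norm (g' r) \<le> G"
    using compact_imp_bounded[OF compact_continuous_image[OF continuous_on_subset[OF g'(2) subset_UNIV] compact_Icc[of s t]]]
    unfolding bounded_pos by blast
  show ?thesis
  proof (rule tendstoI)
    fix e :: real assume e: "0 < e"
    \<comment> \<open>The choice of e' makes e' * G * (t - s) at most e / 2; the added 1 keeps L
      positive when s = t.\<close>
    define L where "L = t - s + 1"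
    then have L: "0 < L" using st by simp
    define e' where "e' = e / (2 * G * L)"
      have e': "0 < e'" using e G(1) L by (simp add: e'_def)
    have "uniformly_continuous_on {s..t} \<Psi>" by (intro compact_uniformly_continuous cont compact_Icc)
    then obtain d where d: "0 < d" "\<And>x y. x \<in> {s..t} \<Longrightarrow> y \<in> {s..t} \<Longrightarrow> dist y x < d \<Longrightarrow> dist (\<Psi> y) (\<Psi> x) < e'"
      unfolding uniformly_continuous_on_def using e' by blast
    have close: "norm (tensor (\<Psi> u - \<Psi> s) (g v - g u) - integral {u..v} ?f) \<le> e' * G * (v - u)"
      if uv: "s \<le> u" "u \<le> v" "v \<le> t" "v - u < d" for u v
    proof -
      have "(g' has_integral g v - g u) {u..v}"
        using uv g'(1) by (intro fundamental_theorem_of_calculus)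
          (auto intro: has_vector_derivative_at_within)
      then have "((\<lambda>r. tensor (\<Psi> u - \<Psi> s) (g' r)) has_integral tensor (\<Psi> u - \<Psi> s) (g v - g u)) {u..v}"
        by (rule has_integral_linear[OF _ tensor.bounded_linear_right, unfolded o_def])
      then have hi: "((\<lambda>r. tensor (\<Psi> u - \<Psi> s) (g' r) - ?f r) has_integral
          tensor (\<Psi> u - \<Psi> s) (g v - g u) - integral {u..v} ?f) {u..v}"
        using uv by (intro has_integral_diff integrable_integral fint)
      have "norm (tensor (\<Psi> u - \<Psi> s) (g' r) - ?f r) \<le> e' * G" if r: "r \<in> {u..v}" for r
      proof -
        have "tensor (\<Psi> u - \<Psi> s) (g' r) - ?f r = tensor (\<Psi> u - \<Psi> r) (g' r)"
          by (simp add: tensor.diff_left[symmetric])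
        moreover have "norm (\<Psi> u - \<Psi> r) * norm (g' r)  \<le> e' * G"
          using d(2)[of r u] r uv G(2)[of r] e'
          by (intro mult_right_mono mult_mono) (auto simp: dist_norm norm_minus_commute)
        ultimately show ?thesis by (simp add: norm_tensor)
      qed
      from has_integral_bound[OF _ hi[folded cbox_interval], of "e' * G"] this
      show ?thesis using e' G(1) uv by simp
    qed
    have "dist (young_sum g p) (integral {s..t} ?f) < e" if p: "p \<in> partitions s t" "mesh_less d p" for p
    proof -
      let ?m = "length p - 1"
      note pp = partitions_props[OF p(1)]
      have cell: "s \<le> p ! i" "p ! i \<le> p ! Suc i" "p ! Suc i \<le> t" "p ! Suc i - p ! i < d" if "i < ?m" for i
        using partition_cell[OF p(1) that] p(2) by auto
      have "integral {s..t} ?f = partition_sum (\<lambda>u v. integral {s..v} ?f - integral {s..u} ?f) p"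
        by (simp add: partition_sum_increment[OF p(1), of "\<lambda>v. integral {s..v} ?f"])
      also have "\<dots> = partition_sum (\<lambda>u v. integral {u..v} ?f) p"
        unfolding partition_sum_def
      proof (rule sum.cong[OF refl])
        fix i assume "i \<in> {..<?m}"
        then show "integral {s..p ! Suc i} ?f - integral {s..p ! i} ?f = integral {p ! i..p ! Suc i} ?f"
          using Henstock_Kurzweil_Integration.integral_combine[of s "p ! i" "p ! Suc i" ?f] cell[of i] fint
          by (simp add: algebra_simps)
      qed
      finally have "norm (young_sum g p - integral {s..t} ?f)
          = norm (\<Sum>i<?m. tensor (\<Psi> (p ! i) - \<Psi> s) (g (p ! Suc i) - g (p ! i)) - integral {p ! i..p ! Suc i} ?f)"
        by (simp add: partition_sum_def sum_subtractf)
      also have "\<dots> \<le> (\<Sum>i<?m. e' * G * (p ! Suc i - p ! i))"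
        using cell by (intro sum_norm_le close) auto
      also have "\<dots> = e' * G * partition_sum (\<lambda>u v. id v - id u) p"
        by (simp add: partition_sum_def sum_distrib_left)
      also have "\<dots> = e' * G * (t - s)"
        by (simp only: partition_sum_increment[OF p(1)] id_apply)
      also have "\<dots> \<le> e' * G * (t - s + 1)"
        using e' G(1) by (intro mult_left_mono) auto
      also have "\<dots> = e / 2"
      proof -
        have "e' * G * L = e / 2" using G(1) L by (simp add: e'_def)
        then show ?thesis by (simp add: L_def)
      qed
      finally show ?thesis using e by (simp add: dist_norm)
    qed
    then show "\<forall>\<^sub>F p in mesh_to_0 s t. dist (young_sum g p) (integral {s..t} ?f) < e"
      unfolding eventually_mesh_to_0 using d(1) by blast
  qed
qed

text \<open>
  Convergence for a continuous integrator: approximate it uniformly by polynomials; summation by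
  parts controls the error uniformly in the partition.
\<close>

lemma young_sum_convergent:
  fixes X :: "real \<Rightarrow> real^'d"
  assumes X: "continuous_on {s..t} X"
  shows "(young_sum X \<longlongrightarrow> young_integral \<Psi> X s t) (mesh_to_0 s t)"
proof -
  let ?F = "filtermap (young_sum X) (mesh_to_0 s t)"
  have V0: "0 \<le> V s t" using V_nonneg st by simp
  have "\<exists>P. eventually P (mesh_to_0 s t) \<and> (\<forall>p q. P p \<and> P q \<longrightarrow> dist (young_sum X p) (young_sum X q) < e)"
    if e: "0 < e" for e
  proof -
    \<comment> \<open>The added 1 avoids division by 0. An error e' in X, uniform in time, changes
      every sum by at most V s t * (2 * e'), hence by at most e / 4, whatever the partition.\<close>
    define L where "L = V s t + 1"
    then have L: "0 < L" using V0 by simp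
    define e' where "e' = e / (8 * L)"
    have e': "0 < e'" using e L by (simp add: e'_def)
    obtain g where g: "polynomial_function g" "\<And>x. x \<in> {s..t} \<Longrightarrow> norm (X x - g x) < e'"
      using Stone_Weierstrass_polynomial_function[OF compact_Icc X e'] by blast
    obtain g' where g': "polynomial_function g'" "\<And>x. (g has_vector_derivative g' x) (at x)"
      using has_vector_derivative_polynomial_function[OF g(1)] by blast
    define I where "I = integral {s..t} (\<lambda>r. tensor (\<Psi> r - \<Psi> s) (g' r))"
    have "(young_sum g \<longlongrightarrow> I) (mesh_to_0 s t)"
      unfolding I_def by (intro young_sum_smooth g' continuous_on_polymonial_function)
    then have ev: "\<forall>\<^sub>F p in mesh_to_0 s t. dist (young_sum g p) I < e / 4"
      using e by (intro tendstoD) auto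
    have near: "dist (young_sum X p) (young_sum g p) \<le> e / 4" if p: "p \<in> partitions s t" for p
    proof -
      have "young_sum X p - young_sum g p = young_sum (\<lambda>r. X r - g r) p"
        by (simp add: partition_sum_def sum_subtractf[symmetric] tensor.diff_right[symmetric] algebra_simps)
      moreover have "norm (young_sum (\<lambda>r. X r - g r) p) \<le> V s t * (2 * e')"
      proof (rule young_sum_bound[OF p])
        fix u assume "s \<le> u" "u \<le> t"
        then show "norm (X t - g t - (X u - g u)) \<le> 2 * e'"
          using g(2)[of u] g(2)[of t] st norm_triangle_ineq4[of "X t - g t" "X u - g u"] by simp
      qed
      moreover have "V s t * (2 * e') \<le> (V s t + 1) * (2 * e')"
        using e' by (intro mult_right_mono mult_left_mono) auto
      moreover have "(V s t + 1) * (2 * e') = e / 4"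
      proof -
        have "L * (2 * e') = e / 4" using L by (simp add: e'_def)
        then show ?thesis by (simp add: L_def)
      qed
      ultimately show ?thesis by (simp add: dist_norm)
    qed
    show ?thesis
    proof (intro exI[of _ "\<lambda>p. p \<in> partitions s t \<and> dist (young_sum g p) I < e / 4"] conjI allI impI)
      show "\<forall>\<^sub>F p in mesh_to_0 s t. p \<in> partitions s t \<and> dist (young_sum g p) I < e / 4"
        using ev unfolding eventually_mesh_to_0 by blast
      fix p q
      assume pq: "(p \<in> partitions s t \<and> dist (young_sum g p) I < e / 4) \<and>
          (q \<in> partitions s t \<and> dist (young_sum g q) I < e / 4)"
      have "dist (young_sum X p) I < e / 2" "dist (young_sum X q) I < e / 2"
        using near[of p] near[of q] pq dist_triangle[of "young_sum X p" I "young_sum g p"]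
          dist_triangle[of "young_sum X q" I "young_sum g q"] by auto
      then show "dist (young_sum X p) (young_sum X q) < e"
        by (rule dist_triangle_half_l)
    qed
  qed
  \<comment> \<open>The value \<open>I\<close> above belongs to the polynomial g and so depends on
    e. Hence only the Cauchy property has been shown, and the limit comes from completeness.\<close>
  then have "cauchy_filter ?F" unfolding cauchy_filter_metric_filtermap by blast
  then obtain I where "?F \<le> nhds I"
    using cauchy_filter_complete_converges[of ?F UNIV] complete_UNIV mesh_to_0_ne_bot[OF st]
    by (auto simp: filtermap_bot_iff)
  then have "(young_sum X \<longlongrightarrow> I) (mesh_to_0 s t)" by (simp add: filterlim_def)
  moreover from this have "young_integral \<Psi> X s t = I"
    unfolding young_integral_def by (intro tendsto_Lim mesh_to_0_ne_bot st)
  ultimately show ?thesis by simp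
qed

lemma young_integral_bound:
  fixes X :: "real \<Rightarrow> real^'d"
  assumes X: "continuous_on {s..t} X" and B: "\<And>u. s \<le> u \<Longrightarrow> u \<le> t \<Longrightarrow> norm (X t - X u) \<le> B"
  shows "norm (young_integral \<Psi> X s t) \<le> V s t * B"
proof (rule Lim_norm_ubound[OF mesh_to_0_ne_bot[OF st] young_sum_convergent[OF X]])
  show "\<forall>\<^sub>F p in mesh_to_0 s t. norm (young_sum X p) \<le> V s t * B"
    unfolding eventually_mesh_to_0
    by (intro exI[of _ 1] conjI ballI impI young_sum_bound B) auto
qed

end

section \<open>A priori bounds for Euler schemes\<close>

locale rough_driver =
  fixes T \<beta> :: real and w :: "real \<Rightarrow> real \<Rightarrow> real"
    and X :: "real \<Rightarrow> real^'d" and XX :: "real \<Rightarrow> real \<Rightarrow> real^'d^'d"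
  assumes T0: "0 < T" and \<beta>0: "0 < \<beta>" and control: "control T w"
    and X_bound: "0 \<le> s \<Longrightarrow> s \<le> t \<Longrightarrow> t \<le> T \<Longrightarrow> norm (X t - X s) \<le> w s t powr \<beta>"
    and XX_bound: "0 \<le> s \<Longrightarrow> s \<le> t \<Longrightarrow> t \<le> T \<Longrightarrow> norm (XX s t) \<le> w s t powr (2 * \<beta>)"
    and chen: "0 \<le> s \<Longrightarrow> s \<le> u \<Longrightarrow> u \<le> t \<Longrightarrow> t \<le> T \<Longrightarrow>
      XX s t = XX s u + XX u t + tensor (X u - X s) (X t - X u)"
begin

lemmas w_nonneg = control_nonneg[OF control]
lemmas w_mono = control_mono[OF control]
lemmas w_superadd = control_superadd[OF control]
lemmas w_diag = control_diag[OF control]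

lemma w_powr_mono:
  "0 \<le> e \<Longrightarrow> 0 \<le> s' \<Longrightarrow> s' \<le> s \<Longrightarrow> s \<le> t \<Longrightarrow> t \<le> t' \<Longrightarrow> t' \<le> T \<Longrightarrow> w s t powr e \<le> w s' t' powr e"
  by (intro powr_mono2 w_mono w_nonneg) auto

lemma w_halves:
  assumes "0 \<le> s" "s \<le> t" "t \<le> T"
  obtains u where "s \<le> u" "u \<le> t" "w s u \<le> w s t / 2" "w u t \<le> w s t / 2"
proof -
  have "continuous_on {s..t} ((\<lambda>(s, t). w s t) \<circ> (\<lambda>u. (s, u)))"
    using control assms unfolding control_def
    by (intro continuous_on_compose continuous_intros) (auto elim!: continuous_on_subset)
  then have c: "continuous_on {s..t} (\<lambda>u. w s u)" by (simp add: o_def)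
  have "w s s \<le> w s t / 2" "w s t / 2 \<le> w s t" using assms w_diag w_nonneg[of s t] by auto
  from IVT'[OF this assms(2) c] obtain u where u: "s \<le> u" "u \<le> t" "w s u = w s t / 2" by blast
  with w_superadd[of s u t] assms that show thesis by force
qed

text \<open>Chop \<open>[s,t]\<close> dyadically until every piece has control at most \<open>h\<close>.\<close>

lemma local_to_global:
  fixes f :: "real \<Rightarrow> 'a::real_normed_vector"
  assumes h: "0 < h" and N: "0 \<le> N"
    and loc: "\<And>s t. 0 \<le> s \<Longrightarrow> s \<le> t \<Longrightarrow> t \<le> T \<Longrightarrow> w s t \<le> h \<Longrightarrow> norm (f t - f s) \<le> N * w s t powr \<beta>"
    and st: "0 \<le> s" "s \<le> t" "t \<le> T"
  shows "norm (f t - f s) \<le> N * (1 + 2 * w 0 T / h) * w s t powr \<beta>"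
proof -
  have dyadic: "norm (f t - f s) \<le> 2 ^ k * N * h powr \<beta>"
    if "0 \<le> s" "s \<le> t" "t \<le> T" "w s t \<le> 2 ^ k * h" for s t k
    using that
  proof (induction k arbitrary: s t)
    case 0
    have "N * w s t powr \<beta> \<le> N * h powr \<beta>"
      using 0 N \<beta>0 w_nonneg[of s t] by (intro mult_left_mono powr_mono2) auto
    with loc[of s t] 0 show ?case by simp
  next
    case (Suc k)
    obtain u where u: "s \<le> u" "u \<le> t" "w s u \<le> w s t / 2" "w u t \<le> w s t / 2"
      using w_halves Suc.prems(1-3) by blast
    have "norm (f u - f s) \<le> 2 ^ k * N * h powr \<beta>" "norm (f t - f u) \<le> 2 ^ k * N * h powr \<beta>"
      using Suc.prems u by (auto intro!: Suc.IH)
    then show ?case using norm_triangle_ineq[of "f t - f u" "f u - f s"] by simp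
  qed
  have w0: "0 \<le> w 0 T" using w_nonneg[of 0 T] T0 by simp
  show ?thesis
  proof (cases "w s t \<le> h")
    case True
    have "1 * (N * w s t powr \<beta>) \<le> (1 + 2 * w 0 T / h) * (N * w s t powr \<beta>)"
      using N h w0 by (intro mult_right_mono) auto
    with loc[OF st True] show ?thesis by (simp add: mult_ac)
  next
    case False
    \<comment> \<open>Minimality of k gives 2^k \<le> 2 * w s t / h, so the number of pieces is
      linear in the control, and h < w s t turns h powr \<beta> into w s t powr \<beta>.\<close>
    obtain k where k: "w s t / h \<le> 2 ^ k" "\<And>j. j < k \<Longrightarrow> \<not> w s t / h \<le> 2 ^ j"
      using exists_least_iff[of "\<lambda>k. w s t / h \<le> 2 ^ k"] real_arch_pow[of 2 "w s t / h"]
      by (metis less_imp_le one_less_numeral_iff semiring_norm(76))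
    have "k \<noteq> 0" using k(1) False h by (cases k) (auto simp: field_simps)
    then obtain j where j: "k = Suc j" by (cases k) auto
    have "2 ^ k \<le> 2 * w s t / h" using k(2)[of j] by (simp add: j)
    also have "\<dots> \<le> 1 + 2 * w 0 T / h"
      using w_mono[of 0 s t T] st h w0 by (simp add: divide_right_mono add_increasing)
    finally have kb: "2 ^ k \<le> 1 + 2 * w 0 T / h" .
    have "norm (f t - f s) \<le> 2 ^ k * N * h powr \<beta>"
      using k(1) h st by (intro dyadic) (auto simp: field_simps)
    also have "\<dots> \<le> (1 + 2 * w 0 T / h) * N * w s t powr \<beta>"
      using kb N h \<beta>0 False w0 by (intro mult_mono powr_mono2) auto
    finally show ?thesis by (simp add: mult_ac)
  qed
qed

lemma holder_modulus:
  assumes C: "0 \<le> C" and e: "0 < e"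
  obtains d where "0 < d"
    "\<And>s t. 0 \<le> s \<Longrightarrow> s \<le> t \<Longrightarrow> t \<le> T \<Longrightarrow> t - s < d \<Longrightarrow> C * w s t powr \<beta> < e"
proof -
  define e' where "e' = e / (C + 1)"
  have e': "0 < e'" using e C by (simp add: e'_def)
  obtain d where d: "0 < d" "\<And>s t. 0 \<le> s \<Longrightarrow> s \<le> t \<Longrightarrow> t \<le> T \<Longrightarrow> t - s < d \<Longrightarrow> w s t < e' powr (1 / \<beta>)"
    using control_small[OF control, of "e' powr (1 / \<beta>)"] e' by auto
  have "C * w s t powr \<beta> < e" if st: "0 \<le> s" "s \<le> t" "t \<le> T" "t - s < d" for s t
  proof -
    have "w s t powr \<beta> \<le> (e' powr (1 / \<beta>)) powr \<beta>"
      using d(2)[of s t] w_nonneg st \<beta>0 by (intro powr_mono2) (auto intro: less_imp_le)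
    also have "\<dots> = e'" using e' \<beta>0 by (simp add: powr_powr)
    finally have "C * w s t powr \<beta> \<le> C * e'" using C by (intro mult_left_mono)
    also have "\<dots> < (C + 1) * e'" using e' by (intro mult_strict_right_mono) auto
    also have "\<dots> = e" using C by (simp add: e'_def)
    finally show ?thesis .
  qed
  with d(1) that show thesis by blast
qed

lemma holder_continuous:
  fixes f :: "real \<Rightarrow> 'a::real_normed_vector"
  assumes C: "0 \<le> C" and ab: "0 \<le> a" "b \<le> T"
    and f: "\<And>s t. a \<le> s \<Longrightarrow> s \<le> t \<Longrightarrow> t \<le> b \<Longrightarrow> norm (f t - f s) \<le> C * w s t powr \<beta>"
  shows "continuous_on {a..b} f"
proof -
  have "\<exists>d>0. \<forall>x'\<in>{a..b}. dist x' x < d \<longrightarrow> dist (f x') (f x) < e" if x: "x \<in> {a..b}" and e: "0 < e" for x e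
  proof -
    obtain d where d: "0 < d" "\<And>s t. 0 \<le> s \<Longrightarrow> s \<le> t \<Longrightarrow> t \<le> T \<Longrightarrow> t - s < d \<Longrightarrow> C * w s t powr \<beta> < e"
      using holder_modulus[OF C e] by blast
    have *: "norm (f t - f s) < e" if "a \<le> s" "s \<le> t" "t \<le> b" "t - s < d" for s t
      using d(2)[of s t] f[of s t] that ab by simp
    have "dist (f x') (f x) < e" if "x' \<in> {a..b}" "dist x' x < d" for x'
      using *[of x x'] *[of x' x] that x by (cases "x \<le> x'") (auto simp: dist_norm norm_minus_commute)
    then show ?thesis using d(1) by blast
  qed
  then show ?thesis unfolding continuous_on_iff by blast
qed

lemma X_continuous: "continuous_on {0..T} X"
  using X_bound by (intro holder_continuous[of 1]) auto

lemma XX_continuous: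
  assumes s: "0 \<le> s"
  shows "continuous_on {s..T} (XX s)"
proof (rule holder_continuous[of "2 * w 0 T powr \<beta>"])
  fix u t assume ut: "s \<le> u" "u \<le> t" "t \<le> T"
  have eq: "XX s t - XX s u = XX u t + tensor (X u - X s) (X t - X u)"
    using chen[of s u t] ut s by simp
  have "norm (XX u t) \<le> w u t powr \<beta> * w u t powr \<beta>"
    using XX_bound[of u t] ut s by (simp add: powr_add[symmetric])
  also have "\<dots> \<le> w 0 T powr \<beta> * w u t powr \<beta>"
    using ut s \<beta>0 by (intro mult_right_mono w_powr_mono) auto
  finally have 1: "norm (XX u t) \<le> w 0 T powr \<beta> * w u t powr \<beta>" .
  have "norm (X u - X s) * norm (X t - X u) \<le> w 0 T powr \<beta> * w u t powr \<beta>"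
    using ut s \<beta>0 by (intro mult_mono order.trans[OF X_bound w_powr_mono] X_bound) auto
  then have 2: "norm (tensor (X u - X s) (X t - X u)) \<le> w 0 T powr \<beta> * w u t powr \<beta>"
    by (simp add: norm_tensor)
  show "norm (XX s t - XX s u) \<le> 2 * w 0 T powr \<beta> * w u t powr \<beta>"
    unfolding eq using norm_triangle_ineq[of "XX u t" "tensor (X u - X s) (X t - X u)"] 1 2 by simp
qed (use s in auto)

text \<open>Chen's relation reduces convergence in both variables to second-level terms over
  [a m, s] and [b m, t], which vanish with w. Both sequences approach from below, as times rounded
  down to a grid do.\<close>

lemma XX_tendsto:
  assumes st: "0 \<le> s" "s \<le> t" "t \<le> T" and ab: "a \<longlonglongrightarrow> s" "b \<longlonglongrightarrow> t"
    "\<And>m. 0 \<le> a m" "\<And>m. a m \<le> s" "\<And>m. a m \<le> b m" "\<And>m. b m \<le> t"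
  shows "(\<lambda>m. XX (a m) (b m)) \<longlonglongrightarrow> XX s t"
proof -
  have r: "a m \<le> T" "0 \<le> b m" "b m \<le> T" for m
    using st ab(3-6)[of m] by linarith+
  have Xa: "(\<lambda>m. X (a m)) \<longlonglongrightarrow> X s" and Xb: "(\<lambda>m. X (b m)) \<longlonglongrightarrow> X t"
    using st ab r by (auto intro!: continuous_on_tendsto_compose[OF X_continuous])
  have small: "(\<lambda>m. XX (c m) r) \<longlonglongrightarrow> 0" if "0 \<le> r" "r \<le> T" "c \<longlonglongrightarrow> r" "\<And>m. 0 \<le> c m" "\<And>m. c m \<le> r" for c r
  proof (rule Lim_null_comparison)
    show "\<forall>\<^sub>F m in sequentially. norm (XX (c m) r) \<le> w (c m) r powr (2 * \<beta>)"
      using that by (intro always_eventually allI XX_bound)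
    have "(\<lambda>m. w (c m) r) \<longlonglongrightarrow> w r r"
      using that by (intro control_tendsto[OF control]) auto
    then show "(\<lambda>m. w (c m) r powr (2 * \<beta>)) \<longlonglongrightarrow> 0"
      using that \<beta>0 w_diag by (intro tendsto_zero_powrI[of _ _ _ "2 * \<beta>"] always_eventually) (auto intro: w_nonneg)
  qed
  have "XX (a m) (b m) = XX s t + XX (a m) s + tensor (X s - X (a m)) (X t - X s)
      - XX (b m) t - tensor (X (b m) - X (a m)) (X t - X (b m))" for m
    using chen[of "a m" "b m" t] chen[of "a m" s t] st ab(3-6)[of m] by (simp add: algebra_simps)
  moreover have "(\<lambda>m. XX s t + XX (a m) s + tensor (X s - X (a m)) (X t - X s)
      - XX (b m) t - tensor (X (b m) - X (a m)) (X t - X (b m)))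
    \<longlonglongrightarrow> XX s t + 0 + tensor (X s - X s) (X t - X s) - 0 - tensor (X t - X s) (X t - X t)"
    using st ab r by (intro tendsto_intros tensor.tendsto Xa Xb small) auto
  ultimately show ?thesis by (simp add: tensor.zero_left tensor.zero_right)
qed

lemma XX_diag: "0 \<le> s \<Longrightarrow> s \<le> T \<Longrightarrow> XX s s = 0"
  using chen[of s s s] by (simp add: tensor.zero_left)

end

text \<open>Kept apart from the driver, so that the constants exist before T, the control and the
  rough path are quantified. Here \<rho> is the constant of the variation bound on the
  drift.\<close>

locale rde_constants = lip_vector_field \<sigma> M H \<theta>
  for \<sigma> :: "real^'n \<Rightarrow> ((real^'d) \<Rightarrow>\<^sub>L (real^'n))" and M H \<theta> +
  fixes \<beta> \<rho> :: real
  assumes \<beta>_pos: "0 < \<beta>" and sewing_exponent: "1 < (2 + \<theta>) * \<beta>" and \<rho>0: "0 \<le> \<rho>"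
begin

text \<open>
  On intervals of control at most \<open>h\<close> the scheme has increments bounded by \<open>N\<close> (by \<open>N0\<close> inside one
  step), the drift has variation at most \<open>NV\<close>, and the deviation from the germ is controlled by
  \<open>DJ\<close> and \<open>DV\<close>; \<open>h\<close> is small enough for these bounds to reproduce themselves.
\<close>

definition p :: real where "p = (2 + \<theta>) * \<beta>"
definition N0 :: real where "N0 = M + 2 * c2"
definition N :: real where "N = 2 * (M + 1)"
definition NV :: real where "NV = \<rho> * (2 * N0 + N)"
definition NY :: real where "NY = N + NV"
definition Q :: real where "Q = H * NY powr (1 + \<theta>) + M * c2 + cH * NY powr \<theta>"
text \<open>What one bisection gains: \<open>lam\<close> is 2 * 2 powr (- p), for two halves of w^p.
  The factor 2 is missing in \<open>mu\<close>, since the term V w^\<beta> profits from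
  superadditivity of V.\<close>

definition lam :: real where "lam = 2 powr (1 - p)"
definition mu :: real where "mu = 2 powr (- \<beta>)"
definition DJ :: real where "DJ = 4 * Q / (1 - lam)"
definition DV :: real where "DV = 4 * M / (1 - mu)"
definition \<eta> :: real where "\<eta> = 1 / (1 + 4 * M / (1 - lam) + 4 * M / (1 - mu) + 2 * DV * \<rho>
  + (c2 + DJ + DV * \<rho> * (2 * N0 + N)))"
definition h :: real where "h = \<eta> powr (1 / \<beta>)"

lemma lam: "0 < lam" "lam < 1" and mu: "0 < mu" "mu < 1"
  using sewing_exponent \<beta>_pos by (auto simp: lam_def mu_def p_def powr_less_one)

lemma consts_nonneg: "0 \<le> N0" "0 \<le> N" "0 \<le> NV" "0 \<le> NY" "0 \<le> Q" "0 \<le> DJ" "0 \<le> DV"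
proof -
  have M0: "0 \<le> M" using M1 by simp
  show a: "0 \<le> N0" "0 \<le> N" using M0 c2_ge1 by (auto simp: N0_def N_def)
  then show b: "0 \<le> NV" using \<rho>0 by (simp add: NV_def)
  with a show "0 \<le> NY" by (simp add: NY_def)
  show "0 \<le> Q" using M0 c2_ge1 H0 cH_ge by (simp add: Q_def)
  then show "0 \<le> DJ" using lam by (simp add: DJ_def)
  show "0 \<le> DV" using M0 mu by (simp add: DV_def)
qed

text \<open>\<eta> is the reciprocal of 1 plus everything it has to absorb, so each product is at
  most 1. The first two bounds close the bisection; the last two close the bound \<open>N\<close> on
  increments, where half of an increment is absorbed and the quadratic terms become linear.\<close>

lemma \<eta>_pos: "0 < \<eta>" and \<eta>_le1: "\<eta> \<le> 1"
  and \<eta>_bounds: "4 * M * \<eta> \<le> 1 - lam" "4 * M * \<eta> \<le> 1 - mu" "2 * DV * \<rho> * \<eta> \<le> 1"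
    "(c2 + DJ + DV * \<rho> * (2 * N0 + N)) * \<eta> \<le> 1"
proof -
  let ?S = "1 + 4 * M / (1 - lam) + 4 * M / (1 - mu) + 2 * DV * \<rho> + (c2 + DJ + DV * \<rho> * (2 * N0 + N))"
  have pos: "0 \<le> 4 * M / (1 - lam)" "0 \<le> 4 * M / (1 - mu)" "0 \<le> 2 * DV * \<rho>"
    "0 \<le> c2 + DJ + DV * \<rho> * (2 * N0 + N)"
    using lam mu M1 \<rho>0 consts_nonneg c2_ge1 by auto
  then have S: "1 \<le> ?S" by linarith
  then show "0 < \<eta>" "\<eta> \<le> 1" by (auto simp: \<eta>_def)
  have le: "a * \<eta> \<le> 1" if "a \<le> ?S" for a
    using that S by (simp add: \<eta>_def)
  have "4 * M / (1 - lam) * \<eta> \<le> 1" "4 * M / (1 - mu) * \<eta> \<le> 1" using pos by (intro le; linarith)+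
  then show "4 * M * \<eta> \<le> 1 - lam" "4 * M * \<eta> \<le> 1 - mu" using lam mu by (auto simp: field_simps)
  show "2 * DV * \<rho> * \<eta> \<le> 1" using pos by (intro le) linarith
  show "(c2 + DJ + DV * \<rho> * (2 * N0 + N)) * \<eta> \<le> 1" using pos by (intro le) linarith
qed

lemma h_pos: "0 < h" and h_powr: "h powr \<beta> = \<eta>"
  using \<eta>_pos \<beta>_pos by (auto simp: h_def powr_powr)

end

locale rough_euler = rde_constants \<sigma> M H \<theta> \<beta> \<rho> + rough_driver T \<beta> w X XX
  for \<sigma> :: "real^'n \<Rightarrow> ((real^'d) \<Rightarrow>\<^sub>L (real^'n))" and M H \<theta> \<beta> \<rho> T w
    and X :: "real \<Rightarrow> real^'d" and XX
begin

abbreviation E :: "real^'n \<Rightarrow> real \<Rightarrow> real \<Rightarrow> real^'n" where "E \<equiv> germ X XX"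

lemma h_le1: "h \<le> 1"
  using \<eta>_pos \<eta>_le1 \<beta>_pos by (simp add: h_def powr_le1)

lemma p_gt1: "1 < p" and p_le: "p \<le> 3 * \<beta>" and p_ge: "2 * \<beta> \<le> p"
  using sewing_exponent \<theta> \<beta>_pos by (auto simp: p_def)

lemma w_powr_le_\<eta>: "0 \<le> s \<Longrightarrow> s \<le> t \<Longrightarrow> t \<le> T \<Longrightarrow> w s t \<le> h \<Longrightarrow> w s t powr \<beta> \<le> \<eta>"
  unfolding h_powr[symmetric] using \<beta>_pos w_nonneg by (intro powr_mono2) auto

lemma germ_first_order:
  assumes "0 \<le> s" "s \<le> t" "t \<le> T"
  shows "norm (E x s t - blinfun_apply (\<sigma> x) (X t - X s)) \<le> c2 * w s t powr (2 * \<beta>)"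
proof -
  have "norm (E x s t - blinfun_apply (\<sigma> x) (X t - X s)) \<le> c2 * norm (XX s t)"
    using A_bound[of x "XX s t"] by (simp add: germ_def)
  also have "\<dots> \<le> c2 * w s t powr (2 * \<beta>)"
    using c2_ge1 by (intro mult_left_mono XX_bound assms) auto
  finally show ?thesis .
qed

lemma germ_bound:
  assumes "0 \<le> s" "s \<le> t" "t \<le> T"
  shows "norm (E x s t) \<le> M * w s t powr \<beta> + c2 * w s t powr (2 * \<beta>)"
proof -
  have "norm (blinfun_apply (\<sigma> x) (X t - X s)) \<le> M * w s t powr \<beta>"
    using M1 by (intro order.trans[OF norm_apply] mult_left_mono X_bound assms) auto
  with germ_first_order[OF assms, of x] show ?thesis
    using norm_triangle_sub[of "E x s t" "blinfun_apply (\<sigma> x) (X t - X s)"] by linarith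
qed

end

text \<open>Discrete data only: z is the scheme, y adds the drift, and times are seen through
  indices. In \<open>V_le\<close> the path may also oscillate between the points \<tau>; the term
  with 2 * N0 pays for the incomplete steps at the two ends of an increment.\<close>

locale euler_scheme = rough_euler \<sigma> M H \<theta> \<beta> \<rho> T w X XX
  for \<sigma> :: "real^'n \<Rightarrow> ((real^'d) \<Rightarrow>\<^sub>L (real^'n))" and M H \<theta> \<beta> \<rho> T w
    and X :: "real \<Rightarrow> real^'d" and XX +
  fixes n :: nat and \<tau> :: "nat \<Rightarrow> real" and y z :: "nat \<Rightarrow> real^'n" and V :: "nat \<Rightarrow> nat \<Rightarrow> real"
  assumes \<tau>_mono: "i \<le> j \<Longrightarrow> j \<le> n \<Longrightarrow> \<tau> i \<le> \<tau> j"
    and \<tau>_range: "i \<le> n \<Longrightarrow> 0 \<le> \<tau> i" "i \<le> n \<Longrightarrow> \<tau> i \<le> T"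
    and step: "i < n \<Longrightarrow> z (Suc i) = z i + E (y i) (\<tau> i) (\<tau> (Suc i))"
    and V_superadd: "i \<le> j \<Longrightarrow> j \<le> k \<Longrightarrow> k \<le> n \<Longrightarrow> V i j + V j k \<le> V i k"
    and V_nonneg: "i \<le> j \<Longrightarrow> j \<le> n \<Longrightarrow> 0 \<le> V i j"
    and V_drift: "i \<le> j \<Longrightarrow> j \<le> n \<Longrightarrow> norm ((y j - z j) - (y i - z i)) \<le> V i j"
    and V_le: "\<And>i j B. i \<le> j \<Longrightarrow> j \<le> n \<Longrightarrow>
      (\<And>k l. i \<le> k \<Longrightarrow> k \<le> l \<Longrightarrow> l \<le> j \<Longrightarrow> norm (z l - z k) \<le> B) \<Longrightarrow>
      V i j \<le> \<rho> * (2 * N0 * w (\<tau> i) (\<tau> j) powr \<beta> + B)"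
begin

definition J :: "nat \<Rightarrow> nat \<Rightarrow> real^'n" where "J i j = z j - z i - E (y i) (\<tau> i) (\<tau> j)"

abbreviation W :: "nat \<Rightarrow> nat \<Rightarrow> real" where "W i j \<equiv> w (\<tau> i) (\<tau> j)"

text \<open>The bounds are carried together because the defect at a splitting point needs all three
  on shorter intervals.\<close>

definition good :: "nat \<Rightarrow> nat \<Rightarrow> bool" where
  "good i j \<longleftrightarrow> norm (J i j) \<le> DJ * W i j powr p + DV * V i j * W i j powr \<beta> \<and>
    norm (z j - z i) \<le> N * W i j powr \<beta> \<and> V i j \<le> NV * W i j powr \<beta>"

lemma W_mono: "i' \<le> i \<Longrightarrow> i \<le> j \<Longrightarrow> j \<le> j' \<Longrightarrow> j' \<le> n \<Longrightarrow> W i j \<le> W i' j'"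
  by (intro w_mono \<tau>_range \<tau>_mono) auto

lemma W_nonneg: "i \<le> j \<Longrightarrow> j \<le> n \<Longrightarrow> 0 \<le> W i j"
  by (intro w_nonneg \<tau>_range \<tau>_mono) auto

lemma V_mono:
  assumes "i' \<le> i" "i \<le> j" "j \<le> j'" "j' \<le> n"
  shows "V i j \<le> V i' j'"
  using V_superadd[of i' i j'] V_superadd[of i j j'] V_nonneg[of i' i] V_nonneg[of j j'] assms
  by linarith

text \<open>A control seen at grid points cannot be halved exactly. With k the last index whose
  control from i is at most half, one more step exceeds half, and superadditivity leaves at most
  half after \<open>Suc k\<close>. The price is the step from k to \<open>Suc k\<close>, which
  belongs to neither part.\<close>

lemma split:
  assumes ij: "i < j" "j \<le> n"
  obtains k where "i \<le> k" "k < j" "W i k \<le> W i j / 2" "W (Suc k) j \<le> W i j / 2"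
proof -
  let ?S = "{k. i \<le> k \<and> k < j \<and> W i k \<le> W i j / 2}"
  define k where "k = Max ?S"
  have fin: "finite ?S" by (rule finite_subset[of _ "{..<j}"]) auto
  have "i \<in> ?S"
    using ij w_diag[of "\<tau> i"] W_nonneg[of i j] \<tau>_range[of i] by auto
  with fin have k: "k \<in> ?S" unfolding k_def by (intro Max_in) auto
  have "W (Suc k) j \<le> W i j / 2"
  proof (cases "Suc k < j")
    case True
    have "Suc k \<notin> ?S" using Max_ge[OF fin, of "Suc k", folded k_def] by (metis Suc_n_not_le_n)
    then have "W i j / 2 < W i (Suc k)" using True k by auto
    moreover have "W i (Suc k) + W (Suc k) j \<le> W i j"
      using True k ij by (intro w_superadd \<tau>_range \<tau>_mono) auto
    ultimately show ?thesis by linarith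
  next
    case False
    with k have "Suc k = j" by auto
    then show ?thesis using w_diag[of "\<tau> j"] \<tau>_range[of j] W_nonneg[of i j] ij by simp
  qed
  with k that show thesis by blast
qed

text \<open>The first-order error of y is the increment of the drift plus terms of order 2\<beta>
  and higher. Multiplied by an increment of X, the latter reach order p, while the drift leaves V
  w^\<beta>; this is why the deviation bound has two terms. The summands with \<eta> are feedback of
  the induction hypothesis. The outer interval [a, b] lets both defects of a splitting be measured
  by the same quantities.\<close>

lemma defect:
  assumes g: "good i k" and ikl: "i \<le> k" "k \<le> l" "a \<le> i" "l \<le> b" "b \<le> n" and small: "W a b \<le> h"
  shows "norm (E (y i) (\<tau> i) (\<tau> k) + E (y k) (\<tau> k) (\<tau> l) - E (y i) (\<tau> i) (\<tau> l))
    \<le> (Q + M * DJ * \<eta>) * W a b powr p + (M + M * DV * \<eta>) * V a b * W a b powr \<beta>"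
proof -
  define x where "x = W a b powr \<beta>"
  define xp where "xp = W a b powr p"
  define e where "e = y k - y i"
  define U where "U = V a b"
  have W0: "0 \<le> W a b" using ikl by (intro W_nonneg) auto
  have x0: "0 \<le> x" and xp0: "0 \<le> xp" by (auto simp: x_def xp_def)
  have U0: "0 \<le> U" unfolding U_def using ikl by (intro V_nonneg) auto
  have x\<eta>: "x \<le> \<eta>" unfolding x_def
    using ikl small by (intro w_powr_le_\<eta> \<tau>_range \<tau>_mono) auto
  have Wx: "W c d powr \<beta> \<le> x" if "a \<le> c" "c \<le> d" "d \<le> b" for c d
    unfolding x_def using that ikl \<beta>_pos by (intro powr_mono2 W_mono W_nonneg) auto
  have Wxp: "W c d powr p \<le> xp" if "a \<le> c" "c \<le> d" "d \<le> b" for c d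
    unfolding xp_def using that ikl p_gt1 by (intro powr_mono2 W_mono W_nonneg) auto
  have xx: "W a b powr (2 * \<beta>) = x * x" by (simp add: x_def powr_add[symmetric])
  have W2: "W c d powr (2 * \<beta>) \<le> x * x" if "a \<le> c" "c \<le> d" "d \<le> b" for c d
    unfolding xx[symmetric] using that ikl \<beta>_pos by (intro powr_mono2 W_mono W_nonneg) auto
  have pw1: "x powr (1 + \<theta>) * x = xp"
    by (simp add: x_def xp_def p_def powr_powr powr_add[symmetric] algebra_simps)
  have pw2: "x powr \<theta> * (x * x) = xp"
    by (simp add: x_def xp_def p_def powr_powr powr_add[symmetric] algebra_simps)
  have pw3: "x * x * x \<le> xp"
  proof -
    have "x * x * x = W a b powr (3 * \<beta>)" by (simp add: x_def powr_add[symmetric])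
    also have "\<dots> \<le> xp" unfolding xp_def using W0 small h_le1 p_le by (intro powr_mono') auto
    finally show ?thesis .
  qed
  have Vik: "V i k \<le> U" unfolding U_def using ikl by (intro V_mono) auto
  have e: "norm e \<le> NY * x"
  proof -
    have "e = (z k - z i) + ((y k - z k) - (y i - z i))" by (simp add: e_def)
    then have "norm e \<le> norm (z k - z i) + V i k"
      using norm_triangle_ineq[of "z k - z i" "(y k - z k) - (y i - z i)"] V_drift[of i k] ikl by simp
    also have "\<dots> \<le> NY * W i k powr \<beta>"
      using g by (simp add: good_def NY_def distrib_right)
    also have "\<dots> \<le> NY * x" using ikl consts_nonneg by (intro mult_left_mono Wx) auto
    finally show ?thesis .
  qed
  have ep: "norm e powr r \<le> NY powr r * x powr r" if "0 \<le> r" for r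
    using e that x0 consts_nonneg by (simp add: powr_mult[symmetric] powr_mono2)
  have lin: "norm (e - blinfun_apply (\<sigma> (y i)) (X (\<tau> k) - X (\<tau> i)))
      \<le> U + c2 * (x * x) + DJ * xp + DV * U * x"
  proof -
    have "e - blinfun_apply (\<sigma> (y i)) (X (\<tau> k) - X (\<tau> i)) = ((y k - z k) - (y i - z i))
        + (E (y i) (\<tau> i) (\<tau> k) - blinfun_apply (\<sigma> (y i)) (X (\<tau> k) - X (\<tau> i))) + J i k"
      by (simp add: e_def J_def)
    moreover have "norm ((y k - z k) - (y i - z i)) \<le> U"
      using V_drift[of i k] Vik ikl by simp
    moreover have "norm (E (y i) (\<tau> i) (\<tau> k) - blinfun_apply (\<sigma> (y i)) (X (\<tau> k) - X (\<tau> i))) \<le> c2 * (x * x)"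
      using ikl c2_ge1
      by (intro order.trans[OF germ_first_order] mult_left_mono W2 \<tau>_range \<tau>_mono) auto
    moreover have "norm (J i k) \<le> DJ * xp + DV * U * x"
    proof -
      have "norm (J i k) \<le> DJ * W i k powr p + DV * V i k * W i k powr \<beta>"
        using g by (simp add: good_def)
      also have "\<dots> \<le> DJ * xp + DV * U * x"
        using ikl consts_nonneg U0 Vik
        by (intro add_mono mult_mono Wx Wxp mult_nonneg_nonneg) (auto intro: V_nonneg)
      finally show ?thesis .
    qed
    ultimately show ?thesis
      by (metis (no_types, opaque_lifting) add.assoc add_mono norm_triangle_le norm_triangle_mono)
  qed
  have "norm (E (y i) (\<tau> i) (\<tau> k) + E (y k) (\<tau> k) (\<tau> l) - E (y i) (\<tau> i) (\<tau> l))
    \<le> (H * norm e powr (1 + \<theta>) + M * norm (e - blinfun_apply (\<sigma> (y i)) (X (\<tau> k) - X (\<tau> i))))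
        * norm (X (\<tau> l) - X (\<tau> k)) + cH * norm e powr \<theta> * norm (XX (\<tau> k) (\<tau> l))"
    unfolding e_def using ikl by (intro germ_defect chen \<tau>_range \<tau>_mono) auto
  also have "\<dots> \<le> (H * (NY powr (1 + \<theta>) * x powr (1 + \<theta>)) + M * (U + c2 * (x * x) + DJ * xp + DV * U * x)) * x
      + cH * (NY powr \<theta> * x powr \<theta>) * (x * x)"
  proof (intro add_mono mult_mono ep lin)
    show "norm (X (\<tau> l) - X (\<tau> k)) \<le> x"
      using ikl by (intro order.trans[OF X_bound] Wx \<tau>_range \<tau>_mono) auto
    show "norm (XX (\<tau> k) (\<tau> l)) \<le> x * x"
      using ikl by (intro order.trans[OF XX_bound] W2 \<tau>_range \<tau>_mono) auto
  qed (use \<theta> H0 M1 cH_ge x0 xp0 U0 consts_nonneg c2_ge1 in auto)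
  also have "\<dots> = H * NY powr (1 + \<theta>) * (x powr (1 + \<theta>) * x) + M * c2 * (x * x * x)
      + cH * NY powr \<theta> * (x powr \<theta> * (x * x)) + M * DJ * (xp * x) + M * U * x + M * DV * (U * x * x)"
    by (simp add: algebra_simps)
  also have "\<dots> \<le> H * NY powr (1 + \<theta>) * xp + M * c2 * xp + cH * NY powr \<theta> * xp
      + M * DJ * (xp * \<eta>) + M * U * x + M * DV * (U * x * \<eta>)"
    unfolding pw1 pw2
    by (intro add_mono mult_left_mono pw3 x\<eta> order_refl)
      (use M1 c2_ge1 xp0 U0 x0 consts_nonneg in auto)
  also have "\<dots> = (Q + M * DJ * \<eta>) * xp + (M + M * DV * \<eta>) * U * x"
    by (simp add: Q_def algebra_simps)
  finally show ?thesis by (simp only: x_def xp_def U_def)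
qed

lemma J_self: "i \<le> n \<Longrightarrow> J i i = 0"
  by (simp add: J_def germ_def XX_diag \<tau>_range blinfun.zero_right)

lemma J_step: "i < n \<Longrightarrow> J i (Suc i) = 0"
  by (simp add: J_def step)

lemma J_bound:
  assumes ij: "i \<le> j" "j \<le> n" and small: "W i j \<le> h"
    and IH: "\<And>k l. i \<le> k \<Longrightarrow> k \<le> l \<Longrightarrow> l \<le> j \<Longrightarrow> l - k < j - i \<Longrightarrow> good k l"
  shows "norm (J i j) \<le> DJ * W i j powr p + DV * V i j * W i j powr \<beta>"
proof (cases "Suc i < j")
  case False
  then have "j = i \<or> j = Suc i" using ij by auto
  then have "J i j = 0" using J_self J_step ij by auto
  then show ?thesis using consts_nonneg V_nonneg[OF ij] by simp
next
  case True
  define x where "x = W i j powr \<beta>"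
  define xp where "xp = W i j powr p"
  define U where "U = V i j"
  have x0: "0 \<le> x" and xp0: "0 \<le> xp" and U0: "0 \<le> U" using ij V_nonneg by (auto simp: x_def xp_def U_def)
  obtain k where k: "i \<le> k" "k < j" "W i k \<le> W i j / 2" "W (Suc k) j \<le> W i j / 2"
    using split[of i j] True ij by auto
  let ?d1 = "E (y i) (\<tau> i) (\<tau> k) + E (y k) (\<tau> k) (\<tau> j) - E (y i) (\<tau> i) (\<tau> j)"
  let ?d2 = "E (y k) (\<tau> k) (\<tau> (Suc k)) + E (y (Suc k)) (\<tau> (Suc k)) (\<tau> j) - E (y k) (\<tau> k) (\<tau> j)"
  let ?B = "(Q + M * DJ * \<eta>) * xp + (M + M * DV * \<eta>) * U * x"
  \<comment> \<open>The case assumption \<open>Suc i < j\<close> makes the middle step shorter than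
    the whole interval.\<close>
  have good1: "good i k" and good2: "good (Suc k) j" and good3: "good k (Suc k)"
    using k True by (auto intro!: IH)
  have d1: "norm ?d1 \<le> ?B" unfolding x_def xp_def U_def using k ij small good1 by (intro defect) auto
  have d2: "norm ?d2 \<le> ?B" unfolding x_def xp_def U_def using k ij small good3 by (intro defect) auto
  \<comment> \<open>On one step the scheme is the germ itself, so the middle step adds no deviation
    although its control need not be halved.\<close>
  have "J k (Suc k) = 0" using k ij by (intro J_step) auto
  then have "J i j = J i k + J (Suc k) j + (?d1 + ?d2)" by (simp add: J_def algebra_simps)
  then have "norm (J i j) \<le> norm (J i k) + norm (J (Suc k) j) + (norm ?d1 + norm ?d2)"
    by (metis add_mono norm_triangle_ineq norm_triangle_le)
  also have "\<dots> \<le> norm (J i k) + norm (J (Suc k) j) + 2 * ?B"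
    unfolding mult_2 by (intro add_mono order_refl d1 d2)
  also have "norm (J i k) + norm (J (Suc k) j) \<le> DJ * lam * xp + DV * mu * U * x"
  proof -
    have W0: "0 \<le> W i j" using ij by (rule W_nonneg)
    have halfp: "(W i j / 2) powr p = lam / 2 * xp"
      using W0 by (simp add: xp_def lam_def powr_divide powr_diff powr_minus)
    have half\<beta>: "(W i j / 2) powr \<beta> = mu * x"
      using W0 by (simp add: x_def mu_def powr_divide powr_minus field_simps)
    have half: "norm (J a b) \<le> DJ * (lam / 2 * xp) + DV * V a b * (mu * x)"
      if "good a b" "a \<le> b" "b \<le> n" "W a b \<le> W i j / 2" for a b
    proof -
      have "norm (J a b) \<le> DJ * W a b powr p + DV * V a b * W a b powr \<beta>"
        using that by (simp add: good_def)
      also have "\<dots> \<le> DJ * (W i j / 2) powr p + DV * V a b * (W i j / 2) powr \<beta>"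
        using that consts_nonneg p_gt1 \<beta>_pos
        by (intro add_mono mult_left_mono powr_mono2 W_nonneg mult_nonneg_nonneg V_nonneg) auto
      finally show ?thesis by (simp only: halfp half\<beta>)
    qed
    \<comment> \<open>No factor 2 appears: the V term contracts by \<open>mu\<close> for any
      positive exponent \<beta>.\<close>
    have "V i k + V (Suc k) j \<le> U"
      using V_superadd[of i k j] V_mono[of k "Suc k" j j] k ij by (simp add: U_def)
    then have "DV * (V i k + V (Suc k) j) * (mu * x) \<le> DV * U * (mu * x)"
      using consts_nonneg mu x0 by (intro mult_right_mono mult_left_mono) auto
    moreover have "norm (J i k) \<le> DJ * (lam / 2 * xp) + DV * V i k * (mu * x)"
      using good1 k ij by (intro half) auto
    moreover have "norm (J (Suc k) j) \<le> DJ * (lam / 2 * xp) + DV * V (Suc k) j * (mu * x)"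
      using good2 k ij by (intro half) auto
    ultimately show ?thesis by (simp add: algebra_simps)
  qed
  also have "DJ * lam * xp + DV * mu * U * x + 2 * ?B
      = (DJ * lam + 2 * Q + 2 * M * \<eta> * DJ) * xp + (DV * mu + 2 * M + 2 * M * \<eta> * DV) * (U * x)"
    by (simp add: algebra_simps)
  also have "\<dots> \<le> DJ * xp + DV * (U * x)"
  proof (intro add_mono mult_right_mono)
    \<comment> \<open>(1 - lam) * DJ equals 4 * Q: one half pays for the 2 * Q from the two defects,
      the other absorbs the feedback. The same division is made for \<open>DV\<close>, with 4 * M in
      place of 4 * Q.\<close>
    have "2 * M * \<eta> * DJ \<le> (1 - lam) / 2 * DJ"
      using \<eta>_bounds(1) consts_nonneg by (intro mult_right_mono) auto
    moreover have "(1 - lam) * DJ = 4 * Q" using lam by (simp add: DJ_def)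
    ultimately show "DJ * lam + 2 * Q + 2 * M * \<eta> * DJ \<le> DJ" by (simp add: algebra_simps)
    have "2 * M * \<eta> * DV \<le> (1 - mu) / 2 * DV"
      using \<eta>_bounds(2) consts_nonneg by (intro mult_right_mono) auto
    moreover have "(1 - mu) * DV = 4 * M" using mu by (simp add: DV_def)
    ultimately show "DV * mu + 2 * M + 2 * M * \<eta> * DV \<le> DV" by (simp add: algebra_simps)
  qed (use x0 xp0 U0 in auto)
  finally show ?thesis by (simp add: x_def xp_def U_def mult.assoc)
qed

text \<open>Strong induction on the number of steps. The deviation bound involves V, V involves the
  oscillation, and the oscillation involves the increment over the full interval; smallness of
  \<eta> breaks this circle.\<close>

lemma good_small:
  assumes "i \<le> j" "j \<le> n" "W i j \<le> h"
  shows "good i j"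
  using assms
proof (induction "j - i" arbitrary: i j rule: less_induct)
  case less
  define x where "x = W i j powr \<beta>"
  define U where "U = V i j"
  define \<zeta> where "\<zeta> = norm (z j - z i)"
  have x0: "0 \<le> x" by (simp add: x_def)
  have U0: "0 \<le> U" using less.prems V_nonneg by (simp add: U_def)
  have x\<eta>: "x \<le> \<eta>" unfolding x_def
    using less.prems by (intro w_powr_le_\<eta> \<tau>_range \<tau>_mono) auto
  have IH: "good k l" if "i \<le> k" "k \<le> l" "l \<le> j" "l - k < j - i" for k l
    using that less.prems by (intro less.hyps order.trans[OF W_mono[of i k l j]]) auto
  have Jij: "norm (J i j) \<le> DJ * W i j powr p + DV * U * x"
    unfolding U_def x_def using less.prems IH by (intro J_bound) auto
  \<comment> \<open>Shorter subintervals fall under the induction hypothesis. The full interval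
    contributes its own increment \<zeta>, still without a bound; it comes back with the factor DV *
    \<rho> * x \<le> 1/2 and is absorbed.\<close>
  have U: "U \<le> \<rho> * (2 * N0 * x + (N * x + \<zeta>))"
    unfolding U_def x_def
  proof (rule V_le[OF less.prems(1,2)])
    fix k l assume kl: "i \<le> k" "k \<le> l" "l \<le> j"
    show "norm (z l - z k) \<le> N * W i j powr \<beta> + \<zeta>"
    proof (cases "l - k < j - i")
      case True
      have "norm (z l - z k) \<le> N * W k l powr \<beta>" using IH[OF kl True] by (simp add: good_def)
      also have "\<dots> \<le> N * W i j powr \<beta>"
        using kl less.prems consts_nonneg \<beta>_pos by (intro mult_left_mono powr_mono2 W_mono W_nonneg) auto
      finally show ?thesis by (simp add: \<zeta>_def add_increasing2)
    next
      case False
      with kl have "k = i" "l = j" by auto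
      then show ?thesis using consts_nonneg by (simp add: \<zeta>_def)
    qed
  qed
  have z1: "\<zeta> \<le> M * x + c2 * (x * x) + norm (J i j)"
  proof -
    have "z j - z i = E (y i) (\<tau> i) (\<tau> j) + J i j" by (simp add: J_def)
    moreover have "W i j powr (2 * \<beta>) = x * x" by (simp add: x_def powr_add[symmetric])
    ultimately show ?thesis
      using germ_bound[of "\<tau> i" "\<tau> j" "y i"] less.prems \<tau>_range \<tau>_mono
        norm_triangle_ineq[of "E (y i) (\<tau> i) (\<tau> j)" "J i j"] by (simp add: \<zeta>_def x_def)
  qed
  have "W i j powr p \<le> W i j powr (2 * \<beta>)"
    using less.prems W_nonneg[of i j] h_le1 p_ge by (intro powr_mono') auto
  then have xp: "W i j powr p \<le> x * x" by (simp add: x_def powr_add[symmetric])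
  have "DJ * W i j powr p \<le> DJ * (x * x)" using xp consts_nonneg by (intro mult_left_mono) auto
  moreover have "DV * U * x \<le> DV * (\<rho> * (2 * N0 * x + (N * x + \<zeta>))) * x"
    using U consts_nonneg x0 by (intro mult_right_mono mult_left_mono) auto
  ultimately have "\<zeta> \<le> M * x + (c2 + DJ + DV * \<rho> * (2 * N0 + N)) * x * x + DV * \<rho> * x * \<zeta>"
    using z1 Jij by (simp add: algebra_simps)
  also have "(c2 + DJ + DV * \<rho> * (2 * N0 + N)) * x * x \<le> 1 * x"
  proof (rule mult_right_mono)
    have "(c2 + DJ + DV * \<rho> * (2 * N0 + N)) * x \<le> (c2 + DJ + DV * \<rho> * (2 * N0 + N)) * \<eta>"
      using x\<eta> c2_ge1 consts_nonneg \<rho>0 by (intro mult_left_mono) auto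
    then show "(c2 + DJ + DV * \<rho> * (2 * N0 + N)) * x \<le> 1" using \<eta>_bounds(4) by linarith
  qed (rule x0)
  also have "DV * \<rho> * x * \<zeta> \<le> 1 / 2 * \<zeta>"
  proof (rule mult_right_mono)
    have "DV * \<rho> * x \<le> DV * \<rho> * \<eta>"
      using x\<eta> consts_nonneg \<rho>0 by (intro mult_left_mono) auto
    then show "DV * \<rho> * x \<le> 1 / 2" using \<eta>_bounds(3) by linarith
  qed (simp add: \<zeta>_def)
  \<comment> \<open>At this point \<zeta> \<le> M * x + x + \<zeta> / 2, which explains N = 2 * (M +
    1).\<close>
  finally have zN: "\<zeta> \<le> N * x" by (simp add: N_def algebra_simps)
  \<comment> \<open>\<open>V_le\<close> a second time, now with the increment itself bounded by N *
    x, removes \<zeta> from the bound on V.\<close>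
  have "U \<le> \<rho> * (2 * N0 * x + N * x)"
    unfolding U_def x_def
  proof (rule V_le[OF less.prems(1,2)])
    fix k l assume kl: "i \<le> k" "k \<le> l" "l \<le> j"
    show "norm (z l - z k) \<le> N * W i j powr \<beta>"
    proof (cases "l - k < j - i")
      case True
      have "norm (z l - z k) \<le> N * W k l powr \<beta>" using IH[OF kl True] by (simp add: good_def)
      also have "\<dots> \<le> N * W i j powr \<beta>"
        using kl less.prems consts_nonneg \<beta>_pos by (intro mult_left_mono powr_mono2 W_mono W_nonneg) auto
      finally show ?thesis .
    next
      case False
      with kl have "k = i" "l = j" by auto
      then show ?thesis using zN by (simp add: \<zeta>_def x_def)
    qed
  qed
  then have "U \<le> NV * x" by (simp add: NV_def algebra_simps)
  with zN Jij show ?case by (simp add: good_def U_def x_def \<zeta>_def)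
qed

end

section \<open>Euler paths\<close>

lemma cpathI: "continuous_on {0..T} f \<Longrightarrow> restrict f {0..T} \<in> cpath T"
  unfolding cpath_iff by (auto intro: continuous_on_eq[of _ f])

lemma cpath_continuous: "x \<in> cpath T \<Longrightarrow> continuous_on {0..T} x"
  unfolding cpath_iff by blast

text \<open>\<Phi> stands for the transformed drift. The existence argument sees only the conditions
  listed here and knows nothing of the implicit equation behind it.\<close>

locale path_dependent_euler = rough_euler \<sigma> M H \<theta> \<beta> \<rho> T w X XX
  for \<sigma> :: "real^'n \<Rightarrow> ((real^'d) \<Rightarrow>\<^sub>L (real^'n))" and M H \<theta> \<beta> \<rho> T w
    and X :: "real \<Rightarrow> real^'d" and XX +
  fixes \<Phi> :: "(real \<Rightarrow> real^'n) \<Rightarrow> real \<Rightarrow> real^'n" and \<rho>' :: real and \<xi> :: "real^'n"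
  assumes \<Phi>_cpath: "x \<in> cpath T \<Longrightarrow> \<Phi> x \<in> cpath T"
    and \<rho>': "0 < \<rho>'" and \<Phi>_Lip: "Lip_cond T \<rho>' \<Phi>" and \<Phi>_BV: "BV_cond T \<rho> \<Phi>"
begin

lemma \<Phi>_lipschitz:
  assumes xy: "x \<in> cpath T" "y \<in> cpath T" and t: "0 \<le> t" "t \<le> T"
    and B: "\<And>u. 0 \<le> u \<Longrightarrow> u \<le> t \<Longrightarrow> norm (x u - y u) \<le> B"
  shows "norm (\<Phi> x t - \<Phi> y t) \<le> \<rho>' * B"
proof -
  have "continuous_on {0..t} (\<lambda>u. norm (\<Phi> x u - \<Phi> y u))"
    using cpath_continuous[OF \<Phi>_cpath[OF xy(1)]] cpath_continuous[OF \<Phi>_cpath[OF xy(2)]] t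
    by (intro continuous_intros) (auto elim: continuous_on_subset)
  then have "bdd_above ((\<lambda>u. norm (\<Phi> x u - \<Phi> y u)) ` {0..t})"
    by (intro bounded_imp_bdd_above compact_imp_bounded compact_continuous_image) auto
  then have "norm (\<Phi> x t - \<Phi> y t) \<le> sup_norm (\<lambda>u. \<Phi> x u - \<Phi> y u) 0 t"
    unfolding sup_norm_def using t by (intro cSUP_upper) auto
  also have "\<dots> \<le> \<rho>' * sup_norm (\<lambda>u. x u - y u) 0 t"
    using \<Phi>_Lip xy t unfolding Lip_cond_def by auto
  also have "sup_norm (\<lambda>u. x u - y u) 0 t \<le> B"
    unfolding sup_norm_def using t B by (intro cSUP_least) auto
  finally show ?thesis using \<rho>' by simp
qed

text \<open>Causality is the Lipschitz condition with distance 0. It is what allows the scheme to be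
  built one step after the other.\<close>

lemma \<Phi>_nonanticipating:
  "x \<in> cpath T \<Longrightarrow> y \<in> cpath T \<Longrightarrow> 0 \<le> t \<Longrightarrow> t \<le> T \<Longrightarrow> (\<And>u. 0 \<le> u \<Longrightarrow> u \<le> t \<Longrightarrow> x u = y u) \<Longrightarrow> \<Phi> x t = \<Phi> y t"
  using \<Phi>_lipschitz[of x y t 0] by simp

definition V :: "(real \<Rightarrow> real^'n) \<Rightarrow> real \<Rightarrow> real \<Rightarrow> real"
  where "V x s t = enn2real (total_variation (\<Phi> x) s t)"

lemma total_variation_\<Phi>:
  assumes x: "x \<in> cpath T" and st: "0 \<le> s" "s \<le> t" "t \<le> T"
    and B: "\<And>u v. s \<le> u \<Longrightarrow> u \<le> v \<Longrightarrow> v \<le> t \<Longrightarrow> norm (x v - x u) \<le> B"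
  shows "total_variation (\<Phi> x) s t \<le> ennreal (\<rho> * B)"
proof -
  have "total_variation (\<Phi> x) s t \<le> ennreal (\<rho> * sup_variation x s t)"
    using \<Phi>_BV x st unfolding BV_cond_def by blast
  also have "\<dots> \<le> ennreal (\<rho> * B)"
    using st B \<rho>0 by (intro ennreal_leI mult_left_mono sup_variation_le) auto
  finally show ?thesis .
qed

lemma V_le_osc:
  assumes "x \<in> cpath T" "0 \<le> s" "s \<le> t" "t \<le> T"
    and "\<And>u v. s \<le> u \<Longrightarrow> u \<le> v \<Longrightarrow> v \<le> t \<Longrightarrow> norm (x v - x u) \<le> B"
  shows "V x s t \<le> \<rho> * B"
proof -
  have "0 \<le> B" using assms(3) assms(5)[of s s] by simp
  then show ?thesis
    unfolding V_def using total_variation_\<Phi>[OF assms] \<rho>0 by (intro enn2real_leI) auto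
qed

text \<open>\<open>BV_cond\<close> bounds the variation by a real number, so \<open>enn2real\<close>
  loses nothing and \<open>V\<close> inherits superadditivity and the bound on increments.\<close>

lemma total_variation_V:
  assumes x: "x \<in> cpath T" and st: "0 \<le> s" "s \<le> t" "t \<le> T"
  shows "total_variation (\<Phi> x) s t = ennreal (V x s t)"
proof -
  have "total_variation (\<Phi> x) s t \<le> ennreal (\<rho> * sup_variation x s t)"
    using \<Phi>_BV x st unfolding BV_cond_def by blast
  then have "total_variation (\<Phi> x) s t < \<infinity>" using ennreal_less_top le_less_trans by (metis infinity_ennreal_def)
  then show ?thesis by (simp add: V_def less_top)
qed

lemma V_nonneg: "0 \<le> V x s t" by (simp add: V_def)

lemma V_superadd:
  assumes x: "x \<in> cpath T" and st: "0 \<le> s" "s \<le> u" "u \<le> t" "t \<le> T"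
  shows "V x s u + V x u t \<le> V x s t"
proof -
  have "ennreal (V x s u + V x u t) \<le> ennreal (V x s t)"
    using total_variation_superadd[OF st(2,3), of "\<Phi> x"] st
    by (simp add: total_variation_V[OF x] V_nonneg)
  then show ?thesis using V_nonneg by (subst (asm) ennreal_le_iff) auto
qed

lemma V_drift:
  assumes x: "x \<in> cpath T" and st: "0 \<le> s" "s \<le> t" "t \<le> T"
  shows "norm (\<Phi> x t - \<Phi> x s) \<le> V x s t"
  using norm_le_total_variation[OF st(2), of "\<Phi> x"] V_nonneg
  by (simp add: total_variation_V[OF x st])

section \<open>Equidistant grids and construction of the Euler paths\<close>

definition grid :: "nat \<Rightarrow> nat \<Rightarrow> real" where "grid n i = real i * T / real n"

lemma grid_0 [simp]: "grid n 0 = 0" and grid_n: "0 < n \<Longrightarrow> grid n n = T"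
  by (auto simp: grid_def)

lemma grid_mono: "i \<le> j \<Longrightarrow> grid n i \<le> grid n j"
  using T0 by (auto simp: grid_def intro!: divide_right_mono mult_right_mono)

lemma grid_le_iff: "0 < n \<Longrightarrow> grid n i \<le> grid n j \<longleftrightarrow> i \<le> j"
  using T0 by (simp add: grid_def divide_le_cancel)

lemma grid_nonneg: "0 \<le> grid n i"
  using grid_mono[of 0 i n] by simp

lemma grid_le_T: "0 < n \<Longrightarrow> i \<le> n \<Longrightarrow> grid n i \<le> T"
  using grid_mono[of i n n] grid_n by simp

definition idx :: "nat \<Rightarrow> real \<Rightarrow> nat" where "idx n s = nat \<lfloor>s * real n / T\<rfloor>"

lemma idx:
  assumes n: "0 < n" and s: "0 \<le> s" "s \<le> T"
  shows "idx n s \<le> n" "grid n (idx n s) \<le> s" "s < grid n (Suc (idx n s))"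
proof -
  let ?r = "s * real n / T"
  have r0: "0 \<le> ?r" using s T0 by simp
  then have fl: "real (idx n s) = of_int \<lfloor>?r\<rfloor>" by (simp add: idx_def)
  have "real (idx n s) \<le> ?r" "?r < real (idx n s) + 1" unfolding fl by linarith+
  then show "grid n (idx n s) \<le> s" "s < grid n (Suc (idx n s))"
    using T0 n by (auto simp: grid_def field_simps)
  have "?r \<le> real n" using s T0 n by (simp add: field_simps)
  with \<open>real (idx n s) \<le> ?r\<close> show "idx n s \<le> n" by linarith
qed

lemma idx_mono: "s \<le> t \<Longrightarrow> idx n s \<le> idx n t"
  unfolding idx_def using T0 by (intro nat_mono floor_mono divide_right_mono mult_right_mono) auto

lemma grid_step: "grid n (Suc i) = grid n i + T / real n"
  by (simp add: grid_def distrib_right add_divide_distrib)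

text \<open>A clamped time adds a zero germ before step i and freezes the path after it. Every stage
  is then a continuous path on all of [0,T], as \<Phi> requires.\<close>

abbreviation clamp :: "nat \<Rightarrow> nat \<Rightarrow> real \<Rightarrow> real"
  where "clamp n i t \<equiv> max (grid n i) (min t (grid n (Suc i)))"

text \<open>\<open>eul n i\<close> is the Euler path with \<open>n\<close> steps, stopped after \<open>i\<close> of them.\<close>

primrec eul :: "nat \<Rightarrow> nat \<Rightarrow> real \<Rightarrow> real^'n" where
  "eul n 0 = (\<lambda>t\<in>{0..T}. \<xi>)"
| "eul n (Suc i) = (\<lambda>t\<in>{0..T}. eul n i t
     + E (eul n i (grid n i) + \<Phi> (eul n i) (grid n i)) (grid n i) (clamp n i t))"

lemma germ_self: "0 \<le> s \<Longrightarrow> s \<le> T \<Longrightarrow> E x s s = 0"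
  by (simp add: germ_def XX_diag blinfun.zero_right)

lemma germ_continuous: "0 \<le> s \<Longrightarrow> continuous_on {s..T} (E x s)"
  unfolding germ_def
  by (intro continuous_intros continuous_on_A XX_continuous blinfun.continuous_on
      continuous_on_subset[OF X_continuous]) auto

lemma eul_cpath: "0 < n \<Longrightarrow> i \<le> n \<Longrightarrow> eul n i \<in> cpath T"
proof (induction i)
  case (Suc i)
  have "continuous_on {0..T} (\<lambda>t. E (eul n i (grid n i) + \<Phi> (eul n i) (grid n i)) (grid n i) (clamp n i t))"
    using Suc.prems grid_le_T[of n i] grid_le_T[of n "Suc i"] grid_nonneg[of n i]
    by (intro continuous_on_compose2[OF germ_continuous[of "grid n i"]] continuous_intros) auto
  moreover have "continuous_on {0..T} (eul n i)"
    using Suc by (intro cpath_continuous) simp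
  ultimately show ?case by (simp only: eul.simps cpathI continuous_on_add)
qed (simp only: eul.simps cpathI continuous_on_const)

lemma eul_stopped: "0 < n \<Longrightarrow> i \<le> n \<Longrightarrow> grid n i \<le> t \<Longrightarrow> t \<le> T \<Longrightarrow> eul n i t = eul n i (grid n i)"
proof (induction i arbitrary: t)
  case 0
  then show ?case using T0 by auto
next
  case (Suc i)
  have i: "grid n i \<le> grid n (Suc i)" by (intro grid_mono) auto
  have T: "grid n (Suc i) \<le> T" using Suc.prems by (intro grid_le_T)
  have "eul n i t = eul n i (grid n i)" "eul n i (grid n (Suc i)) = eul n i (grid n i)"
    using Suc.prems i T by (auto intro!: Suc.IH)
  then show ?case using Suc.prems i T grid_nonneg[of n i] grid_nonneg[of n "Suc i"] by (simp add: min_absorb2)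
qed

lemma eul_Suc_eq: "0 < n \<Longrightarrow> i \<le> n \<Longrightarrow> 0 \<le> t \<Longrightarrow> t \<le> grid n i \<Longrightarrow> eul n (Suc i) t = eul n i t"
  using grid_mono[of i "Suc i" n] grid_le_T[of n i] grid_nonneg[of n i]
  by (simp add: germ_self min_absorb1 max_absorb1)

lemma eul_eq: "0 < n \<Longrightarrow> i \<le> m \<Longrightarrow> m \<le> n \<Longrightarrow> 0 \<le> t \<Longrightarrow> t \<le> grid n i \<Longrightarrow> eul n m t = eul n i t"
proof (induction m)
  case (Suc m)
  show ?case
  proof (cases "i = Suc m")
    case False
    then have "eul n m t = eul n i t" "t \<le> grid n m"
      using Suc grid_mono[of i m n] by auto
    then show ?thesis using eul_Suc_eq[of n m t] Suc.prems by simp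
  qed simp
qed simp

text \<open>The recursion is stated for the finished path, drift included. The later estimates rest
  on this property alone and not on the construction by stages.\<close>

definition euler_path :: "nat \<Rightarrow> (real \<Rightarrow> real^'n) \<Rightarrow> bool" where
  "euler_path n Z \<longleftrightarrow> Z \<in> cpath T \<and> Z 0 = \<xi> \<and> (\<forall>i<n. \<forall>t. grid n i \<le> t \<longrightarrow> t \<le> grid n (Suc i) \<longrightarrow>
     Z t = Z (grid n i) + E (Z (grid n i) + \<Phi> Z (grid n i)) (grid n i) t)"

lemma euler_path_eul:
  assumes n: "0 < n"
  shows "euler_path n (eul n n)"
  unfolding euler_path_def
proof (intro conjI allI impI)
  show "eul n n \<in> cpath T" using n by (intro eul_cpath) auto
  show "eul n n 0 = \<xi>" using eul_eq[of n 0 n 0] n T0 by simp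
  fix i t assume i: "i < n" and t: "grid n i \<le> t" "t \<le> grid n (Suc i)"
  have g: "0 \<le> grid n i" "grid n i \<le> T" "grid n (Suc i) \<le> T" "grid n i \<le> grid n (Suc i)"
    using i n by (auto intro: grid_nonneg grid_le_T grid_mono)
  have "eul n n t = eul n (Suc i) t"
    using i n t g by (intro eul_eq) auto
  also have "\<dots> = eul n i (grid n i) + E (eul n i (grid n i) + \<Phi> (eul n i) (grid n i)) (grid n i) t"
    using i n t g eul_stopped[of n i t] by (simp add: min_absorb1)
  also have "eul n i (grid n i) = eul n n (grid n i)"
    using i n g by (intro eul_eq[symmetric]) auto
  \<comment> \<open>The construction evaluates the drift along the stopped path; by causality this
    is the drift of the finished path.\<close>
  also have "\<Phi> (eul n i) (grid n i) = \<Phi> (eul n n) (grid n i)"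
    using i n g by (intro \<Phi>_nonanticipating eul_cpath eul_eq[symmetric]) auto
  finally show "eul n n t = eul n n (grid n i) + E (eul n n (grid n i) + \<Phi> (eul n n) (grid n i)) (grid n i) t" .
qed

section \<open>Estimates for one Euler path on a sufficiently fine grid\<close>

context
  fixes n :: nat and Z :: "real \<Rightarrow> real^'n"
  assumes n: "0 < n" and Z: "euler_path n Z"
    and fine: "\<And>i. i < n \<Longrightarrow> w (grid n i) (grid n (Suc i)) \<le> h"
begin

lemma Z_cpath: "Z \<in> cpath T" using Z by (simp add: euler_path_def)

text \<open>Inside a step w^\<beta> \<le> \<eta> \<le> 1, so second-order terms are bounded by
  first-order ones; their constants add up to N0 = M + 2 * c2.\<close>

lemma increment_in_step:
  assumes i: "i < n" and ut: "grid n i \<le> u" "u \<le> t" "t \<le> grid n (Suc i)"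
  shows "norm (Z t - Z u) \<le> N0 * w u t powr \<beta>"
proof -
  have g: "0 \<le> grid n i" "grid n (Suc i) \<le> T" using i n by (auto intro: grid_nonneg grid_le_T)
  let ?y = "Z (grid n i) + \<Phi> Z (grid n i)" and ?x = "w u t powr \<beta>"
  have "Z t - Z u = E ?y (grid n i) t - E ?y (grid n i) u"
  proof -
    have "Z r = Z (grid n i) + E ?y (grid n i) r" if "grid n i \<le> r" "r \<le> grid n (Suc i)" for r
      using Z i that unfolding euler_path_def by blast
    from this[of t] this[of u] ut show ?thesis by simp
  qed
  also have "norm \<dots> \<le> M * norm (X t - X u) + c2 * norm (XX u t) + c2 * (norm (X u - X (grid n i)) * norm (X t - X u))"
    using g ut by (intro germ_in_step chen) auto
  also have "\<dots> \<le> M * ?x + c2 * (1 * ?x) + c2 * (1 * ?x)"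
  proof (intro add_mono mult_mono)
    have small: "w u' t' powr \<beta> \<le> 1" if "grid n i \<le> u'" "u' \<le> t'" "t' \<le> grid n (Suc i)" for u' t'
      using w_powr_le_\<eta>[of "grid n i" "grid n (Suc i)"] w_powr_mono[of \<beta> "grid n i" u' t' "grid n (Suc i)"]
        fine[OF i] that g \<eta>_le1 \<beta>_pos by auto
    show "norm (X t - X u) \<le> ?x" "norm (X t - X u) \<le> ?x" using g ut by (auto intro!: X_bound)
    have "norm (XX u t) \<le> ?x * ?x" using XX_bound[of u t] g ut by (simp add: powr_add[symmetric])
    also have "\<dots> \<le> 1 * ?x" using small[OF ut] by (intro mult_right_mono) auto
    finally show "norm (XX u t) \<le> 1 * ?x" .
    show "norm (X u - X (grid n i)) \<le> 1"
      using g ut by (intro order.trans[OF X_bound small]) auto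
  qed (use M1 c2_ge1 in auto)
  also have "\<dots> = N0 * ?x" by (simp add: N0_def algebra_simps)
  finally show ?thesis .
qed

text \<open>u is moved up and v down to a grid point; the two incomplete steps cost N0 * w^\<beta>
  each. If no grid point lies between u and v, both belong to the same step.\<close>

lemma increment_via_grid:
  assumes uv: "0 \<le> s" "s \<le> u" "u \<le> v" "v \<le> t" "t \<le> T"
    and B: "\<And>k l. k \<le> l \<Longrightarrow> l \<le> n \<Longrightarrow> s \<le> grid n k \<Longrightarrow> grid n l \<le> t \<Longrightarrow>
      norm (Z (grid n l) - Z (grid n k)) \<le> B" and B0: "0 \<le> B"
  shows "norm (Z v - Z u) \<le> 2 * N0 * w s t powr \<beta> + B"
proof -
  let ?i = "idx n u" and ?l = "idx n v"
  have i: "?i \<le> n" "grid n ?i \<le> u" "u < grid n (Suc ?i)" and l: "?l \<le> n" "grid n ?l \<le> v" "v < grid n (Suc ?l)"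
    using idx[OF n] uv by auto
  have x: "N0 * w a b powr \<beta> \<le> N0 * w s t powr \<beta>" if "s \<le> a" "a \<le> b" "b \<le> t" for a b
    using that uv \<beta>_pos consts_nonneg by (intro mult_left_mono w_powr_mono) auto
  have x0: "0 \<le> N0 * w s t powr \<beta>" using consts_nonneg by simp
  show ?thesis
  proof (cases "?i < n \<and> grid n (Suc ?i) < v")
    case True
    have kl: "Suc ?i \<le> ?l"
    proof (rule ccontr)
      assume "\<not> Suc ?i \<le> ?l"
      then have "grid n (Suc ?l) \<le> grid n (Suc ?i)" by (intro grid_mono) auto
      with True l show False by linarith
    qed
    have gkl: "grid n (Suc ?i) \<le> grid n ?l" using kl by (rule grid_mono)
    have a: "norm (Z (grid n (Suc ?i)) - Z u) \<le> N0 * w u (grid n (Suc ?i)) powr \<beta>"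
      using True i by (intro increment_in_step) auto
    \<comment> \<open>If \<open>idx n v\<close> is n, then v = T is the last grid point, no step
      starts there, and this piece is empty. The same happens to u further down.\<close>
    have b: "norm (Z v - Z (grid n ?l)) \<le> N0 * w (grid n ?l) v powr \<beta>"
    proof (cases "?l < n")
      case True
      with l show ?thesis by (intro increment_in_step) auto
    next
      case False
      with l(1) have "?l = n" by simp
      then have "v = grid n ?l" using l(2) uv grid_n[OF n] by simp
      then show ?thesis using consts_nonneg by simp
    qed
    have c: "norm (Z (grid n ?l) - Z (grid n (Suc ?i))) \<le> B"
      using kl l i uv by (intro B) auto
    have "Z v - Z u = (Z v - Z (grid n ?l)) + (Z (grid n ?l) - Z (grid n (Suc ?i))) + (Z (grid n (Suc ?i)) - Z u)"
      by simp
    then have "norm (Z v - Z u) \<le> norm (Z v - Z (grid n ?l)) + norm (Z (grid n ?l) - Z (grid n (Suc ?i)))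
        + norm (Z (grid n (Suc ?i)) - Z u)"
      by (metis add_mono norm_triangle_ineq norm_triangle_le order_refl)
    moreover have "N0 * w u (grid n (Suc ?i)) powr \<beta> \<le> N0 * w s t powr \<beta>"
      using uv i gkl l by (intro x) auto
    moreover have "N0 * w (grid n ?l) v powr \<beta> \<le> N0 * w s t powr \<beta>"
      using uv i gkl l by (intro x) auto
    ultimately show ?thesis using a b c by simp
  next
    case False
    have "norm (Z v - Z u) \<le> N0 * w u v powr \<beta>"
    proof (cases "?i < n")
      case True
      with False i uv show ?thesis by (intro increment_in_step[of ?i]) auto
    next
      case False
      with i(1) have "?i = n" by simp
      then have "u = T" "v = T" using i(2) uv grid_n[OF n] by auto
      then show ?thesis using consts_nonneg by simp
    qed
    with x[of u v] x0 uv B0 show ?thesis by simp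
  qed
qed

interpretation scheme: euler_scheme \<sigma> M H \<theta> \<beta> \<rho> T w X XX n "grid n"
  "\<lambda>i. Z (grid n i) + \<Phi> Z (grid n i)" "\<lambda>i. Z (grid n i)" "\<lambda>i j. V Z (grid n i) (grid n j)"
proof unfold_locales
  fix i j k :: nat
  show "i \<le> j \<Longrightarrow> j \<le> n \<Longrightarrow> grid n i \<le> grid n j" by (rule grid_mono)
  show "0 \<le> grid n i" "i \<le> n \<Longrightarrow> grid n i \<le> T" using n by (auto intro: grid_nonneg grid_le_T)
  show "Z (grid n (Suc i)) = Z (grid n i) + E (Z (grid n i) + \<Phi> Z (grid n i)) (grid n i) (grid n (Suc i))"
    if "i < n"
  proof -
    have "grid n i \<le> grid n (Suc i)" by (rule grid_mono) simp
    then show ?thesis using Z that unfolding euler_path_def by blast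
  qed
  show "i \<le> j \<Longrightarrow> j \<le> k \<Longrightarrow> k \<le> n \<Longrightarrow> V Z (grid n i) (grid n j) + V Z (grid n j) (grid n k) \<le> V Z (grid n i) (grid n k)"
    using n by (intro V_superadd Z_cpath grid_mono grid_nonneg grid_le_T)
  show "0 \<le> V Z (grid n i) (grid n j)" by (rule V_nonneg)
  show "norm ((Z (grid n j) + \<Phi> Z (grid n j) - Z (grid n j)) - (Z (grid n i) + \<Phi> Z (grid n i) - Z (grid n i)))
      \<le> V Z (grid n i) (grid n j)" if "i \<le> j" "j \<le> n"
    using V_drift[OF Z_cpath, of "grid n i" "grid n j"] that n by (simp add: grid_mono grid_nonneg grid_le_T)
  show "V Z (grid n i) (grid n j) \<le> \<rho> * (2 * N0 * w (grid n i) (grid n j) powr \<beta> + B)"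
    if ij: "i \<le> j" "j \<le> n"
      and B: "\<And>k l. i \<le> k \<Longrightarrow> k \<le> l \<Longrightarrow> l \<le> j \<Longrightarrow> norm (Z (grid n l) - Z (grid n k)) \<le> B" for B
  proof (rule V_le_osc[OF Z_cpath])
    have B0: "0 \<le> B" using B[of i i] ij by simp
    fix u v assume "grid n i \<le> u" "u \<le> v" "v \<le> grid n j"
    then show "norm (Z v - Z u) \<le> 2 * N0 * w (grid n i) (grid n j) powr \<beta> + B"
      using ij n B0 grid_le_iff[OF n]
      by (intro increment_via_grid grid_nonneg grid_le_T B) auto
  qed (use ij n in \<open>auto intro: grid_nonneg grid_mono grid_le_T\<close>)
qed

lemma grid_estimates:
  assumes "i \<le> j" "j \<le> n" "w (grid n i) (grid n j) \<le> h"
  shows "norm (Z (grid n j) - Z (grid n i) - E (Z (grid n i) + \<Phi> Z (grid n i)) (grid n i) (grid n j))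
      \<le> DJ * w (grid n i) (grid n j) powr p + DV * V Z (grid n i) (grid n j) * w (grid n i) (grid n j) powr \<beta>"
    and "norm (Z (grid n j) - Z (grid n i)) \<le> N * w (grid n i) (grid n j) powr \<beta>"
    and "V Z (grid n i) (grid n j) \<le> NV * w (grid n i) (grid n j) powr \<beta>"
  using scheme.good_small[OF assms] unfolding scheme.good_def scheme.J_def by auto

lemma increment_bound:
  assumes st: "0 \<le> s" "s \<le> t" "t \<le> T"
  shows "norm (Z t - Z s) \<le> (2 * N0 + N) * (1 + 2 * w 0 T / h) * w s t powr \<beta>"
proof (rule local_to_global[OF h_pos _ _ st])
  show "0 \<le> 2 * N0 + N" using consts_nonneg by simp
  fix s t assume st: "0 \<le> s" "s \<le> t" "t \<le> T" and small: "w s t \<le> h"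
  have "norm (Z t - Z s) \<le> 2 * N0 * w s t powr \<beta> + N * w s t powr \<beta>"
  proof (rule increment_via_grid[of s s t t])
    fix k l assume kl: "k \<le> l" "l \<le> n" "s \<le> grid n k" "grid n l \<le> t"
    have g: "grid n k \<le> grid n l" using kl by (intro grid_mono)
    have "w (grid n k) (grid n l) \<le> w s t" using kl g st by (intro w_mono) auto
    then have "norm (Z (grid n l) - Z (grid n k)) \<le> N * w (grid n k) (grid n l) powr \<beta>"
      using kl small by (intro grid_estimates) auto
    also have "\<dots> \<le> N * w s t powr \<beta>"
      using kl g st consts_nonneg \<beta>_pos by (intro mult_left_mono w_powr_mono) auto
    finally show "norm (Z (grid n l) - Z (grid n k)) \<le> N * w s t powr \<beta>" .
  qed (use st consts_nonneg in auto)
  then show "norm (Z t - Z s) \<le> (2 * N0 + N) * w s t powr \<beta>" by (simp add: distrib_right)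
qed

end

end

section \<open>Passage to the limit\<close>

text \<open>Uniform convergence to a continuous limit permits evaluation at moving points, here at
  times rounded to a changing grid.\<close>

lemma tendsto_uniform_compose:
  fixes f :: "nat \<Rightarrow> 'a::metric_space \<Rightarrow> 'b::real_normed_vector"
  assumes unif: "\<And>e. 0 < e \<Longrightarrow> \<exists>N. \<forall>m\<ge>N. \<forall>x\<in>S. norm (f m x - g x) < e"
    and g: "continuous_on S g" and u: "u \<longlonglongrightarrow> u0" "\<And>m. u m \<in> S" "u0 \<in> S"
  shows "(\<lambda>m. f m (u m)) \<longlonglongrightarrow> g u0"
proof -
  have "(\<lambda>m. f m (u m) - g (u m)) \<longlonglongrightarrow> 0"
  proof (rule LIMSEQ_I)
    fix e :: real assume "0 < e"
    from unif[OF this] show "\<exists>N. \<forall>m\<ge>N. norm (f m (u m) - g (u m) - 0) < e"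
      using u(2) by auto
  qed
  moreover have "(\<lambda>m. g (u m)) \<longlonglongrightarrow> g u0"
    using continuous_on_tendsto_compose[OF g u(1)] u by simp
  ultimately show ?thesis using tendsto_add by fastforce
qed

context path_dependent_euler
begin

definition A_glob :: real where "A_glob = (2 * N0 + N) * (1 + 2 * w 0 T / h)"

lemma A_glob_nonneg: "0 \<le> A_glob"
  using consts_nonneg h_pos w_nonneg[of 0 T] T0 by (simp add: A_glob_def)

definition dev :: "(real \<Rightarrow> real^'n) \<Rightarrow> real \<Rightarrow> real \<Rightarrow> real^'n"
  where "dev Z s t = Z t - Z s - E (Z s + \<Phi> Z s) s t"

lemma V_le_global:
  assumes Z: "Z \<in> cpath T"
    and inc: "\<And>s t. 0 \<le> s \<Longrightarrow> s \<le> t \<Longrightarrow> t \<le> T \<Longrightarrow> norm (Z t - Z s) \<le> A_glob * w s t powr \<beta>"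
  shows "V Z 0 T \<le> \<rho> * (A_glob * w 0 T powr \<beta>)"
proof (rule V_le_osc[OF Z])
  fix u v assume uv: "0 \<le> u" "u \<le> v" "v \<le> T"
  then have "A_glob * w u v powr \<beta> \<le> A_glob * w 0 T powr \<beta>"
    using A_glob_nonneg \<beta>_pos by (intro mult_left_mono w_powr_mono) auto
  with inc[OF uv] show "norm (Z v - Z u) \<le> A_glob * w 0 T powr \<beta>" by simp
qed (use T0 in auto)

lemma euler_limit:
  obtains Z where "Z \<in> cpath T"
    and "\<And>s t. 0 \<le> s \<Longrightarrow> s \<le> t \<Longrightarrow> t \<le> T \<Longrightarrow> norm (Z t - Z s) \<le> A_glob * w s t powr \<beta>"
    and "\<And>s t. 0 \<le> s \<Longrightarrow> s \<le> t \<Longrightarrow> t \<le> T \<Longrightarrow> w s t < h \<Longrightarrow>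
      norm (dev Z s t) \<le> (DJ + DV * NV) * w s t powr (2 * \<beta>)"
    and "\<And>t. 0 \<le> t \<Longrightarrow> t \<le> T \<Longrightarrow>
      (partition_sum (\<lambda>u v. E (Z u + \<Phi> Z u) u v) \<longlongrightarrow> Z t - \<xi>) (mesh_to_0 0 t)"
proof -
  obtain d where d: "0 < d" "\<And>s t. 0 \<le> s \<Longrightarrow> s \<le> t \<Longrightarrow> t \<le> T \<Longrightarrow> t - s < d \<Longrightarrow> w s t < h"
    using control_small[OF control h_pos] by blast
  \<comment> \<open>From n0 steps on the mesh is below d, so that every step has control at most h,
    as the estimates for a single scheme demand.\<close>
  obtain n0 :: nat where n0: "T / d < real n0" using reals_Archimedean2 by blast
  moreover have "0 < T / d" using T0 d by simp
  ultimately have n0pos: "0 < n0" by (metis less_trans of_nat_0_less_iff)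
  define Zs where "Zs m = eul (n0 + m) (n0 + m)" for m
  have pos: "0 < n0 + m" for m using n0pos by simp
  have ep: "euler_path (n0 + m) (Zs m)" for m
    unfolding Zs_def by (rule euler_path_eul[OF pos])
  have fine: "w (grid (n0 + m) i) (grid (n0 + m) (Suc i)) \<le> h" if "i < n0 + m" for m i
  proof -
    have "T / real (n0 + m) \<le> T / real n0" using n0pos T0 by (intro divide_left_mono) auto
    also have "\<dots> < d" using n0 n0pos d T0 by (simp add: field_simps)
    finally have "grid (n0 + m) (Suc i) - grid (n0 + m) i < d" by (simp add: grid_step)
    then have "w (grid (n0 + m) i) (grid (n0 + m) (Suc i)) < h"
      using that by (intro d(2) grid_nonneg grid_mono grid_le_T[OF pos]) auto
    then show ?thesis by simp
  qed
  have Zs_cpath: "Zs m \<in> cpath T" and Zs_0: "Zs m 0 = \<xi>" for m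
    using ep unfolding euler_path_def by auto
  have inc: "norm (Zs m t - Zs m s) \<le> A_glob * w s t powr \<beta>" if "0 \<le> s" "s \<le> t" "t \<le> T" for m s t
    unfolding A_glob_def using increment_bound[OF pos ep fine that] by simp
  obtain g k where g: "continuous_on {0..T} g" and k: "strict_mono (k :: nat \<Rightarrow> nat)"
    and unif: "\<And>e. 0 < e \<Longrightarrow> \<exists>N. \<forall>n x. N \<le> n \<and> x \<in> {0..T} \<longrightarrow> norm (Zs (k n) x - g x) < e"
  proof (rule Arzela_Ascoli[of "{0..T}" Zs "norm \<xi> + A_glob * w 0 T powr \<beta>"])
    fix m x assume x: "x \<in> {0..T}"
    have "norm (Zs m x - Zs m 0) \<le> A_glob * w 0 x powr \<beta>" using x by (intro inc) auto
    also have "\<dots> \<le> A_glob * w 0 T powr \<beta>"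
      using x A_glob_nonneg \<beta>_pos by (intro mult_left_mono w_powr_mono) auto
    finally show "norm (Zs m x) \<le> norm \<xi> + A_glob * w 0 T powr \<beta>"
      using norm_triangle_sub[of "Zs m x" \<xi>] by (simp add: Zs_0)
  next
    fix x e :: real assume x: "x \<in> {0..T}" and e: "0 < e"
    obtain d where d: "0 < d" "\<And>s t. 0 \<le> s \<Longrightarrow> s \<le> t \<Longrightarrow> t \<le> T \<Longrightarrow> t - s < d \<Longrightarrow> A_glob * w s t powr \<beta> < e"
      using holder_modulus[OF A_glob_nonneg e] by blast
    have *: "norm (Zs m t - Zs m s) < e" if "0 \<le> s" "s \<le> t" "t \<le> T" "t - s < d" for s t m
      using d(2)[OF that] inc[OF that(1-3), of m] by simp
    have "norm (Zs m x - Zs m y) < e" if "y \<in> {0..T}" "norm (x - y) < d" for m y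
      using *[of x y m] *[of y x m] that x by (cases "x \<le> y") (auto simp: norm_minus_commute)
    then show "\<exists>d>0. \<forall>n y. y \<in> {0..T} \<and> norm (x - y) < d \<longrightarrow> norm (Zs n x - Zs n y) < e"
      using d(1) by blast
  qed auto
  define Z where "Z = restrict g {0..T}"
  have Z: "Z \<in> cpath T" unfolding Z_def by (rule cpathI[OF g])
  define Zm where "Zm m = Zs (k m)" for m
  define nn where "nn m = n0 + k m" for m
  have nn: "0 < nn m" for m unfolding nn_def by (rule pos)
  have epm: "euler_path (nn m) (Zm m)" for m unfolding nn_def Zm_def by (rule ep)
  have finem: "w (grid (nn m) i) (grid (nn m) (Suc i)) \<le> h" if "i < nn m" for m i
    using that unfolding nn_def by (rule fine)
  have Zm_cpath: "Zm m \<in> cpath T" for m unfolding Zm_def by (rule Zs_cpath)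
  have unifZ: "\<exists>N. \<forall>m\<ge>N. \<forall>x\<in>{0..T}. norm (Zm m x - Z x) < e" if "0 < e" for e
    using unif[OF that] unfolding Zm_def Z_def by (metis restrict_apply')
  have unif\<Phi>: "\<exists>N. \<forall>m\<ge>N. \<forall>x\<in>{0..T}. norm (\<Phi> (Zm m) x - \<Phi> Z x) < e" if e: "0 < e" for e
  proof -
    have "0 < e / (2 * \<rho>')" using e \<rho>' by simp
    then obtain N where N: "\<forall>m\<ge>N. \<forall>x\<in>{0..T}. norm (Zm m x - Z x) < e / (2 * \<rho>')"
      using unifZ by blast
    have "norm (\<Phi> (Zm m) x - \<Phi> Z x) < e" if "N \<le> m" "x \<in> {0..T}" for m x
    proof -
      have "norm (\<Phi> (Zm m) x - \<Phi> Z x) \<le> \<rho>' * (e / (2 * \<rho>'))"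
        using N that by (intro \<Phi>_lipschitz Zm_cpath Z) (auto intro: less_imp_le)
      also have "\<dots> = e / 2" using \<rho>' by simp
      finally show ?thesis using e by simp
    qed
    then show ?thesis by blast
  qed
  have Zm_tendsto: "(\<lambda>m. Zm m (u m)) \<longlonglongrightarrow> Z u0" and \<Phi>_tendsto: "(\<lambda>m. \<Phi> (Zm m) (u m)) \<longlonglongrightarrow> \<Phi> Z u0"
    if "u \<longlonglongrightarrow> u0" "\<And>m. u m \<in> {0..T}" "u0 \<in> {0..T}" for u u0
    using tendsto_uniform_compose[OF unifZ cpath_continuous[OF Z] that]
      tendsto_uniform_compose[OF unif\<Phi> cpath_continuous[OF \<Phi>_cpath[OF Z]] that] by auto
  \<comment> \<open>Times rounded down to the grid of the m-th scheme: deviations are controlled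
    only between grid points.\<close>
  define \<phi> where "\<phi> m s = grid (nn m) (idx (nn m) s)" for m s
  have \<phi>: "0 \<le> \<phi> m s" "\<phi> m s \<le> s" "s - T / real (nn m) \<le> \<phi> m s" "idx (nn m) s \<le> nn m" if "0 \<le> s" "s \<le> T" for m s
    using idx[OF nn[of m] that] grid_nonneg by (auto simp: \<phi>_def grid_step)
  have \<phi>_mono: "\<phi> m s \<le> \<phi> m t" if "s \<le> t" for m s t
    unfolding \<phi>_def using that by (intro grid_mono idx_mono)
  have \<phi>_tendsto: "(\<lambda>m. \<phi> m s) \<longlonglongrightarrow> s" if s: "0 \<le> s" "s \<le> T" for s
  proof (rule tendsto_sandwich[of "\<lambda>m. s - T / real (nn m)" _ _ "\<lambda>m. s"])
    have "strict_mono nn" using k by (simp add: nn_def strict_mono_def)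
    from LIMSEQ_subseq_LIMSEQ[OF lim_const_over_n[of T] this]
    have "(\<lambda>m. T / real (nn m)) \<longlonglongrightarrow> 0" by (simp add: o_def)
    then have "(\<lambda>m. s - T / real (nn m)) \<longlonglongrightarrow> s - 0" by (intro tendsto_intros)
    then show "(\<lambda>m. s - T / real (nn m)) \<longlonglongrightarrow> s" by simp
  qed (use \<phi>[OF s] in auto)
  have w\<phi>: "(\<lambda>m. w (\<phi> m s) (\<phi> m t)) \<longlonglongrightarrow> w s t" if "0 \<le> s" "s \<le> t" "t \<le> T" for s t
    using that \<phi>(1)[of s] \<phi>(2)[of t]
    by (intro control_tendsto[OF control] \<phi>_tendsto \<phi>_mono) (auto intro: order_trans)
  have dev_tendsto: "(\<lambda>m. dev (Zm m) (\<phi> m s) (\<phi> m t)) \<longlonglongrightarrow> dev Z s t" if st: "0 \<le> s" "s \<le> t" "t \<le> T" for s t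
  proof -
    have in_T: "\<phi> m s \<in> {0..T}" "\<phi> m t \<in> {0..T}" for m
      using \<phi>[of s m] \<phi>[of t m] st by auto
    have y: "(\<lambda>m. Zm m (\<phi> m s) + \<Phi> (Zm m) (\<phi> m s)) \<longlonglongrightarrow> Z s + \<Phi> Z s"
      using st in_T by (intro tendsto_add Zm_tendsto \<Phi>_tendsto \<phi>_tendsto) auto
    have xx: "(\<lambda>m. XX (\<phi> m s) (\<phi> m t)) \<longlonglongrightarrow> XX s t"
      using st \<phi>[of s] \<phi>[of t] by (intro XX_tendsto \<phi>_tendsto \<phi>_mono) auto
    have x: "(\<lambda>m. X (\<phi> m t) - X (\<phi> m s)) \<longlonglongrightarrow> X t - X s"
      using st in_T
      by (intro tendsto_diff continuous_on_tendsto_compose[OF X_continuous] \<phi>_tendsto always_eventually) auto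
    have s: "(\<lambda>m. \<sigma> (Zm m (\<phi> m s) + \<Phi> (Zm m) (\<phi> m s))) \<longlonglongrightarrow> \<sigma> (Z s + \<Phi> Z s)"
      by (intro continuous_on_tendsto_compose[OF continuous_on_\<sigma>[of UNIV] y]) auto
    have "(\<lambda>m. E (Zm m (\<phi> m s) + \<Phi> (Zm m) (\<phi> m s)) (\<phi> m s) (\<phi> m t)) \<longlonglongrightarrow> E (Z s + \<Phi> Z s) s t"
      unfolding germ_def by (rule tendsto_add[OF blinfun.tendsto[OF s x] A_tendsto[OF y xx]])
    then show ?thesis
      unfolding dev_def using st in_T by (intro tendsto_diff[of _ "Z t - Z s"] tendsto_diff[of _ "Z t"] Zm_tendsto \<phi>_tendsto) auto
  qed
  have dev_bound: "norm (dev (Zm m) (\<phi> m s) (\<phi> m t)) \<le> DJ * w (\<phi> m s) (\<phi> m t) powr p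
        + DV * V (Zm m) (\<phi> m s) (\<phi> m t) * w (\<phi> m s) (\<phi> m t) powr \<beta>"
    and V_bound: "V (Zm m) (\<phi> m s) (\<phi> m t) \<le> NV * w (\<phi> m s) (\<phi> m t) powr \<beta>"
    if st: "0 \<le> s" "s \<le> t" "t \<le> T" and small: "w (\<phi> m s) (\<phi> m t) \<le> h" for m s t
  proof -
    have "idx (nn m) s \<le> idx (nn m) t" "idx (nn m) t \<le> nn m"
      using st \<phi>(4)[of t m] by (auto intro: idx_mono)
    note est = grid_estimates[OF nn epm finem this, folded \<phi>_def, OF _ small]
    show "norm (dev (Zm m) (\<phi> m s) (\<phi> m t)) \<le> DJ * w (\<phi> m s) (\<phi> m t) powr p
        + DV * V (Zm m) (\<phi> m s) (\<phi> m t) * w (\<phi> m s) (\<phi> m t) powr \<beta>"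
      using est(1) by (simp add: dev_def)
    show "V (Zm m) (\<phi> m s) (\<phi> m t) \<le> NV * w (\<phi> m s) (\<phi> m t) powr \<beta>"
      using est(3) by simp
  qed
  have incZ: "norm (Z t - Z s) \<le> A_glob * w s t powr \<beta>" if st: "0 \<le> s" "s \<le> t" "t \<le> T" for s t
  proof (rule LIMSEQ_le_const2)
    show "(\<lambda>m. norm (Zm m t - Zm m s)) \<longlonglongrightarrow> norm (Z t - Z s)"
      using st by (intro tendsto_norm tendsto_diff Zm_tendsto) auto
    show "\<exists>N. \<forall>m\<ge>N. norm (Zm m t - Zm m s) \<le> A_glob * w s t powr \<beta>"
      unfolding Zm_def using inc[OF st] by blast
  qed
  have Z0: "Z 0 = \<xi>"
  proof -
    have "(\<lambda>m. Zm m 0) \<longlonglongrightarrow> Z 0" using T0 by (intro Zm_tendsto) auto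
    moreover have "(\<lambda>m. Zm m 0) = (\<lambda>m. \<xi>)" by (simp add: Zm_def Zs_0)
    ultimately show ?thesis using LIMSEQ_unique[OF _ tendsto_const] by metis
  qed
  \<comment> \<open>V is replaced by NV * w^\<beta> before the limit is taken, so its convergence is
    not an issue. The strict inequality w s t < h passes to the rounded times eventually.\<close>
  have devZ: "norm (dev Z s t) \<le> (DJ + DV * NV) * w s t powr (2 * \<beta>)"
    if st: "0 \<le> s" "s \<le> t" "t \<le> T" "w s t < h" for s t
  proof (rule tendsto_le[OF _ _ tendsto_norm[OF dev_tendsto]])
    have w0: "0 \<le> w (\<phi> m s) (\<phi> m t)" for m
      using st \<phi>[of s m] \<phi>[of t m] by (intro w_nonneg \<phi>_mono) auto
    show "(\<lambda>m. (DJ + DV * NV) * w (\<phi> m s) (\<phi> m t) powr (2 * \<beta>)) \<longlonglongrightarrow> (DJ + DV * NV) * w s t powr (2 * \<beta>)"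
      using st w0 \<beta>_pos by (intro tendsto_mult tendsto_const tendsto_powr' w\<phi>) auto
    have "\<forall>\<^sub>F m in sequentially. w (\<phi> m s) (\<phi> m t) < h"
      using order_tendstoD(2)[OF w\<phi> st(4)] st by simp
    then show "\<forall>\<^sub>F m in sequentially. norm (dev (Zm m) (\<phi> m s) (\<phi> m t))
        \<le> (DJ + DV * NV) * w (\<phi> m s) (\<phi> m t) powr (2 * \<beta>)"
    proof eventually_elim
      case (elim m)
      let ?w = "w (\<phi> m s) (\<phi> m t)"
      have "norm (dev (Zm m) (\<phi> m s) (\<phi> m t)) \<le> DJ * ?w powr p + DV * V (Zm m) (\<phi> m s) (\<phi> m t) * ?w powr \<beta>"
        using st elim by (intro dev_bound) auto
      also have "\<dots> \<le> DJ * ?w powr (2 * \<beta>) + DV * (NV * ?w powr \<beta>) * ?w powr \<beta>"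
        using st elim consts_nonneg w0[of m] h_le1 p_ge
        by (intro add_mono mult_left_mono mult_right_mono V_bound powr_mono') auto
      also have "\<dots> = (DJ + DV * NV) * ?w powr (2 * \<beta>)"
        by (simp add: distrib_right powr_add[symmetric])
      finally show ?case .
    qed
  qed (use st in auto)
  have sums: "(partition_sum (\<lambda>u v. E (Z u + \<Phi> Z u) u v) \<longlongrightarrow> Z t - \<xi>) (mesh_to_0 0 t)"
    if t: "0 \<le> t" "t \<le> T" for t
  proof (rule tendstoI)
    fix e :: real assume e: "0 < e"
    \<comment> \<open>One bound for the total variation of the drift in all schemes, from the
      uniform bound on increments. It takes the place of convergence of V.\<close>
    define Vb where "Vb = \<rho> * (A_glob * w 0 T powr \<beta>)"
    have Vb: "V (Zm m) 0 T \<le> Vb" for m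
      unfolding Vb_def Zm_def by (intro V_le_global Zs_cpath inc)
    have Vb0: "0 \<le> Vb" using order_trans[OF V_nonneg Vb] .
    have wT: "0 \<le> w 0 T" using w_nonneg T0 by simp
    \<comment> \<open>r will bound the control of the cells. Both parts of the summed deviation
      vanish with r, because p > 1 and \<beta> > 0.\<close>
    have "((\<lambda>r. DJ * r powr (p - 1) * w 0 T + DV * r powr \<beta> * Vb) \<longlongrightarrow> DJ * 0 * w 0 T + DV * 0 * Vb) (at_right 0)"
      using p_gt1 \<beta>_pos
      by (intro tendsto_add tendsto_mult tendsto_const tendsto_zero_powrI[OF tendsto_ident_at tendsto_const])
        (auto simp: eventually_at_right_less intro: eventually_mono[OF eventually_at_right_less])
    then have "\<forall>\<^sub>F r in at_right 0. DJ * r powr (p - 1) * w 0 T + DV * r powr \<beta> * Vb < e"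
      using e by (intro order_tendstoD(2)[of _ "0::real"]) auto
    moreover have "\<forall>\<^sub>F r in at_right 0. r < h"
      by (rule order_tendstoD(2)[OF tendsto_ident_at h_pos])
    ultimately have "\<forall>\<^sub>F r in at_right 0. 0 < r \<and> r < h \<and> DJ * r powr (p - 1) * w 0 T + DV * r powr \<beta> * Vb < e"
      using eventually_at_right_less[of "0::real"] by eventually_elim auto
    then have "\<exists>r. 0 < r \<and> r < h \<and> DJ * r powr (p - 1) * w 0 T + DV * r powr \<beta> * Vb < e"
      by (rule eventually_happens'[OF trivial_limit_at_right_real])
    then obtain r where r: "0 < r" "r < h" "DJ * r powr (p - 1) * w 0 T + DV * r powr \<beta> * Vb < e"
      by blast
    obtain \<delta> where \<delta>: "0 < \<delta>" "\<And>s t. 0 \<le> s \<Longrightarrow> s \<le> t \<Longrightarrow> t \<le> T \<Longrightarrow> t - s < \<delta> \<Longrightarrow> w s t < r"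
      using control_small[OF control r(1)] by blast
    have "dist (partition_sum (\<lambda>u v. E (Z u + \<Phi> Z u) u v) q) (Z t - \<xi>) < e"
      if q: "q \<in> partitions 0 t" "mesh_less \<delta> q" for q
    proof -
      let ?l = "length q - 1"
      have cell: "0 \<le> q ! i" "q ! i \<le> q ! Suc i" "q ! Suc i \<le> T" "w (q ! i) (q ! Suc i) < r" if "i < ?l" for i
        using partition_cell[OF q(1) that] q(2) t \<delta>(2)[of "q ! i" "q ! Suc i"] by auto
      have q_range: "0 \<le> q ! i" "q ! i \<le> T" if "i < length q" for i
        using partitions_props(5)[OF q(1) that] t by auto
      have lq: "0 < length q" using partitions_props(1)[OF q(1)] .
      have lim: "(\<lambda>m. \<Sum>i<?l. dev (Zm m) (\<phi> m (q ! i)) (\<phi> m (q ! Suc i))) \<longlonglongrightarrow> (\<Sum>i<?l. dev Z (q ! i) (q ! Suc i))"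
        using cell by (intro tendsto_sum dev_tendsto) auto
      have "\<forall>\<^sub>F m in sequentially. \<forall>i\<in>{..<?l}. w (\<phi> m (q ! i)) (\<phi> m (q ! Suc i)) < r"
        using cell by (intro eventually_ball_finite finite_lessThan ballI order_tendstoD(2)[OF w\<phi>]) auto
      then have "\<forall>\<^sub>F m in sequentially. norm (\<Sum>i<?l. dev (Zm m) (\<phi> m (q ! i)) (\<phi> m (q ! Suc i)))
          \<le> DJ * r powr (p - 1) * w 0 T + DV * r powr \<beta> * Vb"
      proof eventually_elim
        case (elim m)
        let ?a = "\<lambda>i. \<phi> m (q ! i)"
        have a_mono: "?a i \<le> ?a (Suc i)" if "i < ?l" for i using cell(2)[OF that] by (rule \<phi>_mono)
        have a_range: "0 \<le> ?a i" "?a i \<le> T" if "i \<le> ?l" for i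
        proof -
          have "i < length q" using that lq by linarith
          then show "0 \<le> ?a i" "?a i \<le> T" using \<phi>[of "q ! i" m] q_range[of i] by auto
        qed
        have "norm (\<Sum>i<?l. dev (Zm m) (?a i) (?a (Suc i)))
            \<le> (\<Sum>i<?l. DJ * r powr (p - 1) * w (?a i) (?a (Suc i)) + DV * r powr \<beta> * V (Zm m) (?a i) (?a (Suc i)))"
        proof (rule sum_norm_le)
          fix i assume i: "i \<in> {..<?l}"
          let ?w = "w (?a i) (?a (Suc i))"
          have w0: "0 \<le> ?w" using i a_mono a_range by (intro w_nonneg) auto
          have wr: "?w < r" using elim i by blast
          have "norm (dev (Zm m) (?a i) (?a (Suc i))) \<le> DJ * ?w powr p + DV * V (Zm m) (?a i) (?a (Suc i)) * ?w powr \<beta>"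
            using i cell wr r by (intro dev_bound) auto
          also have "?w powr p = ?w powr (p - 1) * ?w"
            using w0 powr_add[of ?w "p - 1" 1] by simp
          also have "DJ * (?w powr (p - 1) * ?w) + DV * V (Zm m) (?a i) (?a (Suc i)) * ?w powr \<beta>
              \<le> DJ * (r powr (p - 1) * ?w) + DV * V (Zm m) (?a i) (?a (Suc i)) * r powr \<beta>"
            using wr w0 p_gt1 \<beta>_pos consts_nonneg V_nonneg
            by (intro add_mono mult_left_mono mult_right_mono powr_mono2) auto
          finally show "norm (dev (Zm m) (?a i) (?a (Suc i))) \<le> DJ * r powr (p - 1) * w (?a i) (?a (Suc i))
              + DV * r powr \<beta> * V (Zm m) (?a i) (?a (Suc i))"
            by (simp add: mult_ac)
        qed
        also have "\<dots> = DJ * r powr (p - 1) * (\<Sum>i<?l. w (?a i) (?a (Suc i)))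
            + DV * r powr \<beta> * (\<Sum>i<?l. V (Zm m) (?a i) (?a (Suc i)))"
          by (simp add: sum.distrib sum_distrib_left)
        also have "\<dots> \<le> DJ * r powr (p - 1) * w 0 T + DV * r powr \<beta> * Vb"
        proof (intro add_mono mult_left_mono)
          have a0: "?a 0 \<le> ?a ?l"
            using superadditive_sum_le[of 0 T w ?l ?a] w_superadd w_nonneg a_mono a_range[of 0] a_range[of ?l]
            by auto
          have "(\<Sum>i<?l. w (?a i) (?a (Suc i))) \<le> w (?a 0) (?a ?l)"
            using superadditive_sum_le[of 0 T w ?l ?a] w_superadd w_nonneg a_mono a_range[of 0] a_range[of ?l]
            by auto
          also have "\<dots> \<le> w 0 T" using a0 a_range[of 0] a_range[of ?l] by (intro w_mono) auto
          finally show "(\<Sum>i<?l. w (?a i) (?a (Suc i))) \<le> w 0 T" .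
          have "(\<Sum>i<?l. V (Zm m) (?a i) (?a (Suc i))) \<le> V (Zm m) (?a 0) (?a ?l)"
            using superadditive_sum_le[of 0 T "V (Zm m)" ?l ?a] V_superadd[OF Zm_cpath] V_nonneg a_mono
              a_range[of 0] a_range[of ?l] by auto
          also have "\<dots> \<le> V (Zm m) 0 T"
            using V_superadd[OF Zm_cpath, of 0 "?a 0" T m] V_superadd[OF Zm_cpath, of "?a 0" "?a ?l" T m]
              V_nonneg[of "Zm m" 0 "?a 0"] V_nonneg[of "Zm m" "?a ?l" T] a0 a_range[of 0] a_range[of ?l] by auto
          finally show "(\<Sum>i<?l. V (Zm m) (?a i) (?a (Suc i))) \<le> Vb" using Vb[of m] by simp
        qed (use consts_nonneg in auto)
        finally show ?case .
      qed
      then have "norm (\<Sum>i<?l. dev Z (q ! i) (q ! Suc i)) \<le> DJ * r powr (p - 1) * w 0 T + DV * r powr \<beta> * Vb"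
        by (rule tendsto_upperbound[OF tendsto_norm[OF lim]]) simp
      also have "(\<Sum>i<?l. dev Z (q ! i) (q ! Suc i)) = Z t - \<xi> - partition_sum (\<lambda>u v. E (Z u + \<Phi> Z u) u v) q"
        using partition_sum_increment[OF q(1), of Z]
        by (simp add: partition_sum_def dev_def sum_subtractf Z0)
      finally show ?thesis using r(3) by (simp add: dist_norm norm_minus_commute)
    qed
    then show "\<forall>\<^sub>F q in mesh_to_0 0 t. dist (partition_sum (\<lambda>u v. E (Z u + \<Phi> Z u) u v) q) (Z t - \<xi>) < e"
      unfolding eventually_mesh_to_0 using \<delta>(1) by blast
  qed
  show thesis by (rule that[OF Z incZ devZ sums])
qed

end

section \<open>Solutions driven by rough paths\<close>

context path_dependent_euler
begin

text \<open>The Young terms of the germ sum to zero in the limit: they are at most \<open>V(u,v) w(u,v)\<^sup>\<beta>\<close>.\<close>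

lemma has_rough_integral_germ:
  assumes Z: "Z \<in> cpath T" and Z': "\<And>t. 0 \<le> t \<Longrightarrow> t \<le> T \<Longrightarrow> Z' t = \<sigma> (Z t + \<Phi> Z t)"
    and t: "0 \<le> t" "t \<le> T"
    and sums: "(partition_sum (\<lambda>u v. E (Z u + \<Phi> Z u) u v) \<longlongrightarrow> I) (mesh_to_0 0 t)"
  shows "has_rough_integral \<sigma> X XX Z Z' (\<Phi> Z) 0 t I"
proof -
  let ?Y = "\<lambda>u. Z u + \<Phi> Z u"
  let ?y = "\<lambda>u v. tensor_apply (D (?Y u)) (young_integral (\<Phi> Z) X u v)"
  define c where "c = real CARD('n) * real CARD('d) * M"
  have c0: "0 \<le> c" using M1 by (simp add: c_def)
  have V0: "0 \<le> V Z 0 T" by (rule V_nonneg)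
  have young: "norm (?y u v) \<le> c * (V Z u v * w u v powr \<beta>)" if uv: "0 \<le> u" "u \<le> v" "v \<le> T" for u v
  proof -
    interpret bv_path "\<Phi> Z" "V Z" u v
      using uv cpath_continuous[OF \<Phi>_cpath[OF Z]] V_drift[OF Z] V_superadd[OF Z]
      by unfold_locales (auto elim: continuous_on_subset)
    have "norm (young_integral (\<Phi> Z) X u v) \<le> V Z u v * w u v powr \<beta>"
    proof (rule young_integral_bound)
      show "continuous_on {u..v} X" using uv by (auto intro: continuous_on_subset[OF X_continuous])
      fix r assume "u \<le> r" "r \<le> v"
      then show "norm (X v - X r) \<le> w u v powr \<beta>"
        using uv \<beta>_pos by (intro order.trans[OF X_bound w_powr_mono]) auto
    qed
    then have "c * norm (young_integral (\<Phi> Z) X u v) \<le> c * (V Z u v * w u v powr \<beta>)"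
      using c0 by (intro mult_left_mono)
    moreover have "norm (?y u v) \<le> c * norm (young_integral (\<Phi> Z) X u v)"
      unfolding c_def using norm_D_apply[of "?Y u"] by (intro norm_tensor_apply_le) (metis mult.right_neutral norm_axis_1)
    ultimately show ?thesis by linarith
  qed
  have "(partition_sum ?y \<longlongrightarrow> 0) (mesh_to_0 0 t)"
  proof (rule tendstoI)
    fix e :: real assume e: "0 < e"
    have cV: "0 \<le> c * V Z 0 T" using c0 V0 by simp
    \<comment> \<open>The values of V on the cells sum to at most V Z 0 T, so the Young terms of a
      fine partition add up to at most c * V Z 0 T * r. The added 1 keeps the quotient
      \<open>r\<close> defined when this factor is 0.\<close>
    obtain d where d: "0 < d" "\<And>s t. 0 \<le> s \<Longrightarrow> s \<le> t \<Longrightarrow> t \<le> T \<Longrightarrow> t - s < d \<Longrightarrow> (c * V Z 0 T + 1) * w s t powr \<beta> < e"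
      using holder_modulus[of "c * V Z 0 T + 1" e] cV e by auto
    define r where "r = e / (c * V Z 0 T + 1)"
    have r: "0 < r" "(c * V Z 0 T) * r < e" using e cV by (auto simp: r_def field_simps)
    have small: "w u v powr \<beta> \<le> r" if "0 \<le> u" "u \<le> v" "v \<le> T" "v - u < d" for u v
      using d(2)[OF that] cV by (simp add: r_def field_simps)
    have "dist (partition_sum ?y q) 0 < e" if q: "q \<in> partitions 0 t" "mesh_less d q" for q
    proof -
      let ?l = "length q - 1"
      have "norm (partition_sum ?y q) \<le> (\<Sum>i<?l. c * r * V Z (q ! i) (q ! Suc i))"
        unfolding partition_sum_def
      proof (rule sum_norm_le)
        fix i assume "i \<in> {..<?l}"
        then have i: "0 \<le> q ! i" "q ! i \<le> q ! Suc i" "q ! Suc i \<le> T" "q ! Suc i - q ! i < d"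
          using partition_cell[OF q(1), of i] q(2) t by auto
        have "c * (V Z (q ! i) (q ! Suc i) * w (q ! i) (q ! Suc i) powr \<beta>) \<le> c * (V Z (q ! i) (q ! Suc i) * r)"
          using c0 V_nonneg by (intro mult_left_mono small i) auto
        with young[OF i(1-3)] show "norm (?y (q ! i) (q ! Suc i)) \<le> c * r * V Z (q ! i) (q ! Suc i)"
          by (simp add: mult_ac)
      qed
      also have "\<dots> = c * r * partition_sum (V Z) q" by (simp add: partition_sum_def sum_distrib_left)
      also have "\<dots> \<le> c * r * V Z 0 t"
        using c0 r t V_nonneg V_superadd[OF Z]
        by (intro mult_left_mono partition_sum_superadditive[OF _ _ q(1), of 0 T]) auto
      also have "\<dots> \<le> c * r * V Z 0 T"
        using V_superadd[OF Z, of 0 t T] V_nonneg[of Z t T] t c0 r by (intro mult_left_mono) auto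
      finally show ?thesis using r(2) by (simp add: mult_ac)
    qed
    then show "\<forall>\<^sub>F q in mesh_to_0 0 t. dist (partition_sum ?y q) 0 < e"
      unfolding eventually_mesh_to_0 using d(1) by blast
  qed
  with sums have "((\<lambda>q. partition_sum (\<lambda>u v. E (?Y u) u v) q + partition_sum ?y q) \<longlongrightarrow> I + 0) (mesh_to_0 0 t)"
    by (intro tendsto_add)
  moreover have "\<forall>\<^sub>F q in mesh_to_0 0 t. partition_sum (\<lambda>u v. E (?Y u) u v) q + partition_sum ?y q
      = partition_sum (rough_germ \<sigma> X XX Z Z' (\<Phi> Z)) q"
    unfolding eventually_mesh_to_0
  proof (intro exI[of _ 1] conjI ballI impI)
    fix q assume q: "q \<in> partitions 0 t"
    have "E (?Y (q ! i)) (q ! i) (q ! Suc i) + ?y (q ! i) (q ! Suc i)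
        = rough_germ \<sigma> X XX Z Z' (\<Phi> Z) (q ! i) (q ! Suc i)" if "i < length q - 1" for i
      using partition_cell[OF q that] t Z'[of "q ! i"]
      by (simp add: rough_germ_def germ_def A_def Let_def)
    then show "partition_sum (\<lambda>u v. E (?Y u) u v) q + partition_sum ?y q
        = partition_sum (rough_germ \<sigma> X XX Z Z' (\<Phi> Z)) q"
      by (simp add: partition_sum_def sum.distrib[symmetric])
  qed simp
  ultimately show ?thesis
    unfolding has_rough_integral_def by (simp add: tendsto_cong)
qed

text \<open>Below the threshold h the remainder is the deviation plus the second level of the germ.
  Above it w^\<beta> \<ge> \<eta>, so the first-order bound (A_glob + M) * w^\<beta> becomes one of
  second order at the cost of 1 / \<eta>.\<close>

definition R_const :: real where "R_const = DJ + DV * NV + c2 + (A_glob + M) / \<eta>"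

lemma solution_exists:
  obtains Z Z' where "Z \<in> cpath T" "Z' \<in> cpath T"
    "\<And>t. 0 \<le> t \<Longrightarrow> t \<le> T \<Longrightarrow> Z' t = \<sigma> (Z t + \<Phi> Z t)"
    "\<And>t. 0 \<le> t \<Longrightarrow> t \<le> T \<Longrightarrow> has_rough_integral \<sigma> X XX Z Z' (\<Phi> Z) 0 t (Z t - \<xi>)"
    "\<And>s t. 0 \<le> s \<Longrightarrow> s \<le> t \<Longrightarrow> t \<le> T \<Longrightarrow> norm (Z t - Z s) \<le> A_glob * w s t powr \<beta>"
    "\<And>s t. 0 \<le> s \<Longrightarrow> s \<le> t \<Longrightarrow> t \<le> T \<Longrightarrow> norm (Z' t - Z' s) \<le> M * (1 + \<rho>) * A_glob * w s t powr \<beta>"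
    "\<And>s t. 0 \<le> s \<Longrightarrow> s \<le> t \<Longrightarrow> t \<le> T \<Longrightarrow> total_variation (\<Phi> Z) s t \<le> ennreal (\<rho> * A_glob * w s t powr \<beta>)"
    "\<And>s t. 0 \<le> s \<Longrightarrow> s \<le> t \<Longrightarrow> t \<le> T \<Longrightarrow> norm (remainder X Z Z' s t) \<le> R_const * w s t powr (2 * \<beta>)"
proof -
  obtain Z where Z: "Z \<in> cpath T"
    and inc: "\<And>s t. 0 \<le> s \<Longrightarrow> s \<le> t \<Longrightarrow> t \<le> T \<Longrightarrow> norm (Z t - Z s) \<le> A_glob * w s t powr \<beta>"
    and dev: "\<And>s t. 0 \<le> s \<Longrightarrow> s \<le> t \<Longrightarrow> t \<le> T \<Longrightarrow> w s t < h \<Longrightarrow>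
      norm (dev Z s t) \<le> (DJ + DV * NV) * w s t powr (2 * \<beta>)"
    and sums: "\<And>t. 0 \<le> t \<Longrightarrow> t \<le> T \<Longrightarrow>
      (partition_sum (\<lambda>u v. E (Z u + \<Phi> Z u) u v) \<longlongrightarrow> Z t - \<xi>) (mesh_to_0 0 t)"
    using euler_limit by blast
  define Z' where "Z' = (\<lambda>t\<in>{0..T}. \<sigma> (Z t + \<Phi> Z t))"
  have Z'_eq: "Z' t = \<sigma> (Z t + \<Phi> Z t)" if "0 \<le> t" "t \<le> T" for t
    using that by (simp add: Z'_def)
  have Z': "Z' \<in> cpath T"
    unfolding Z'_def using cpath_continuous[OF Z] cpath_continuous[OF \<Phi>_cpath[OF Z]]
    by (intro cpathI continuous_on_compose2[OF continuous_on_\<sigma>[of UNIV]] continuous_on_add) auto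
  have osc: "norm (Z v - Z u) \<le> A_glob * w s t powr \<beta>" if "0 \<le> s" "s \<le> u" "u \<le> v" "v \<le> t" "t \<le> T" for s t u v
    using that A_glob_nonneg \<beta>_pos by (intro order.trans[OF inc] mult_left_mono w_powr_mono) auto
  have TV: "total_variation (\<Phi> Z) s t \<le> ennreal (\<rho> * A_glob * w s t powr \<beta>)"
    if st: "0 \<le> s" "s \<le> t" "t \<le> T" for s t
    using total_variation_\<Phi>[OF Z st, of "A_glob * w s t powr \<beta>"] osc[of s _ _ t] st by (simp add: mult.assoc)
  have Z'_inc: "norm (Z' t - Z' s) \<le> M * (1 + \<rho>) * A_glob * w s t powr \<beta>"
    if st: "0 \<le> s" "s \<le> t" "t \<le> T" for s t
  proof -
    have "norm (\<Phi> Z t - \<Phi> Z s) \<le> \<rho> * (A_glob * w s t powr \<beta>)"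
      using V_drift[OF Z st] V_le_osc[OF Z st, of "A_glob * w s t powr \<beta>"] osc[of s _ _ t] st by force
    then have "norm ((Z t + \<Phi> Z t) - (Z s + \<Phi> Z s)) \<le> (1 + \<rho>) * A_glob * w s t powr \<beta>"
      using inc[OF st] norm_triangle_ineq[of "Z t - Z s" "\<Phi> Z t - \<Phi> Z s"] by (simp add: algebra_simps)
    then have "M * norm ((Z t + \<Phi> Z t) - (Z s + \<Phi> Z s)) \<le> M * ((1 + \<rho>) * A_glob * w s t powr \<beta>)"
      using M1 by (intro mult_left_mono) auto
    moreover have "norm (Z' t - Z' s) \<le> M * norm ((Z t + \<Phi> Z t) - (Z s + \<Phi> Z s))"
      using lip[of "Z t + \<Phi> Z t" "Z s + \<Phi> Z s"] st by (simp add: Z'_eq)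
    ultimately show ?thesis by (simp add: mult.assoc)
  qed
  have R: "norm (remainder X Z Z' s t) \<le> R_const * w s t powr (2 * \<beta>)"
    if st: "0 \<le> s" "s \<le> t" "t \<le> T" for s t
  proof (cases "w s t < h")
    case True
    have "remainder X Z Z' s t = dev Z s t
        + (E (Z s + \<Phi> Z s) s t - blinfun_apply (\<sigma> (Z s + \<Phi> Z s)) (X t - X s))"
      using st by (simp add: remainder_def dev_def Z'_eq)
    then have "norm (remainder X Z Z' s t) \<le> (DJ + DV * NV + c2) * w s t powr (2 * \<beta>)"
      using norm_triangle_ineq[of "dev Z s t" "E (Z s + \<Phi> Z s) s t - blinfun_apply (\<sigma> (Z s + \<Phi> Z s)) (X t - X s)"]
        dev[OF st True] germ_first_order[OF st, of "Z s + \<Phi> Z s"] by (simp add: distrib_right)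
    also have "\<dots> \<le> R_const * w s t powr (2 * \<beta>)"
      using A_glob_nonneg M1 \<eta>_pos by (intro mult_right_mono) (auto simp: R_const_def)
    finally show ?thesis .
  next
    case False
    have "\<eta> \<le> w s t powr \<beta>"
      unfolding h_powr[symmetric] using False h_pos \<beta>_pos by (intro powr_mono2) auto
    then have "(A_glob + M) * w s t powr \<beta> * \<eta> \<le> (A_glob + M) * w s t powr \<beta> * w s t powr \<beta>"
      using A_glob_nonneg M1 by (intro mult_left_mono) auto
    then have big: "(A_glob + M) * w s t powr \<beta> \<le> (A_glob + M) / \<eta> * w s t powr (2 * \<beta>)"
      using \<eta>_pos by (simp add: pos_le_divide_eq powr_add[symmetric] mult.assoc)
    have "norm (blinfun_apply (Z' s) (X t - X s)) \<le> M * w s t powr \<beta>"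
      using st M1 by (simp add: Z'_eq) (intro order.trans[OF norm_apply] mult_left_mono X_bound, auto)
    then have "norm (remainder X Z Z' s t) \<le> (A_glob + M) * w s t powr \<beta>"
      unfolding remainder_def
      using inc[OF st] norm_triangle_ineq4[of "Z t - Z s" "blinfun_apply (Z' s) (X t - X s)"] by (simp add: distrib_right)
    also note big
    also have "(A_glob + M) / \<eta> * w s t powr (2 * \<beta>) \<le> R_const * w s t powr (2 * \<beta>)"
      using consts_nonneg c2_ge1 by (intro mult_right_mono) (auto simp: R_const_def)
    finally show ?thesis .
  qed
  show thesis
    by (rule that[OF Z Z' Z'_eq has_rough_integral_germ[OF Z Z'_eq _ _ sums] inc Z'_inc TV R])
qed

end

section \<open>The correspondence between the two equations\<close>

locale implicit_drift =
  fixes T :: real and C :: "(real \<Rightarrow> real^'n) \<Rightarrow> (real \<Rightarrow> real^'n)"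
  assumes C_cpath: "x \<in> cpath T \<Longrightarrow> C x \<in> cpath T"
    and solvable: "x \<in> cpath T \<Longrightarrow> \<exists>!y. implicit_solution T C x y"
begin

text \<open>An equality of functions and not only on [0,T], since both sides are
  \<open>undefined\<close> elsewhere. It allows rewriting inside the rough integral, which takes the
  whole drift path as an argument.\<close>

lemma tilde_implicit:
  assumes x: "x \<in> cpath T" and y: "implicit_solution T C x y"
  shows "tilde T C x = C y"
proof
  have "(THE y. implicit_solution T C x y) = y"
    by (rule the_equality) (use solvable[OF x] y in blast)+
  moreover have "C y t = undefined" if "t \<notin> {0..T}" for t
    using C_cpath[of y] y that unfolding implicit_solution_def cpath_iff by (metis extensional_arb)
  ultimately show "tilde T C x t = C y t" for t
    using y by (cases "t \<in> {0..T}") (auto simp: tilde_def implicit_solution_def)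
qed

lemma tilde_cpath: "x \<in> cpath T \<Longrightarrow> tilde T C x \<in> cpath T"
  using solvable[of x] tilde_implicit[of x] C_cpath unfolding implicit_solution_def by (metis (no_types, lifting))

lemma defined_by_E2:
  assumes "E1_defined_by T \<omega> \<beta> X XX \<sigma> \<xi> C Y P"
  shows "P \<in> E2_solutions T \<omega> \<beta> X XX \<sigma> \<xi> C" and "Z_to_Y T C P = Y"
proof -
  obtain Z Z' where P: "P = (Z, Z')" by (cases P)
  have Y: "Y \<in> cpath T" and Z: "(Z, Z') \<in> controlled_paths T \<omega> \<beta> X"
    and eq: "\<And>t. t \<in> {0..T} \<Longrightarrow> Y t = Z t + C Y t \<and> Z' t = \<sigma> (Y t) \<and>
        has_rough_integral \<sigma> X XX Z Z' (C Y) 0 t (Z t - \<xi>)"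
    using assms unfolding E1_defined_by_def P by auto
  have "Z \<in> cpath T" using Z by (simp only: controlled_paths_def mem_Collect_eq prod.case)
  moreover have "implicit_solution T C Z Y" unfolding implicit_solution_def using Y eq by blast
  ultimately have t: "tilde T C Z = C Y" by (rule tilde_implicit)
  show "P \<in> E2_solutions T \<omega> \<beta> X XX \<sigma> \<xi> C"
    unfolding E2_solutions_def P t mem_Collect_eq prod.case using Z eq by metis
  show "Z_to_Y T C P = Y"
  proof
    fix r
    have "Y \<in> extensional {0..T}" using Y unfolding cpath_iff by blast
    moreover have "r \<in> {0..T} \<Longrightarrow> Y r = Z r + C Y r" using eq by blast
    ultimately show "Z_to_Y T C P r = Y r"
      unfolding Z_to_Y_def P t prod.case by (metis extensional_arb restrict_apply)
  qed
qed

lemma E2_defined_by: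
  assumes "P \<in> E2_solutions T \<omega> \<beta> X XX \<sigma> \<xi> C"
  shows "E1_defined_by T \<omega> \<beta> X XX \<sigma> \<xi> C (Z_to_Y T C P) P"
proof -
  obtain Z Z' where P: "P = (Z, Z')" by (cases P)
  have cZ: "(Z, Z') \<in> controlled_paths T \<omega> \<beta> X"
    and eq: "\<And>t. t \<in> {0..T} \<Longrightarrow> Z' t = \<sigma> (Z t + tilde T C Z t) \<and>
        has_rough_integral \<sigma> X XX Z Z' (tilde T C Z) 0 t (Z t - \<xi>)"
    using assms unfolding E2_solutions_def P by auto
  have Z: "Z \<in> cpath T" using cZ by (simp only: controlled_paths_def mem_Collect_eq prod.case)
  obtain Y where Y: "implicit_solution T C Z Y" using solvable[OF Z] by blast
  have t: "tilde T C Z = C Y" by (rule tilde_implicit[OF Z Y])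
  have "Z_to_Y T C P = Y"
  proof
    fix r
    have "Y \<in> extensional {0..T}" using Y unfolding implicit_solution_def cpath_iff by blast
    moreover have "r \<in> {0..T} \<Longrightarrow> Y r = Z r + C Y r" using Y unfolding implicit_solution_def by blast
    ultimately show "Z_to_Y T C P r = Y r"
      unfolding Z_to_Y_def P t prod.case by (metis extensional_arb restrict_apply)
  qed
  then show ?thesis
    using Y cZ eq unfolding E1_defined_by_def P t prod.case implicit_solution_def by metis
qed

text \<open>On [0,T] the path is recovered as Y - C(Y) and its derivative as \<sigma>(Y); membership
  in \<open>cpath T\<close> fixes the values elsewhere.\<close>

lemma defined_by_unique:
  assumes "E1_defined_by T \<omega> \<beta> X XX \<sigma> \<xi> C Y P" "E1_defined_by T \<omega> \<beta> X XX \<sigma> \<xi> C Y Q"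
  shows "P = Q"
proof -
  obtain Z Z' W W' where PQ: "P = (Z, Z')" "Q = (W, W')" by (cases P, cases Q)
  have cp: "Z \<in> cpath T" "Z' \<in> cpath T" "W \<in> cpath T" "W' \<in> cpath T"
    using assms unfolding E1_defined_by_def PQ prod.case controlled_paths_def mem_Collect_eq by blast+
  have eq: "Y t = Z t + C Y t" "Y t = W t + C Y t" "Z' t = \<sigma> (Y t)" "W' t = \<sigma> (Y t)" if "t \<in> {0..T}" for t
    using assms that unfolding E1_defined_by_def PQ prod.case by blast+
  have "Z t = W t" "Z' t = W' t" if "t \<in> {0..T}" for t
    using eq[OF that] by (metis add_right_cancel)+
  then have "Z = W" "Z' = W'"
    using cp unfolding cpath_iff by (meson extensionalityI)+
  then show ?thesis by (simp add: PQ)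
qed

end

section \<open>The constant of the final estimate\<close>

context rde_constants
begin

text \<open>Dominates \<open>A_glob\<close> once the factor 1 + w 0 T is taken out, and no longer
  depends on the driver.\<close>

definition K_inc :: real where "K_inc = (2 * N0 + N) * (1 + 2 / h)"

definition K_total :: real where
  "K_total = K_inc + M * (1 + \<rho>) * K_inc + \<rho> * K_inc + (DJ + DV * NV + c2 + (K_inc + M) / \<eta>)"

lemma K_inc_nonneg: "0 \<le> K_inc"
  using consts_nonneg h_pos by (simp add: K_inc_def)

lemma K_total_pos: "0 < K_total"
proof -
  have "0 \<le> K_inc + M * (1 + \<rho>) * K_inc + \<rho> * K_inc" "0 \<le> DJ + DV * NV" "0 \<le> (K_inc + M) / \<eta>"
    using K_inc_nonneg M1 \<rho>0 consts_nonneg \<eta>_pos by auto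
  with c2_ge1 show ?thesis unfolding K_total_def by linarith
qed

end

context path_dependent_euler
begin

text \<open>Returning from the rescaled control to \<omega> multiplies the first-order norms by r
  and the norm of the remainder by r^2. Both powers are dominated by r + r^2 + r^3, the modified
  norm of the rough path.\<close>

lemma total_constant_bound:
  assumes r: "0 \<le> r"
  shows "A_glob * r + M * (1 + \<rho>) * A_glob * r + \<rho> * A_glob * r + R_const * r\<^sup>2
    \<le> K_total * (1 + w 0 T) * (r + r\<^sup>2 + r ^ 3)"
proof -
  let ?w = "1 + w 0 T"
  have w1: "1 \<le> ?w" using w_nonneg T0 by simp
  have A: "A_glob \<le> K_inc * ?w"
  proof -
    have "1 + 2 * w 0 T / h \<le> (1 + 2 / h) * ?w" using h_pos w1 by (simp add: distrib_left distrib_right)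
    then have "(2 * N0 + N) * (1 + 2 * w 0 T / h) \<le> (2 * N0 + N) * ((1 + 2 / h) * ?w)"
      using consts_nonneg by (intro mult_left_mono) auto
    then show ?thesis by (simp add: A_glob_def K_inc_def mult.assoc)
  qed
  have one: "a \<le> a * ?w" if "0 \<le> a" for a using w1 that mult_left_mono[of 1 ?w a] by simp
  have R: "R_const \<le> (DJ + DV * NV + c2 + (K_inc + M) / \<eta>) * ?w"
  proof -
    have "DJ + DV * NV + c2 \<le> (DJ + DV * NV + c2) * ?w"
      using consts_nonneg c2_ge1 by (intro one) auto
    moreover have "(A_glob + M) / \<eta> \<le> (K_inc * ?w + M * ?w) / \<eta>"
      using A one[of M] M1 \<eta>_pos by (intro divide_right_mono add_mono) auto
    moreover have "(K_inc * ?w + M * ?w) / \<eta> = (K_inc + M) / \<eta> * ?w" by (simp only: distrib_right[symmetric] times_divide_eq_left)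
    ultimately show ?thesis unfolding R_const_def by (simp only: distrib_right)
  qed
  let ?a = "K_inc + M * (1 + \<rho>) * K_inc + \<rho> * K_inc" and ?b = "DJ + DV * NV + c2 + (K_inc + M) / \<eta>"
  have a0: "0 \<le> ?a" "0 \<le> ?b"
    using K_inc_nonneg M1 \<rho>0 consts_nonneg \<eta>_pos c2_ge1 by auto
  have "A_glob * r + M * (1 + \<rho>) * A_glob * r + \<rho> * A_glob * r = (1 + M * (1 + \<rho>) + \<rho>) * A_glob * r"
    by (simp add: algebra_simps)
  also have "\<dots> \<le> (1 + M * (1 + \<rho>) + \<rho>) * (K_inc * ?w) * r"
    using A M1 \<rho>0 r by (intro mult_right_mono mult_left_mono) auto
  also have "\<dots> = ?a * ?w * r" by (simp add: algebra_simps)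
  also have "\<dots> \<le> ?a * ?w * (r + r\<^sup>2 + r ^ 3)"
    using a0 w1 r by (intro mult_left_mono mult_nonneg_nonneg) auto
  finally have 1: "A_glob * r + M * (1 + \<rho>) * A_glob * r + \<rho> * A_glob * r \<le> ?a * ?w * (r + r\<^sup>2 + r ^ 3)" .
  have "R_const * r\<^sup>2 \<le> ?b * ?w * r\<^sup>2" by (intro mult_right_mono R) simp
  also have "\<dots> \<le> ?b * ?w * (r + r\<^sup>2 + r ^ 3)"
    using a0 w1 r by (intro mult_left_mono mult_nonneg_nonneg) auto
  finally have 2: "R_const * r\<^sup>2 \<le> ?b * ?w * (r + r\<^sup>2 + r ^ 3)" .
  from add_mono[OF 1 2] show ?thesis unfolding K_total_def by (simp only: distrib_right)
qed

end

theorem theorem5p15: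
  fixes \<beta> \<gamma> \<rho>'' :: real
    and \<sigma> :: "real^'n \<Rightarrow> ((real^'d) \<Rightarrow>\<^sub>L (real^'n))"
  assumes "1/3 < \<beta>" and "\<beta> \<le> 1/2" and "\<gamma> > 1/\<beta>"
    and "\<sigma> \<in> Lip_class (\<gamma> - 1)"
    and "\<rho>'' > 0"
  shows "\<exists>K \<kappa>1 \<kappa>2 \<kappa>3 :: real. K > 0 \<and> \<kappa>1 > 0 \<and> \<kappa>2 > 0 \<and> \<kappa>3 > 0 \<and>
    (\<forall>(T::real) (\<omega> :: real \<Rightarrow> real \<Rightarrow> real) (X :: real \<Rightarrow> real^'d) (XX :: real \<Rightarrow> real \<Rightarrow> real^'d^'d)
      (\<xi> :: real^'n) (C :: (real \<Rightarrow> real^'n) \<Rightarrow> (real \<Rightarrow> real^'n)) (\<rho>'::real).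
      T > 0 \<longrightarrow> control T \<omega> \<longrightarrow> rough_path T \<omega> \<beta> X XX \<longrightarrow>
      continuous_map (mtopology_of (path_metric T)) (mtopology_of (path_metric T)) C \<longrightarrow>
      (\<forall>x\<in>cpath T. total_variation (C x) 0 T < \<infinity>) \<longrightarrow>
      adapted T C \<longrightarrow>
      (\<forall>x\<in>cpath T. \<exists>!y. implicit_solution T C x y) \<longrightarrow>
      \<rho>' > 0 \<longrightarrow> Lip_cond T \<rho>' (tilde T C) \<longrightarrow> BV_cond T \<rho>'' (tilde T C) \<longrightarrow>
      (let E1 = E1_solutions T \<omega> \<beta> X XX \<sigma> \<xi> C;
           E2 = E2_solutions T \<omega> \<beta> X XX \<sigma> \<xi> C;
           defby = E1_defined_by T \<omega> \<beta> X XX \<sigma> \<xi> C;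
           N = rough_norm_tilde T \<omega> \<beta> X XX;
           toY = Z_to_Y T C;
           toZ = Y_to_Z T \<omega> \<beta> X XX \<sigma> \<xi> C
       in
        ((\<exists>(Z, Z')\<in>E2.
            holder_norm T \<omega> \<beta> Z + holder_norm T \<omega> \<beta> Z' + variation_holder_norm T \<omega> \<beta> (tilde T C Z)
              + holder_norm2 T \<omega> (2 * \<beta>) (remainder X Z Z')
            \<le> ennreal (K * (1 + (1 + N) powr \<kappa>1 * \<omega> 0 T) powr \<kappa>2 * N powr \<kappa>3)) \<and>
         (\<forall>P\<in>E2. toY P \<in> E1)) \<and>
        ((\<forall>Y P. defby Y P \<longrightarrow> P \<in> E2) \<and>
         (\<forall>Y P Q. defby Y P \<longrightarrow> defby Y Q \<longrightarrow> P = Q)) \<and>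
        ((\<forall>P\<in>E2. toZ (toY P) = P) \<and> (\<forall>Y\<in>E1. toY (toZ Y) = Y) \<and>
         ((\<exists>\<^sub>\<le>\<^sub>1Y. Y \<in> E1) \<longleftrightarrow> (\<exists>\<^sub>\<le>\<^sub>1P. P \<in> E2)))))"
proof -
  have \<beta>0: "0 < \<beta>" using assms(1) by simp
  obtain M H \<theta> where c: "1 \<le> M" "0 \<le> H" "0 < \<theta>" "\<theta> \<le> 1" "1 < (2 + \<theta>) * \<beta>"
    "\<And>x. \<sigma> differentiable (at x)" "\<And>x. norm (\<sigma> x) \<le> M"
    "\<And>x h. norm (frechet_derivative \<sigma> (at x) h) \<le> M * norm h"
    "\<And>x y h. norm (frechet_derivative \<sigma> (at x) h - frechet_derivative \<sigma> (at y) h)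
        \<le> H * norm (x - y) powr \<theta> * norm h"
    by (rule Lip_class_bounds[OF assms(1-4)]) metis
  interpret rde_constants \<sigma> M H \<theta> \<beta> \<rho>''
    using c \<beta>0 assms(5) by unfold_locales auto
  \<comment> \<open>\<kappa>1 = 1/\<beta> is the exponent of the rescaling, with r at most 1 plus
    the modified norm. The estimate is linear in the rescaled control and in the modified norm,
    which gives the value 1 for the other two exponents.\<close>
  show ?thesis
  proof (rule exI[of _ K_total], rule exI[of _ "1 / \<beta>"], rule exI[of _ 1], rule exI[of _ 1],
      intro conjI allI impI, goal_cases)
    case 1
    show ?case by (rule K_total_pos)
  next
    case 2
    show ?case using \<beta>0 by simp
  next
    case (5 T \<omega> X XX \<xi> C \<rho>')
    note hyps = this
    have T0: "0 < T" and om: "control T \<omega>" and X: "rough_path T \<omega> \<beta> X XX" by fact+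
    define \<Phi> where "\<Phi> = tilde T C"
    define r where "r = rough_norm T \<omega> \<beta> X XX"
    define w where "w = (\<lambda>s t. r powr (1 / \<beta>) * \<omega> s t)"
    interpret implicit_drift T C
    proof
      show "C x \<in> cpath T" if "x \<in> cpath T" for x
        using continuous_map_image_subset_topspace[OF hyps(4)] that by (auto simp del: mspace_cfunspace)
      show "\<exists>!y. implicit_solution T C x y" if "x \<in> cpath T" for x
        using hyps(7) that by blast
    qed
    have Xfin: "holder_norm T \<omega> \<beta> X < \<infinity>" "holder_norm2 T \<omega> (2 * \<beta>) XX < \<infinity>"
      using X by (auto simp: rough_path_def)
    define hX where "hX = enn2real (holder_norm T \<omega> \<beta> X)"
    define hXX where "hXX = enn2real (holder_norm2 T \<omega> (2 * \<beta>) XX)"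
    have nn: "0 \<le> hX" "0 \<le> hXX" by (auto simp: hX_def hXX_def)
    have r_eq: "r = hX + sqrt hXX" by (simp add: r_def rough_norm_def hX_def hXX_def)
    have r0: "0 \<le> r" and hXr: "hX \<le> r" using nn by (auto simp: r_eq)
    have "sqrt hXX \<le> r" using nn by (simp add: r_eq)
    then have "(sqrt hXX)\<^sup>2 \<le> r\<^sup>2" using nn by (intro power_mono) auto
    then have hXXr: "hXX \<le> r\<^sup>2" using nn by simp
    have w_powr: "w s t powr \<beta> = r * \<omega> s t powr \<beta>" "w s t powr (2 * \<beta>) = r\<^sup>2 * \<omega> s t powr (2 * \<beta>)"
      if "0 \<le> s" "s \<le> t" "t \<le> T" for s t
      unfolding w_def using powr_scaled_control[OF \<beta>0 r0 control_nonneg[OF om that]] by auto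
    interpret path_dependent_euler \<sigma> M H \<theta> \<beta> \<rho>'' T w X XX \<Phi> \<rho>' \<xi>
    proof
      show "control T w" unfolding w_def by (intro control_scale om) simp
      show "norm (X t - X s) \<le> w s t powr \<beta>" if st: "0 \<le> s" "s \<le> t" "t \<le> T" for s t
      proof -
        have "norm (X t - X s) \<le> hX * \<omega> s t powr \<beta>"
          using holder_norm2_bound[OF Xfin(1)[unfolded holder_norm_def] st] by (simp add: hX_def holder_norm_def)
        also have "\<dots> \<le> r * \<omega> s t powr \<beta>" using hXr by (intro mult_right_mono) auto
        finally show ?thesis using w_powr[OF st] by simp
      qed
      show "norm (XX s t) \<le> w s t powr (2 * \<beta>)" if st: "0 \<le> s" "s \<le> t" "t \<le> T" for s t
      proof -
        have "norm (XX s t) \<le> hXX * \<omega> s t powr (2 * \<beta>)"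
          using holder_norm2_bound[OF Xfin(2) st] by (simp add: hXX_def)
        also have "\<dots> \<le> r\<^sup>2 * \<omega> s t powr (2 * \<beta>)" using hXXr by (intro mult_right_mono) auto
        finally show ?thesis using w_powr[OF st] by simp
      qed
      show "XX s t = XX s u + XX u t + tensor (X u - X s) (X t - X u)"
        if "0 \<le> s" "s \<le> u" "u \<le> t" "t \<le> T" for s u t
        using X that unfolding rough_path_def by blast
      show "\<Phi> x \<in> cpath T" if "x \<in> cpath T" for x
        unfolding \<Phi>_def by (rule tilde_cpath[OF that])
    qed (use T0 \<beta>0 hyps in \<open>simp_all only: \<Phi>_def\<close>)
    obtain Z Z' where Z: "Z \<in> cpath T" and Z': "Z' \<in> cpath T"
      and eq: "\<And>t. 0 \<le> t \<Longrightarrow> t \<le> T \<Longrightarrow> Z' t = \<sigma> (Z t + \<Phi> Z t)"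
      and int: "\<And>t. 0 \<le> t \<Longrightarrow> t \<le> T \<Longrightarrow> has_rough_integral \<sigma> X XX Z Z' (\<Phi> Z) 0 t (Z t - \<xi>)"
      and bounds: "\<And>s t. 0 \<le> s \<Longrightarrow> s \<le> t \<Longrightarrow> t \<le> T \<Longrightarrow> norm (Z t - Z s) \<le> A_glob * w s t powr \<beta>"
        "\<And>s t. 0 \<le> s \<Longrightarrow> s \<le> t \<Longrightarrow> t \<le> T \<Longrightarrow> norm (Z' t - Z' s) \<le> M * (1 + \<rho>'') * A_glob * w s t powr \<beta>"
        "\<And>s t. 0 \<le> s \<Longrightarrow> s \<le> t \<Longrightarrow> t \<le> T \<Longrightarrow> total_variation (\<Phi> Z) s t \<le> ennreal (\<rho>'' * A_glob * w s t powr \<beta>)"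
        "\<And>s t. 0 \<le> s \<Longrightarrow> s \<le> t \<Longrightarrow> t \<le> T \<Longrightarrow> norm (remainder X Z Z' s t) \<le> R_const * w s t powr (2 * \<beta>)"
      using solution_exists by blast
    have const0: "0 \<le> A_glob * r" "0 \<le> M * (1 + \<rho>'') * A_glob * r" "0 \<le> \<rho>'' * A_glob * r" "0 \<le> R_const * r\<^sup>2"
      using A_glob_nonneg M1 \<rho>0 r0 consts_nonneg c2_ge1 \<eta>_pos by (auto simp: R_const_def)
    have n1: "holder_norm T \<omega> \<beta> Z \<le> ennreal (A_glob * r)"
      unfolding holder_norm_def using bounds(1) w_powr
      by (intro holder_norm2_le const0) (simp add: mult.assoc)
    have n2: "holder_norm T \<omega> \<beta> Z' \<le> ennreal (M * (1 + \<rho>'') * A_glob * r)"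
      unfolding holder_norm_def using bounds(2) w_powr
      by (intro holder_norm2_le const0) (simp add: mult.assoc)
    have n3: "variation_holder_norm T \<omega> \<beta> (\<Phi> Z) \<le> ennreal (\<rho>'' * A_glob * r)"
      using bounds(3) w_powr by (intro variation_holder_norm_le const0) (simp add: mult.assoc)
    have n4: "holder_norm2 T \<omega> (2 * \<beta>) (remainder X Z Z') \<le> ennreal (R_const * r\<^sup>2)"
      using bounds(4) w_powr by (intro holder_norm2_le const0) (simp add: mult.assoc)
    have E2: "(Z, Z') \<in> E2_solutions T \<omega> \<beta> X XX \<sigma> \<xi> C"
      unfolding E2_solutions_def controlled_paths_def mem_Collect_eq prod.case
      using Z Z' eq int n1 n2 n4 unfolding \<Phi>_def by (auto intro: le_less_trans simp del: mspace_cfunspace)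
    define N1 where "N1 = rough_norm_tilde T \<omega> \<beta> X XX"
    have N1: "N1 = r + r\<^sup>2 + r ^ 3"
      by (simp add: N1_def rough_norm_tilde_def r_def numeral_3_eq_3 numeral_2_eq_2)
    have rN: "r \<le> 1 + N1" and N10: "0 \<le> N1" using r0 by (auto simp: N1)
    have \<omega>0: "0 \<le> \<omega> 0 T" using control_nonneg[OF om] T0 by simp
    have "holder_norm T \<omega> \<beta> Z + holder_norm T \<omega> \<beta> Z' + variation_holder_norm T \<omega> \<beta> (\<Phi> Z)
        + holder_norm2 T \<omega> (2 * \<beta>) (remainder X Z Z')
      \<le> ennreal (A_glob * r) + ennreal (M * (1 + \<rho>'') * A_glob * r) + ennreal (\<rho>'' * A_glob * r) + ennreal (R_const * r\<^sup>2)"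
      by (intro add_mono n1 n2 n3 n4)
    also have "\<dots> = ennreal (A_glob * r + M * (1 + \<rho>'') * A_glob * r + \<rho>'' * A_glob * r + R_const * r\<^sup>2)"
      using const0 by simp
    also have "\<dots> \<le> ennreal (K_total * (1 + (1 + N1) powr (1 / \<beta>) * \<omega> 0 T) powr 1 * N1 powr 1)"
    proof (rule ennreal_leI)
      have "w 0 T \<le> (1 + N1) powr (1 / \<beta>) * \<omega> 0 T"
        unfolding w_def using rN r0 \<omega>0 \<beta>0 by (intro mult_right_mono powr_mono2) auto
      then have "K_total * (1 + w 0 T) * N1 \<le> K_total * (1 + (1 + N1) powr (1 / \<beta>) * \<omega> 0 T) * N1"
        using K_total_pos N10 by (intro mult_right_mono mult_left_mono) auto
      with total_constant_bound[OF r0] show "A_glob * r + M * (1 + \<rho>'') * A_glob * r + \<rho>'' * A_glob * r + R_const * r\<^sup>2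
        \<le> K_total * (1 + (1 + N1) powr (1 / \<beta>) * \<omega> 0 T) powr 1 * N1 powr 1"
        using N10 \<omega>0 by (simp add: N1[symmetric])
    qed
    finally have estimate: "holder_norm T \<omega> \<beta> Z + holder_norm T \<omega> \<beta> Z' + variation_holder_norm T \<omega> \<beta> (tilde T C Z)
        + holder_norm2 T \<omega> (2 * \<beta>) (remainder X Z Z')
      \<le> ennreal (K_total * (1 + (1 + N1) powr (1 / \<beta>) * \<omega> 0 T) powr 1 * N1 powr 1)"
      unfolding \<Phi>_def .
    let ?E1 = "E1_solutions T \<omega> \<beta> X XX \<sigma> \<xi> C" and ?E2 = "E2_solutions T \<omega> \<beta> X XX \<sigma> \<xi> C"
    let ?defby = "E1_defined_by T \<omega> \<beta> X XX \<sigma> \<xi> C"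
    let ?toZ = "Y_to_Z T \<omega> \<beta> X XX \<sigma> \<xi> C"
    have toZ: "?toZ Y = P" if "?defby Y P" for Y P
      unfolding Y_to_Z_def using that defined_by_unique by blast
    have toY_E1: "Z_to_Y T C P \<in> ?E1" if "P \<in> ?E2" for P
      using E2_defined_by[OF that] unfolding E1_solutions_def by blast
    have toZ_toY: "?toZ (Z_to_Y T C P) = P" if "P \<in> ?E2" for P
      by (rule toZ[OF E2_defined_by[OF that]])
    have toY_toZ: "Z_to_Y T C (?toZ Y) = Y" and toZ_E2: "?toZ Y \<in> ?E2" if Y: "Y \<in> ?E1" for Y
    proof -
      obtain P where P: "?defby Y P" using Y unfolding E1_solutions_def by blast
      show "Z_to_Y T C (?toZ Y) = Y" "?toZ Y \<in> ?E2"
        unfolding toZ[OF P] using defined_by_E2[OF P] by auto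
    qed
    \<comment> \<open>The two transformations are mutually inverse bijections between the solution
      sets, so having at most one element carries over in both directions.\<close>
    have uniq: "(\<exists>\<^sub>\<le>\<^sub>1Y. Y \<in> ?E1) \<longleftrightarrow> (\<exists>\<^sub>\<le>\<^sub>1P. P \<in> ?E2)"
      unfolding Uniq_def using toZ_toY toY_toZ toY_E1 toZ_E2 by metis
    show ?case
      unfolding Let_def N1_def[symmetric]
    proof (intro conjI)
      show "\<exists>(Z, Z')\<in>?E2. holder_norm T \<omega> \<beta> Z + holder_norm T \<omega> \<beta> Z' + variation_holder_norm T \<omega> \<beta> (tilde T C Z)
          + holder_norm2 T \<omega> (2 * \<beta>) (remainder X Z Z')
        \<le> ennreal (K_total * (1 + (1 + N1) powr (1 / \<beta>) * \<omega> 0 T) powr 1 * N1 powr 1)"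
        by (rule bexI[OF _ E2]) (simp only: prod.case estimate)
      show "\<forall>P\<in>?E2. Z_to_Y T C P \<in> ?E1" using toY_E1 by blast
      show "\<forall>Y P. ?defby Y P \<longrightarrow> P \<in> ?E2" using defined_by_E2(1) by blast
      show "\<forall>Y P Q. ?defby Y P \<longrightarrow> ?defby Y Q \<longrightarrow> P = Q" using defined_by_unique by blast
      show "\<forall>P\<in>?E2. ?toZ (Z_to_Y T C P) = P" using toZ_toY by blast
      show "\<forall>Y\<in>?E1. Z_to_Y T C (?toZ Y) = Y" using toY_toZ by blast
    qed (rule uniq)
  qed simp_all
qed

end
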